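(* Let $\Omega$ be a bounded domain in $\mathbb C^n$ with $\mathcal C^2$ boundary. Suppose there does not exist a constant $c>0$ such that $S_\Omega(z)\le 1-c\,d(z)$ for all $z\in\Omega$. Then $\Omega$ is biholomorphic to the unit ball $\mathbb B(0,1)\subset\mathbb C^n$.
   Context: For a bounded domain $\Omega\subset\mathbb C^n$ and $z\in\Omega$, the squeezing function is $S_\Omega(z)=\sup_f \sup\{r>0:\ \mathbb B(0,r)\subset f(\Omega)\}$, where the outer supremum runs over all injective holomorphic maps $f:\Omega\to\mathbb B(0,1)$ with $f(z)=0$; here $\mathbb B(0,r)$ is the open Euclidean ball of radius $r$ centered at $0$. $d(z)$ denotes the Euclidean distance from $z$ to $\partial\Omega$. *)

theory Defs
  imports "HOL-Analysis.Analysis"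
begin

definition holomorphic_on_cn ::
  "(complex ^ 'n \<Rightarrow> complex ^ 'm) \<Rightarrow> (complex ^ 'n) set \<Rightarrow> bool" where
  "holomorphic_on_cn f S \<longleftrightarrow>
     (\<forall>z\<in>S. \<exists>L. (f has_derivative L) (at z) \<and>
                 (\<forall>(c::complex) x. L (c *s x) = c *s L x))"

definition domain_cn :: "(complex ^ 'n) set \<Rightarrow> bool" where
  "domain_cn \<Omega> \<longleftrightarrow> open \<Omega> \<and> connected \<Omega> \<and> \<Omega> \<noteq> {}"

definition C2_boundary :: "(complex ^ 'n) set \<Rightarrow> bool" where
  "C2_boundary \<Omega> \<longleftrightarrow>
     (\<forall>p\<in>frontier \<Omega>. \<exists>U (\<rho> :: complex ^ 'n \<Rightarrow> real)
        (D :: complex ^ 'n \<Rightarrow> ((complex ^ 'n) \<Rightarrow>\<^sub>L real))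
        (D2 :: complex ^ 'n \<Rightarrow> ((complex ^ 'n) \<Rightarrow>\<^sub>L ((complex ^ 'n) \<Rightarrow>\<^sub>L real))).
        open U \<and> p \<in> U \<and>
        (\<forall>x\<in>U. (\<rho> has_derivative blinfun_apply (D x)) (at x)) \<and>
        (\<forall>x\<in>U. (D has_derivative blinfun_apply (D2 x)) (at x)) \<and>
        continuous_on U D2 \<and>
        (\<forall>z\<in>U. z \<in> \<Omega> \<longleftrightarrow> \<rho> z < 0) \<and>
        (\<forall>z\<in>U \<inter> frontier \<Omega>. D z \<noteq> 0))"

definition squeezing :: "(complex ^ 'n) set \<Rightarrow> complex ^ 'n \<Rightarrow> real" where
  "squeezing \<Omega> z = Sup {r. r > 0 \<and>
      (\<exists>f :: complex ^ 'n \<Rightarrow> complex ^ 'n.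
          holomorphic_on_cn f \<Omega> \<and> inj_on f \<Omega> \<and> f ` \<Omega> \<subseteq> ball 0 1 \<and>
          f z = 0 \<and> ball 0 r \<subseteq> f ` \<Omega>)}"

definition biholomorphic_cn :: "(complex ^ 'n) set \<Rightarrow> (complex ^ 'n) set \<Rightarrow> bool" where
  "biholomorphic_cn A B \<longleftrightarrow>
     (\<exists>f g :: complex ^ 'n \<Rightarrow> complex ^ 'n.
        holomorphic_on_cn f A \<and> holomorphic_on_cn g B \<and> f ` A = B \<and> g ` B = A \<and>
        (\<forall>x\<in>A. g (f x) = x) \<and> (\<forall>y\<in>B. f (g y) = y))"

end

(* Fix p in Omega. Harnack's inequality on balls touching a C^2 boundary from inside, followed by Harnack on
   compact sets, gives Re F(p) >= c d(z) Re F(z) for all z in Omega and all holomorphic F from Omega to the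
   right half plane. If f is an injective holomorphic map into the unit ball with f(z) = 0 and with a ball of
   radius r in its image, where 1 - r is small compared with d(z), apply this to F = 1 - <f, a/|a|>, a = f(p):
   1 - r is small compared with 1 - |a|. Hence the ball automorphism that moves a to 0 still maps the ball of
   radius r onto almost the whole unit ball, and there are injective holomorphic maps from Omega into the unit
   ball that send p to 0 and whose images exhaust it. By Montel's theorem these maps and their inverses (which are
   holomorphic, by Osgood's theorem) converge along a subsequence. The limit of the inverses is open by Hurwitz's
   theorem for its Jacobian determinant, so it takes its values in the interior of the closure of Omega, which is
   Omega; therefore the two limits are inverse to each other. *)
theory Submission
  imports Defs "HOL-Complex_Analysis.Great_Picard"
begin

section \<open>Holomorphic functions of several complex variables\<close>

text \<open>The inner ball must have a radius bounded below: at depth d(z) under the surface of such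
  a ball, Harnack's factor is linear in d(z), which is exactly the rate in the estimate for S. The
  function F has value 1 at z and real part 1 - |a| at p, so 1 - |a| is at least c d(z). Negating
  the estimate with constant \<epsilon> c / 8 yields a point z, depending on \<epsilon>, and a map
  with 1 - r below \<epsilon> (1 - |a|) / 8, while p stays fixed. The boundary regularity enters a
  second time: every boundary point is a limit of exterior points, which is why the interior of the
  closure adds nothing. The main obstacle is Osgood's theorem. The local theory of analytic sets is
  avoided by an induction on the number of coordinates that the map does not preserve, in which the
  zero set of the Jacobian determinant is examined only inside a plane spanned by two coordinate
  axes. Function theory in several variables is drawn from one variable along complex lines
  \<open>t \<mapsto> z + t *s v\<close>.\<close>

definition hol_fun :: "(complex ^ 'n \<Rightarrow> complex) \<Rightarrow> (complex ^ 'n) set \<Rightarrow> bool" where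
  "hol_fun f S \<longleftrightarrow>
     (\<forall>z\<in>S. \<exists>L. (f has_derivative L) (at z) \<and> (\<forall>c x. L (c *s x) = c * L x))"

text \<open>The complex partial derivative in coordinate \<open>l\<close>. Taking it as
  \<open>deriv\<close> of a slice makes it total and gives direct access to Cauchy's theory in one
  variable.\<close>

definition cpd :: "'n \<Rightarrow> (complex ^ 'n \<Rightarrow> complex) \<Rightarrow> complex ^ 'n \<Rightarrow> complex" where
  "cpd l f z = deriv (\<lambda>t. f (z + t *s axis l 1)) 0"

section \<open>Complex scalars and coordinates\<close>

lemma norm_cscale: "norm (c *s x) = norm c * norm (x :: complex ^ 'n)"
proof -
  have "norm (c *s x) = L2_set (\<lambda>i. norm c * norm (x $ i)) UNIV"
    by (simp add: norm_vec_def norm_mult)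
  also have "\<dots> = norm c * norm x"
    by (simp add: norm_vec_def L2_set_right_distrib)
  finally show ?thesis .
qed

lemma scaleR_cscale: "r *\<^sub>R x = complex_of_real r *s (x :: complex ^ 'n)"
  unfolding vec_eq_iff by (simp add: scaleR_conv_of_real[where 'a=complex])

lemma bounded_linear_cscale_left: "bounded_linear (\<lambda>t. t *s (v :: complex ^ 'n))"
  by (rule bounded_linear_intro[where K="norm v"])
     (simp_all add: vector_sadd_rdistrib norm_cscale scaleR_cscale scaleR_conv_of_real)

lemma norm_axis_complex [simp]: "norm (axis i (1 :: complex)) = 1"
proof -
  have "norm (axis i (1 :: complex)) = norm (\<chi> j. if j = i then (1 :: real) else 0)"
    by (auto simp: norm_vec_def axis_def intro!: arg_cong2[where f=L2_set])
  also have "\<dots> = 1"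
    using norm_axis_1[of i] by (simp add: axis_def)
  finally show ?thesis .
qed

lemma continuous_on_cscale [continuous_intros]:
  fixes v :: "'a::topological_space \<Rightarrow> complex ^ 'n"
  assumes "continuous_on S c" "continuous_on S v"
  shows "continuous_on S (\<lambda>x. c x *s v x)"
  unfolding vector_scalar_mult_def
  by (intro continuous_on_vec_lambda continuous_intros assms)

lemma has_derivative_vec_iff:
  fixes f :: "'a::real_normed_vector \<Rightarrow> complex ^ 'm"
  shows "(f has_derivative L) F \<longleftrightarrow> (\<forall>i. ((\<lambda>z. f z $ i) has_derivative (\<lambda>v. L v $ i)) F)"
proof
  assume "(f has_derivative L) F"
  then show "\<forall>i. ((\<lambda>z. f z $ i) has_derivative (\<lambda>v. L v $ i)) F"
    by (intro allI bounded_linear.has_derivative[OF bounded_linear_vec_nth])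
next
  assume *: "\<forall>i. ((\<lambda>z. f z $ i) has_derivative (\<lambda>v. L v $ i)) F"
  have lin: "bounded_linear (axis i :: complex \<Rightarrow> complex ^ 'm)" for i :: 'm
  proof -
    have "axis i = (\<lambda>x. x *s (axis i 1 :: complex ^ 'm))"
      by (auto simp: fun_eq_iff vec_eq_iff axis_def)
    then show ?thesis by (rule ssubst) (rule bounded_linear_cscale_left)
  qed
  have "((\<lambda>z. \<Sum>i\<in>UNIV. axis i (f z $ i)) has_derivative (\<lambda>v. \<Sum>i\<in>UNIV. axis i (L v $ i))) F"
    by (intro has_derivative_sum bounded_linear.has_derivative[OF lin] *[rule_format])
  moreover have "(\<Sum>i\<in>UNIV. axis i (x $ i)) = x" for x :: "complex ^ 'm"
    by (simp add: vec_eq_iff axis_def if_distrib cong: if_cong)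
  ultimately show "(f has_derivative L) F" by simp
qed

lemma holomorphic_on_cn_iff: "holomorphic_on_cn f S \<longleftrightarrow> (\<forall>i. hol_fun (\<lambda>z. f z $ i) S)"
proof
  assume f: "holomorphic_on_cn f S"
  show "\<forall>i. hol_fun (\<lambda>z. f z $ i) S"
    unfolding hol_fun_def
  proof (intro allI ballI)
    fix i z assume "z \<in> S"
    then obtain L where "(f has_derivative L) (at z)" "\<forall>c x. L (c *s x) = c *s L x"
      using f unfolding holomorphic_on_cn_def by blast
    then show "\<exists>L. ((\<lambda>z. f z $ i) has_derivative L) (at z) \<and> (\<forall>c x. L (c *s x) = c * L x)"
      by (intro exI[of _ "\<lambda>v. L v $ i"]) (simp add: has_derivative_vec_iff)
  qed
next
  assume *: "\<forall>i. hol_fun (\<lambda>z. f z $ i) S"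
  show "holomorphic_on_cn f S"
    unfolding holomorphic_on_cn_def
  proof
    fix z assume "z \<in> S"
    then have "\<forall>i. \<exists>L. ((\<lambda>z. f z $ i) has_derivative L) (at z) \<and> (\<forall>c x. L (c *s x) = c * L x)"
      using * unfolding hol_fun_def by blast
    then obtain L where "\<forall>i. ((\<lambda>z. f z $ i) has_derivative L i) (at z) \<and> (\<forall>c x. L i (c *s x) = c * L i x)"
      by metis
    then show "\<exists>L. (f has_derivative L) (at z) \<and> (\<forall>c x. L (c *s x) = c *s L x)"
      by (intro exI[of _ "\<lambda>v. \<chi> i. L i v"]) (simp add: has_derivative_vec_iff vec_eq_iff)
  qed
qed

lemma holomorphic_on_cn_imp_continuous:
  "holomorphic_on_cn f S \<Longrightarrow> continuous_on S f"
  unfolding holomorphic_on_cn_def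
  by (meson continuous_at_imp_continuous_on has_derivative_continuous)

lemma hol_fun_imp_continuous: "hol_fun f S \<Longrightarrow> continuous_on S f"
  unfolding hol_fun_def
  by (meson continuous_at_imp_continuous_on has_derivative_continuous)

lemma holomorphic_on_cn_subset: "holomorphic_on_cn f S \<Longrightarrow> T \<subseteq> S \<Longrightarrow> holomorphic_on_cn f T"
  unfolding holomorphic_on_cn_def by blast

lemma hol_fun_subset: "hol_fun f S \<Longrightarrow> T \<subseteq> S \<Longrightarrow> hol_fun f T"
  unfolding hol_fun_def by blast

section \<open>Algebra and composition of holomorphic functions\<close>

lemma hol_fun_const: "hol_fun (\<lambda>z. c) S"
  unfolding hol_fun_def by (intro ballI exI[of _ "\<lambda>v. 0"]) auto

lemma hol_fun_component: "hol_fun (\<lambda>z. z $ i) S"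
  unfolding hol_fun_def
  by (intro ballI exI[of _ "\<lambda>v. v $ i"] conjI allI bounded_linear_imp_has_derivative bounded_linear_vec_nth)
     simp

lemma hol_fun_add: "hol_fun f S \<Longrightarrow> hol_fun g S \<Longrightarrow> hol_fun (\<lambda>z. f z + g z) S"
  unfolding hol_fun_def
proof (intro ballI)
  fix z assume "\<forall>z\<in>S. \<exists>L. (f has_derivative L) (at z) \<and> (\<forall>c x. L (c *s x) = c * L x)"
    "\<forall>z\<in>S. \<exists>L. (g has_derivative L) (at z) \<and> (\<forall>c x. L (c *s x) = c * L x)" "z \<in> S"
  then obtain L M where "(f has_derivative L) (at z)" "\<forall>c x. L (c *s x) = c * L x"
    "(g has_derivative M) (at z)" "\<forall>c x. M (c *s x) = c * M x" by blast
  then show "\<exists>L. ((\<lambda>z. f z + g z) has_derivative L) (at z) \<and> (\<forall>c x. L (c *s x) = c * L x)"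
    by (intro exI[of _ "\<lambda>v. L v + M v"] conjI has_derivative_add)
       (simp_all add: distrib_left)
qed

lemma hol_fun_mult: "hol_fun f S \<Longrightarrow> hol_fun g S \<Longrightarrow> hol_fun (\<lambda>z. f z * g z) S"
  unfolding hol_fun_def
proof (intro ballI)
  fix z assume "\<forall>z\<in>S. \<exists>L. (f has_derivative L) (at z) \<and> (\<forall>c x. L (c *s x) = c * L x)"
    "\<forall>z\<in>S. \<exists>L. (g has_derivative L) (at z) \<and> (\<forall>c x. L (c *s x) = c * L x)" "z \<in> S"
  then obtain L M where "(f has_derivative L) (at z)" "\<forall>c x. L (c *s x) = c * L x"
    "(g has_derivative M) (at z)" "\<forall>c x. M (c *s x) = c * M x" by blast
  then show "\<exists>L. ((\<lambda>z. f z * g z) has_derivative L) (at z) \<and> (\<forall>c x. L (c *s x) = c * L x)"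
    by (intro exI[of _ "\<lambda>v. f z * M v + L v * g z"] conjI has_derivative_mult)
       (simp_all add: distrib_left mult.assoc mult.left_commute)
qed

lemma hol_fun_diff:
  assumes "hol_fun f S" "hol_fun g S"
  shows "hol_fun (\<lambda>z. f z - g z) S"
  using hol_fun_add[OF assms(1) hol_fun_mult[OF hol_fun_const[of "-1"] assms(2)]] by simp

lemma hol_fun_sum: "(\<And>i. i \<in> I \<Longrightarrow> hol_fun (f i) S) \<Longrightarrow> hol_fun (\<lambda>z. \<Sum>i\<in>I. f i z) S"
  by (induction I rule: infinite_finite_induct) (auto intro: hol_fun_const hol_fun_add)

lemma hol_fun_prod: "(\<And>i. i \<in> I \<Longrightarrow> hol_fun (f i) S) \<Longrightarrow> hol_fun (\<lambda>z. \<Prod>i\<in>I. f i z) S"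
  by (induction I rule: infinite_finite_induct) (auto intro: hol_fun_const hol_fun_mult)

lemma hol_fun_det:
  fixes A :: "complex ^ 'n \<Rightarrow> complex ^ 'm ^ 'm"
  assumes "\<And>i j. hol_fun (\<lambda>z. A z $ i $ j) S"
  shows "hol_fun (\<lambda>z. det (A z)) S"
  unfolding det_def by (intro hol_fun_sum hol_fun_mult hol_fun_const hol_fun_prod assms)

lemma hol_fun_holomorphic_compose:
  assumes f: "hol_fun f S" and h: "h holomorphic_on T" "open T" and "f ` S \<subseteq> T"
  shows "hol_fun (\<lambda>z. h (f z)) S"
  unfolding hol_fun_def
proof
  fix z assume z: "z \<in> S"
  then obtain L where L: "(f has_derivative L) (at z)" "\<forall>c x. L (c *s x) = c * L x"
    using f unfolding hol_fun_def by blast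
  have "(h has_derivative (\<lambda>t. deriv h (f z) * t)) (at (f z))"
    using holomorphic_derivI[OF h, of "f z"] z assms(4)
    by (auto simp: has_field_derivative_def)
  from has_derivative_compose[OF L(1) this] L(2)
  show "\<exists>L. ((\<lambda>z. h (f z)) has_derivative L) (at z) \<and> (\<forall>c x. L (c *s x) = c * L x)"
    by (intro exI[of _ "\<lambda>v. deriv h (f z) * L v"]) (auto simp: algebra_simps)
qed

lemma hol_fun_divide:
  assumes "hol_fun f S" "hol_fun g S" "\<And>z. z \<in> S \<Longrightarrow> g z \<noteq> 0"
  shows "hol_fun (\<lambda>z. f z / g z) S"
proof -
  have "hol_fun (\<lambda>z. inverse (g z)) S"
    by (rule hol_fun_holomorphic_compose[OF assms(2), where T="-{0}"])
       (auto intro!: holomorphic_intros simp: assms(3))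
  from hol_fun_mult[OF assms(1) this] show ?thesis by (simp add: field_simps)
qed

lemma hol_fun_compose:
  assumes f: "hol_fun f T" and g: "holomorphic_on_cn g S" and "g ` S \<subseteq> T"
  shows "hol_fun (\<lambda>z. f (g z)) S"
  unfolding hol_fun_def
proof
  fix z assume z: "z \<in> S"
  then obtain L where L: "(g has_derivative L) (at z)" "\<forall>c x. L (c *s x) = c *s L x"
    using g unfolding holomorphic_on_cn_def by blast
  obtain M where M: "(f has_derivative M) (at (g z))" "\<forall>c x. M (c *s x) = c * M x"
    using f z assms(3) unfolding hol_fun_def by blast
  from has_derivative_compose[OF L(1) M(1)] L(2) M(2)
  show "\<exists>L. ((\<lambda>z. f (g z)) has_derivative L) (at z) \<and> (\<forall>c x. L (c *s x) = c * L x)"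
    by (intro exI[of _ "\<lambda>v. M (L v)"]) auto
qed

lemma holomorphic_on_cn_compose:
  assumes "holomorphic_on_cn f T" "holomorphic_on_cn g S" "g ` S \<subseteq> T"
  shows "holomorphic_on_cn (\<lambda>z. f (g z)) S"
  using assms hol_fun_compose unfolding holomorphic_on_cn_iff[of "\<lambda>z. f (g z)"] holomorphic_on_cn_iff[of f] by blast

section \<open>Slices along complex lines and partial derivatives\<close>

lemma hol_fun_slice_derivative:
  fixes f :: "complex ^ 'n \<Rightarrow> complex"
  assumes L: "(f has_derivative L) (at (z + t0 *s v))" and h: "\<forall>c x. L (c *s x) = c * L x"
  shows "((\<lambda>t. f (z + t *s v)) has_field_derivative L v) (at t0)"
proof -
  have "((\<lambda>t. z + t *s v) has_derivative (\<lambda>t. t *s v)) (at t0)"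
  proof -
    have "((\<lambda>t. t *s v) has_derivative (\<lambda>t. t *s v)) (at t0)"
      by (rule bounded_linear_imp_has_derivative[OF bounded_linear_cscale_left])
    from has_derivative_add[OF has_derivative_const this, of z] show ?thesis by simp
  qed
  from has_derivative_compose[OF this L] h show ?thesis
    by (simp add: has_field_derivative_def mult_commute_abs)
qed

lemma hol_fun_slice:
  assumes "hol_fun f S" "\<And>t. t \<in> T \<Longrightarrow> z + t *s v \<in> S"
  shows "(\<lambda>t. f (z + t *s v)) holomorphic_on T"
  unfolding holomorphic_on_def
proof
  fix t assume "t \<in> T"
  then obtain L where "(f has_derivative L) (at (z + t *s v))" "\<forall>c x. L (c *s x) = c * L x"
    using assms unfolding hol_fun_def by blast
  from hol_fun_slice_derivative[OF this]
  show "(\<lambda>t. f (z + t *s v)) field_differentiable at t within T"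
    using field_differentiable_at_within field_differentiable_def by blast
qed

text \<open>A complex linear \<open>L\<close> is determined by its values on the axes, and the slice
  derivatives identify these values as \<open>cpd\<close>.\<close>

lemma hol_fun_has_derivative:
  assumes "hol_fun f S" "z \<in> S"
  shows "(f has_derivative (\<lambda>v. \<Sum>l\<in>UNIV. v $ l * cpd l f z)) (at z)"
proof -
  obtain L where L: "(f has_derivative L) (at z)" "\<forall>c x. L (c *s x) = c * L x"
    using assms unfolding hol_fun_def by blast
  have c: "cpd l f z = L (axis l 1)" for l
    unfolding cpd_def
    by (rule DERIV_imp_deriv, rule hol_fun_slice_derivative) (use L in auto)
  have lin: "linear L" using L(1) has_derivative_linear by blast
  have "L v = (\<Sum>l\<in>UNIV. v $ l * cpd l f z)" for v
    by (subst basis_expansion[symmetric], subst linear_sum[OF lin]) (use L(2) c in auto)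
  then have "L = (\<lambda>v. \<Sum>l\<in>UNIV. v $ l * cpd l f z)" by blast
  then show ?thesis using L(1) by simp
qed

lemma cpd_slice:
  assumes "hol_fun f S" "z + t0 *s axis l 1 \<in> S"
  shows "((\<lambda>t. f (z + t *s axis l 1)) has_field_derivative cpd l f (z + t0 *s axis l 1)) (at t0)"
proof -
  have "(\<Sum>k\<in>UNIV. axis l 1 $ k * cpd k f (z + t0 *s axis l 1)) = cpd l f (z + t0 *s axis l 1)"
    by (simp add: axis_def mult_if_delta)
  with hol_fun_slice_derivative[OF hol_fun_has_derivative[OF assms]]
  show ?thesis by (simp add: sum_distrib_left algebra_simps)
qed

lemma cpd_slice_derivative:
  assumes "hol_fun f S" "z + t0 *s v \<in> S"
  shows "((\<lambda>t. f (z + t *s v)) has_field_derivative (\<Sum>l\<in>UNIV. v $ l * cpd l f (z + t0 *s v))) (at t0)"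
  using hol_fun_slice_derivative[OF hol_fun_has_derivative[OF assms]]
  by (simp add: sum_distrib_left algebra_simps)

section \<open>Cauchy's formula with parameters\<close>

lemma cpd_cauchy_integral:
  fixes f :: "complex ^ 'n \<Rightarrow> complex"
  assumes f: "hol_fun f S" and r: "0 < r" and S: "cball z r \<subseteq> S"
  shows "cpd l f z = integral (cbox 0 1) (\<lambda>x.
    f (z + circlepath 0 r x *s axis l 1) / (circlepath 0 r x)\<^sup>2 *
      (2 * pi * \<i> * r * exp (2 * of_real pi * \<i> * x)) / (2 * pi * \<i>))"
proof -
  let ?h = "\<lambda>t. f (z + t *s axis l 1)"
  have hol: "?h holomorphic_on cball 0 r"
    by (rule hol_fun_slice[OF f]) (use S in \<open>auto simp: dist_norm norm_cscale subset_iff\<close>)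
  have "(?h has_field_derivative (1 / (2 * of_real pi * \<i>) *
      contour_integral (circlepath 0 r) (\<lambda>u. ?h u / (u - 0)^2))) (at 0)"
    by (rule Cauchy_derivative_integral_circlepath)
       (use hol r in \<open>auto intro: holomorphic_on_imp_continuous_on holomorphic_on_subset\<close>)
  then have "cpd l f z = 1 / (2 * of_real pi * \<i>) * contour_integral (circlepath 0 r) (\<lambda>u. ?h u / u^2)"
    unfolding cpd_def by (auto dest: DERIV_imp_deriv)
  also have "\<dots> = integral {0..1} (\<lambda>x. 1 / (2 * of_real pi * \<i>) *
      (?h (circlepath 0 r x) / (circlepath 0 r x)\<^sup>2 * (2 * pi * \<i> * r * exp (2 * of_real pi * \<i> * x))))"
    unfolding contour_integral_integral vector_derivative_circlepath integral_mult_right ..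
  finally show ?thesis by (simp add: mult.commute)
qed

text \<open>The part \<gamma>'(x) / (2 \<pi> i \<gamma>(x)^2) of Cauchy's formula for a first
  derivative that depends neither on the function nor on the centre.\<close>

definition circ_kernel :: "real \<Rightarrow> real \<Rightarrow> complex" where
  "circ_kernel r x = (2 * pi * \<i> * r * exp (2 * of_real pi * \<i> * x)) /
     (circlepath 0 r x)\<^sup>2 / (2 * pi * \<i>)"

text \<open>In this form \<open>z\<close> enters only through the argument of \<open>f\<close>, so
  theorems on parameter integrals over a fixed interval transfer regularity from \<open>f\<close> to
  \<open>cpd l f\<close>.\<close>

lemma circ_kernel_cauchy:
  fixes f :: "complex ^ 'n \<Rightarrow> complex"
  assumes "hol_fun f S" "0 < r" "cball z r \<subseteq> S"
  shows "cpd l f z = integral (cbox 0 1) (\<lambda>x. circ_kernel r x * f (z + circlepath 0 r x *s axis l 1))"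
  unfolding cpd_cauchy_integral[OF assms] circ_kernel_def
  by (rule arg_cong[where f="integral _"]) (simp add: fun_eq_iff mult.commute)

lemma continuous_on_circlepath: "continuous_on A (circlepath z r)"
  unfolding circlepath by (intro continuous_intros)

lemma continuous_on_circ_kernel: "r > 0 \<Longrightarrow> continuous_on A (circ_kernel r)"
  unfolding circ_kernel_def
  by (intro continuous_intros continuous_on_circlepath) (auto simp: circlepath)

text \<open>One radius serves all centres in \<open>ball z0 r\<close>; hence the kernel does not
  vary with \<open>z\<close> when the integral is differentiated.\<close>

lemma circlepath_mem:
  fixes z :: "complex ^ 'n"
  assumes "z \<in> ball z0 r" "ball z0 (2 * r) \<subseteq> S"
  shows "z + circlepath 0 r x *s axis l 1 \<in> S" "cball z r \<subseteq> S" "r > 0"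
proof -
  show r: "r > 0" using assms(1) by (metis mem_ball order_le_less_trans zero_le_dist)
  show 1: "cball z r \<subseteq> S"
  proof
    fix w assume "w \<in> cball z r"
    then have "dist z0 w < 2 * r"
      using assms(1) dist_triangle[of z0 w z] by (simp add: dist_commute)
    then show "w \<in> S" using assms(2) by auto
  qed
  have "norm (circlepath 0 r x) = r" using r by (simp add: circlepath norm_mult)
  then show "z + circlepath 0 r x *s axis l 1 \<in> S"
    by (intro subsetD[OF 1]) (simp add: dist_norm norm_cscale)
qed

lemma cpd_continuous:
  fixes f :: "complex ^ 'n \<Rightarrow> complex"
  assumes f: "hol_fun f S" and "open S"
  shows "continuous_on S (cpd l f)"
proof (rule continuous_at_imp_continuous_on, rule ballI)
  fix z0 assume "z0 \<in> S"
  then obtain e where e: "e > 0" "ball z0 e \<subseteq> S" using \<open>open S\<close> openE by blast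
  define r where "r = e / 2"
  have r: "r > 0" "ball z0 (2 * r) \<subseteq> S" using e by (auto simp: r_def)
  note mem = circlepath_mem[OF _ r(2)]
  have "continuous_on (ball z0 r)
      (\<lambda>z. integral (cbox 0 1) (\<lambda>x. circ_kernel r x * f (z + circlepath 0 r x *s axis l 1)))"
  proof (rule integral_continuous_on_param)
    have "continuous_on (ball z0 r \<times> cbox 0 1) (\<lambda>p. f (fst p + circlepath 0 r (snd p) *s axis l 1))"
      by (rule continuous_on_compose2[OF hol_fun_imp_continuous[OF f]])
         (auto intro!: continuous_intros continuous_on_compose2[OF continuous_on_circlepath[of UNIV]] mem)
    then show "continuous_on (ball z0 r \<times> cbox 0 1)
        (\<lambda>(z, x). circ_kernel r x * f (z + circlepath 0 r x *s axis l 1))"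
      by (auto simp: case_prod_unfold intro!: continuous_intros
          continuous_on_compose2[OF continuous_on_circ_kernel[OF r(1), of UNIV]])
  qed
  then have "continuous_on (ball z0 r) (cpd l f)"
    using circ_kernel_cauchy[OF f r(1) mem(2)] by (metis (no_types, lifting) continuous_on_cong)
  then show "isCont (cpd l f) z0"
    using r(1) by (simp add: continuous_on_eq_continuous_at)
qed

text \<open>The total derivative as an element of a normed space, so that its continuity refers to
  the operator norm, as differentiation under the integral and the mean value inequality
  require.\<close>

definition cderiv :: "(complex ^ 'n \<Rightarrow> complex) \<Rightarrow> complex ^ 'n \<Rightarrow> (complex ^ 'n) \<Rightarrow>\<^sub>L complex" where
  "cderiv f z = Blinfun (\<lambda>v. \<Sum>l\<in>UNIV. v $ l * cpd l f z)"

lemma cderiv_apply [simp]: "blinfun_apply (cderiv f z) v = (\<Sum>l\<in>UNIV. v $ l * cpd l f z)"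
proof -
  have "bounded_linear (\<lambda>v. \<Sum>l\<in>UNIV. v $ l * cpd l f z)"
    by (intro bounded_linear_sum bounded_linear_compose[OF bounded_linear_mult_left bounded_linear_vec_nth])
  then show ?thesis unfolding cderiv_def by (simp add: bounded_linear_Blinfun_apply)
qed

lemma hol_fun_has_cderiv:
  "hol_fun f S \<Longrightarrow> z \<in> S \<Longrightarrow> (f has_derivative blinfun_apply (cderiv f z)) (at z)"
  by (rule has_derivative_eq_rhs[OF hol_fun_has_derivative]) (simp_all add: fun_eq_iff)

lemma cderiv_continuous: "hol_fun f S \<Longrightarrow> open S \<Longrightarrow> continuous_on S (cderiv f)"
  by (intro continuous_on_blinfun_componentwise)
     (auto intro!: continuous_intros cpd_continuous)

text \<open>Differentiate Cauchy's formula under the integral sign. The resulting derivative is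
  complex linear because the derivative of the integrand is so for each value of the circle
  parameter.\<close>

lemma hol_fun_cpd:
  fixes f :: "complex ^ 'n \<Rightarrow> complex"
  assumes f: "hol_fun f S" and "open S"
  shows "hol_fun (cpd l f) S"
  unfolding hol_fun_def
proof
  fix z0 assume "z0 \<in> S"
  then obtain e where e: "e > 0" "ball z0 e \<subseteq> S" using \<open>open S\<close> openE by blast
  define r where "r = e / 2"
  have r: "r > 0" "ball z0 (2 * r) \<subseteq> S" using e by (auto simp: r_def)
  note mem = circlepath_mem[OF _ r(2)]
  let ?w = "\<lambda>z x. z + circlepath 0 r x *s axis l 1"
  let ?D = "\<lambda>z x. blinfun_mult_right (circ_kernel r x) o\<^sub>L cderiv f (?w z x)"
  have cf: "continuous_on (ball z0 r \<times> cbox 0 1) (\<lambda>(z, x). ?D z x)"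
  proof -
    have "continuous_on (ball z0 r \<times> cbox 0 1) (\<lambda>p. cderiv f (?w (fst p) (snd p)))"
      by (rule continuous_on_compose2[OF cderiv_continuous[OF f \<open>open S\<close>]])
         (auto intro!: continuous_intros continuous_on_compose2[OF continuous_on_circlepath[of UNIV]] mem)
    then show ?thesis
      by (auto simp: case_prod_unfold intro!: continuous_intros
          continuous_on_compose2[OF continuous_on_circ_kernel[OF r(1), of UNIV]])
  qed
  have der: "((\<lambda>z. integral (cbox 0 1) (\<lambda>x. circ_kernel r x * f (?w z x))) has_derivative
      blinfun_apply (integral (cbox 0 1) (?D z0))) (at z0 within ball z0 r)"
  proof (rule leibniz_rule[OF _ _ cf])
    fix z x assume z: "z \<in> ball z0 r" "x \<in> cbox (0::real) 1"
    have "((\<lambda>z. ?w z x) has_derivative (\<lambda>v. v)) (at z within ball z0 r)"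
      by (auto intro!: derivative_eq_intros)
    from has_derivative_compose[OF this hol_fun_has_cderiv[OF f mem(1)[OF z(1)]]]
    show "((\<lambda>z. circ_kernel r x * f (?w z x)) has_derivative blinfun_apply (?D z x)) (at z within ball z0 r)"
      by (auto intro!: derivative_eq_intros simp: sum_distrib_left)
  next
    fix z assume z: "z \<in> ball z0 r"
    show "(\<lambda>x. circ_kernel r x * f (?w z x)) integrable_on cbox 0 1"
      by (intro integrable_continuous continuous_intros continuous_on_circ_kernel r
          continuous_on_compose2[OF hol_fun_imp_continuous[OF f]] continuous_on_circlepath)
         (use mem(1)[OF z] in auto)
  qed (use r in auto)
  have int: "?D z0 integrable_on cbox 0 1"
  proof (rule integrable_continuous)
    have "continuous_on (cbox 0 1) (\<lambda>x. case (z0, x) of (z, x) \<Rightarrow> ?D z x)"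
      by (rule continuous_on_compose2[OF cf])
         (use r in \<open>auto intro!: continuous_on_Pair continuous_on_const continuous_on_id\<close>)
    then show "continuous_on (cbox 0 1) (?D z0)" by (simp only: prod.case)
  qed
  have at: "at z0 within ball z0 r = at z0" by (rule at_within_open) (use r in simp_all)
  have "(cpd l f has_derivative blinfun_apply (integral (cbox 0 1) (?D z0))) (at z0 within ball z0 r)"
    by (rule has_derivative_transform[OF _ _ der])
       (use r circ_kernel_cauchy[OF f r(1) mem(2)] in auto)
  moreover have "blinfun_apply (integral (cbox 0 1) (?D z0)) (c *s v) =
      c * blinfun_apply (integral (cbox 0 1) (?D z0)) v" for c v
    unfolding blinfun_apply_integral[OF int] integral_mult_right[symmetric]
    by (rule arg_cong[where f="integral _"]) (simp add: fun_eq_iff sum_distrib_left algebra_simps)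
  ultimately show "\<exists>L. (cpd l f has_derivative L) (at z0) \<and> (\<forall>c x. L (c *s x) = c * L x)"
    unfolding at by blast
qed

lemma cpd_iterate_hol_fun:
  assumes "hol_fun q S" "open S"
  shows "hol_fun ((cpd l ^^ n) q) S"
  by (induction n) (simp_all add: assms hol_fun_cpd)

text \<open>This translates orders of vanishing in a coordinate direction into iterated
  \<open>cpd\<close>, which are again holomorphic in all variables.\<close>

lemma higher_deriv_slice:
  fixes q :: "complex ^ 'n \<Rightarrow> complex"
  assumes q: "hol_fun q S" "open S" and T: "open T" "\<And>t. t \<in> T \<Longrightarrow> z + t *s axis l 1 \<in> S" and "t \<in> T"
  shows "(deriv ^^ n) (\<lambda>t. q (z + t *s axis l 1)) t = (cpd l ^^ n) q (z + t *s axis l 1)"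
  using \<open>t \<in> T\<close>
proof (induction n arbitrary: t)
  case 0
  then show ?case by simp
next
  case (Suc n)
  have "(deriv ^^ Suc n) (\<lambda>t. q (z + t *s axis l 1)) t = deriv ((deriv ^^ n) (\<lambda>t. q (z + t *s axis l 1))) t"
    by simp
  also have "\<dots> = deriv (\<lambda>t. (cpd l ^^ n) q (z + t *s axis l 1)) t"
    by (rule deriv_cong_ev)
       (use Suc T in \<open>auto simp: eventually_nhds\<close>)
  also have "\<dots> = cpd l ((cpd l ^^ n) q) (z + t *s axis l 1)"
    by (rule DERIV_imp_deriv[OF cpd_slice[OF cpd_iterate_hol_fun[OF q] T(2)[OF Suc.prems]]])
  finally show ?case by simp
qed

section \<open>Injective holomorphic maps have nonvanishing Jacobian\<close>

text \<open>Continuity of \<open>cderiv\<close> and the mean value inequality on a small ball give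
  an estimate uniform in both points. It allows two nearby zeros to be compared without one of them
  being the base point.\<close>

lemma hol_fun_strict_derivative:
  fixes f :: "complex ^ 'n \<Rightarrow> complex"
  assumes f: "hol_fun f S" "open S" and "z0 \<in> S" "e > 0"
  obtains r where "r > 0" "ball z0 r \<subseteq> S"
    "\<And>x y. x \<in> ball z0 r \<Longrightarrow> y \<in> ball z0 r \<Longrightarrow>
      norm (f x - f y - blinfun_apply (cderiv f z0) (x - y)) \<le> e * norm (x - y)"
proof -
  obtain r1 where r1: "r1 > 0" "ball z0 r1 \<subseteq> S" using f(2) \<open>z0 \<in> S\<close> openE by blast
  have "isCont (cderiv f) z0"
    using cderiv_continuous[OF f] f(2) \<open>z0 \<in> S\<close> continuous_on_eq_continuous_at by blast
  then obtain r2 where r2: "r2 > 0" "\<And>x. dist x z0 < r2 \<Longrightarrow> dist (cderiv f x) (cderiv f z0) < e"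
    using \<open>e > 0\<close> unfolding continuous_at_eps_delta by blast
  define r where "r = min r1 r2"
  have sub: "ball z0 r \<subseteq> S" using r1 by (auto simp: r_def)
  show ?thesis
  proof (rule that[of r])
    fix x y assume xy: "x \<in> ball z0 r" "y \<in> ball z0 r"
    have "norm (f x - f y - blinfun_apply (cderiv f z0) (x - y)) \<le> norm (x - y) * e"
    proof (rule differentiable_bound_linearization[where S="ball z0 r" and f'="\<lambda>x. blinfun_apply (cderiv f x)"])
      fix t :: real assume "t \<in> {0..1}"
      then show "y + t *\<^sub>R (x - y) \<in> ball z0 r"
        using convexD_alt[OF convex_ball xy(2,1), of t] by (simp add: algebra_simps)
    next
      fix x assume x: "x \<in> ball z0 r"
      then show "(f has_derivative blinfun_apply (cderiv f x)) (at x within ball z0 r)"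
        using hol_fun_has_cderiv[OF f(1)] sub has_derivative_at_withinI by blast
      have "onorm (blinfun_apply (cderiv f x) - blinfun_apply (cderiv f z0)) = norm (cderiv f x - cderiv f z0)"
        by (simp only: norm_blinfun.rep_eq minus_blinfun.rep_eq fun_diff_def)
      also have "\<dots> \<le> e"
        using r2(2)[of x] x by (simp add: dist_norm[symmetric] dist_commute r_def less_imp_le)
      finally show "onorm (blinfun_apply (cderiv f x) - blinfun_apply (cderiv f z0)) \<le> e" .
    qed (use r1(1) r2(1) in \<open>simp add: r_def\<close>)
    then show "norm (f x - f y - blinfun_apply (cderiv f z0) (x - y)) \<le> e * norm (x - y)"
      by (simp add: mult.commute)
  qed (use r1 r2 sub in \<open>auto simp: r_def\<close>)
qed

lemma cderiv_axes:
  fixes f :: "complex ^ 'n \<Rightarrow> complex"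
  assumes "l1 \<noteq> l2"
  shows "blinfun_apply (cderiv f z) (a *s axis l1 1 + b *s axis l2 1) = a * cpd l1 f z + b * cpd l2 f z"
proof -
  have "(a * axis l1 1 $ l + b * axis l2 1 $ l) * cpd l f z =
      (if l = l1 then a * cpd l1 f z else 0) + (if l = l2 then b * cpd l2 f z else 0)" for l
    using assms by (auto simp: axis_def)
  then show ?thesis by (simp add: sum.distrib)
qed

text \<open>A nonzero derivative of any order at 0 rules out that \<open>h\<close> vanishes
  identically, and then its zero at 0 is isolated. Half the isolating radius makes the closed disc
  available.\<close>

lemma nonzero_slice_isolated:
  fixes h :: "complex \<Rightarrow> complex"
  assumes h: "h holomorphic_on ball 0 r" "r > 0" "h 0 = 0" and n: "(deriv ^^ n) h 0 \<noteq> 0"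
  obtains d where "0 < d" "d < r" "\<And>t. norm t \<le> d \<Longrightarrow> t \<noteq> 0 \<Longrightarrow> h t \<noteq> 0"
proof -
  have "\<exists>b\<in>ball 0 r. h b \<noteq> 0"
  proof (rule ccontr)
    assume "\<not> (\<exists>b\<in>ball 0 r. h b \<noteq> 0)"
    then have "(deriv ^^ n) h 0 = (deriv ^^ n) (\<lambda>_. 0) 0"
      using \<open>r > 0\<close> by (intro higher_deriv_cong_ev) (auto simp: eventually_nhds intro!: exI[of _ "ball 0 r"])
    then show False using n by simp
  qed
  then obtain b where "b \<in> ball 0 r" "h b \<noteq> 0" by blast
  then obtain d0 where d0: "0 < d0" "ball 0 d0 \<subseteq> ball (0::complex) r" "\<And>z. z \<in> ball 0 d0 - {0} \<Longrightarrow> h z \<noteq> 0"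
    using isolated_zeros[OF h(1), of 0 b] h by auto
  have "d0 \<le> r" using d0(1,2) h(2) by (simp add: ball_subset_ball_iff)
  then show ?thesis using that[of "d0 / 2"] d0 by auto
qed

text \<open>A quantitative form of Hurwitz's theorem. Without a zero, the maximum principle for
  \<open>1 / g\<close> carries the lower bound \<open>\<eta> / 2\<close> from the circle to the
  centre, but \<open>g 0\<close> is smaller than that.\<close>

lemma zeros_persist:
  fixes g h :: "complex \<Rightarrow> complex"
  assumes g: "g holomorphic_on cball 0 d" and "d > 0"
    and h: "\<And>t. norm t = d \<Longrightarrow> norm (h t) \<ge> \<eta>" "h 0 = 0"
    and close: "\<And>t. norm t \<le> d \<Longrightarrow> norm (g t - h t) < \<eta> / 2"
  shows "\<exists>t. norm t \<le> d \<and> g t = 0"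
proof (rule ccontr)
  assume "\<not> ?thesis"
  then have nz: "\<And>t. norm t \<le> d \<Longrightarrow> g t \<noteq> 0" by blast
  have "\<eta> > 0" using close[of 0] \<open>d > 0\<close> norm_ge_zero[of "g 0 - h 0"] by (simp del: norm_ge_zero)
  have "norm (1 / g 0) \<le> 2 / \<eta>"
  proof (rule maximum_modulus_frontier[of "\<lambda>t. 1 / g t" "cball 0 d"])
    show "(\<lambda>t. 1 / g t) holomorphic_on interior (cball 0 d)"
      by (intro holomorphic_intros holomorphic_on_subset[OF g]) (use nz in auto)
    show "continuous_on (closure (cball 0 d)) (\<lambda>t. 1 / g t)"
      by (simp, intro continuous_intros holomorphic_on_imp_continuous_on[OF g]) (use nz in auto)
    fix t :: complex assume "t \<in> frontier (cball 0 d)"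
    then have t: "norm t = d" using \<open>d > 0\<close> by (simp add: frontier_cball)
    have "norm (g t) \<ge> norm (h t) - norm (g t - h t)"
      by (metis norm_minus_commute norm_triangle_ineq2 diff_le_eq add.commute)
    then have "norm (g t) \<ge> \<eta> / 2" using h(1)[OF t] close[of t] t by simp
    then show "norm (1 / g t) \<le> 2 / \<eta>"
      using \<open>\<eta> > 0\<close> nz[of t] t by (simp add: norm_divide divide_le_eq le_divide_eq mult.commute)
  qed (use \<open>d > 0\<close> in auto)
  moreover have "norm (g 0) < \<eta> / 2" using close[of 0] h(2) \<open>d > 0\<close> by simp
  ultimately show False using nz[of 0] \<open>d > 0\<close> \<open>\<eta> > 0\<close> by (simp add: norm_divide field_simps)
qed

text \<open>
  At a zero of \<open>q\<close> of minimal order \<open>K\<close> in the direction \<open>l2\<close>, the function \<open>D = (cpd l2 ^^ (K - 1)) q\<close> vanishes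
  on the zeros of \<open>q\<close> and has \<open>cpd l2 D \<noteq> 0\<close>. Within the plane of \<open>l1\<close> and \<open>l2\<close> the zeros of \<open>q\<close> near that point
  therefore form a Lipschitz graph over the \<open>l1\<close>-axis, and \<open>F\<close> is constant along this graph.
\<close>

lemma singular_zero_set_not_injective:
  fixes F :: "complex ^ 'n \<Rightarrow> complex ^ 'm" and q :: "complex ^ 'n \<Rightarrow> complex"
  assumes "open S" and F: "\<And>k. hol_fun (\<lambda>z. F z $ k) S" and q: "hol_fun q S"
    and "a \<in> S" "q a = 0" and l12: "l1 \<noteq> l2"
    and crit: "\<And>z k. z \<in> S \<Longrightarrow> q z = 0 \<Longrightarrow> cpd l1 (\<lambda>z. F z $ k) z = 0 \<and> cpd l2 (\<lambda>z. F z $ k) z = 0"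
  shows "\<not> inj_on F S"
proof
  assume inj: "inj_on F S"
  define e1 e2 :: "complex ^ 'n" where "e1 = axis l1 1" and "e2 = axis l2 1"
  have ne: "norm e1 = 1" "norm e2 = 1" by (simp_all add: e1_def e2_def)
  note hol_d = cpd_iterate_hol_fun[OF q \<open>open S\<close>]
  \<comment> \<open>If all derivatives in direction \<open>l2\<close> vanished at a zero, then
    \<open>q\<close> would vanish on a disc in that direction. By \<open>crit\<close> the components
    of \<open>F\<close> would be constant there, against injectivity.\<close>
  have ex: "\<exists>k. (cpd l2 ^^ k) q z \<noteq> 0" if z: "z \<in> S" "q z = 0" for z
  proof (rule ccontr)
    assume "\<not> ?thesis"
    then have all0: "\<And>k. (cpd l2 ^^ k) q z = 0" by blast
    obtain r where r: "r > 0" "ball z r \<subseteq> S" using \<open>open S\<close> z(1) openE by blast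
    have mem: "z + t *s e2 \<in> S" if "t \<in> ball 0 r" for t
      using that r by (auto simp: subset_iff dist_norm norm_cscale ne)
    have "q (z + t *s e2) = 0" if t: "t \<in> ball 0 r" for t
    proof (rule holomorphic_fun_eq_0_on_connected[where S="ball 0 r" and f="\<lambda>t. q (z + t *s e2)" and z=0])
      show "(\<lambda>t. q (z + t *s e2)) holomorphic_on ball 0 r"
        by (rule hol_fun_slice[OF q]) (rule mem)
      show "(deriv ^^ n) (\<lambda>t. q (z + t *s e2)) 0 = 0" for n
        using higher_deriv_slice[OF q \<open>open S\<close> open_ball[of 0 r], where z=z and l=l2 and n=n and t=0] mem r(1) all0
        by (simp add: e2_def)
    qed (use r t in auto)
    then have d0: "((\<lambda>t. F (z + t *s e2) $ k) has_field_derivative 0) (at t)" if "t \<in> ball 0 r" for t k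
      using cpd_slice[OF F[of k], of z t l2] mem that crit[of "z + t *s e2" k] by (simp add: e2_def)
    have mr: "of_real (r/2) \<in> ball (0::complex) r" "(0::complex) \<in> ball 0 r" using r by auto
    have "F (z + of_real (r/2) *s e2) $ k = F (z + 0 *s e2) $ k" for k
    proof -
      have "\<exists>c. \<forall>t\<in>ball 0 r. F (z + t *s e2) $ k = c"
        by (rule has_field_derivative_zero_constant[OF convex_ball]) (rule has_field_derivative_at_within[OF d0])
      then obtain c where "\<forall>t\<in>ball 0 r. F (z + t *s e2) $ k = c" ..
      with mr show ?thesis by metis
    qed
    then have "F (z + of_real (r/2) *s e2) = F z" by (simp add: vec_eq_iff)
    from inj_onD[OF inj this mem[OF mr(1)] z(1)] have "of_real (r/2) *s e2 = 0" by simp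
    then have "norm (of_real (r/2) *s e2) = 0" by simp
    then show False using r unfolding norm_cscale ne by simp
  qed
  \<comment> \<open>The minimum is taken over all zeros of \<open>q\<close> in \<open>S\<close> at
    once; minimality at a single zero would not make \<open>D\<close> vanish at the neighbouring
    ones.\<close>
  define K where "K = (LEAST k. \<exists>z\<in>S. q z = 0 \<and> (cpd l2 ^^ k) q z \<noteq> 0)"
  have "\<exists>k. \<exists>z\<in>S. q z = 0 \<and> (cpd l2 ^^ k) q z \<noteq> 0" using ex \<open>a \<in> S\<close> \<open>q a = 0\<close> by blast
  then have "\<exists>z\<in>S. q z = 0 \<and> (cpd l2 ^^ K) q z \<noteq> 0" unfolding K_def by (rule LeastI_ex)
  then obtain z0 where z0: "z0 \<in> S" "q z0 = 0" "(cpd l2 ^^ K) q z0 \<noteq> 0" by blast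
  have "K \<noteq> 0" using z0 by (metis funpow_0)
  then obtain m where K: "K = Suc m" by (cases K) auto
  define D where "D = (cpd l2 ^^ m) q"
  have D_hol: "hol_fun D S" unfolding D_def by (rule hol_d)
  have D0: "D z = 0" if "z \<in> S" "q z = 0" for z
    using not_less_Least[of m "\<lambda>k. \<exists>z\<in>S. q z = 0 \<and> (cpd l2 ^^ k) q z \<noteq> 0"] that K
    unfolding K_def[symmetric] D_def by auto
  define c where "c = cpd l2 D z0"
  have c: "c \<noteq> 0" using z0(3) by (simp add: c_def D_def K)
  obtain \<rho> where \<rho>: "\<rho> > 0" "ball z0 \<rho> \<subseteq> S"
    and strict: "\<And>x y. x \<in> ball z0 \<rho> \<Longrightarrow> y \<in> ball z0 \<rho> \<Longrightarrow>
      norm (D x - D y - blinfun_apply (cderiv D z0) (x - y)) \<le> norm c / 2 * norm (x - y)"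
    using hol_fun_strict_derivative[OF D_hol \<open>open S\<close> z0(1), of "norm c / 2"] c by auto
  \<comment> \<open>Two zeros satisfy |c| |t - t'| \<le> |A| |s - s'| + |c|/2 (|s - s'| + |t - t'|)
    with A = \<open>cpd l1 D z0\<close>; absorbing the last term on the left leaves this
    slope.\<close>
  define C where "C = 2 * norm (cpd l1 D z0) / norm c + 1"
  define pt where "pt s t = z0 + (s *s e1 + t *s e2)" for s t
  have pt_diff: "pt s t - pt s' t' = (s - s') *s e1 + (t - t') *s e2" for s t s' t'
    by (simp add: pt_def vector_sub_rdistrib)
  have npt: "norm (s *s e1 + t *s e2) \<le> norm s + norm t" for s t
    using norm_triangle_ineq[of "s *s e1" "t *s e2"] by (simp add: norm_cscale ne)
  have lip: "norm (t - t') \<le> C * norm (s - s')"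
    if "pt s t \<in> ball z0 \<rho>" "pt s' t' \<in> ball z0 \<rho>" "q (pt s t) = 0" "q (pt s' t') = 0" for s t s' t'
  proof -
    let ?A = "cpd l1 D z0"
    have "D (pt s t) = 0" "D (pt s' t') = 0" using that \<rho>(2) D0 by blast+
    then have "norm ((s - s') * ?A + (t - t') * c) \<le> norm c / 2 * norm ((s - s') *s e1 + (t - t') *s e2)"
      using strict[OF that(1,2)] cderiv_axes[OF l12, of D z0 "s - s'" "t - t'"]
      unfolding pt_diff by (simp add: e1_def e2_def c_def norm_minus_commute)
    also have "\<dots> \<le> norm c / 2 * (norm (s - s') + norm (t - t'))"
      by (intro mult_left_mono npt) auto
    finally have 1: "norm ((s - s') * ?A + (t - t') * c) \<le> norm c / 2 * (norm (s - s') + norm (t - t'))" .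
    have "norm ((t - t') * c) \<le> norm ((s - s') * ?A + (t - t') * c) + norm ((s - s') * ?A)"
      by (metis add.commute norm_diff_ineq diff_le_eq)
    then have "norm (t - t') * norm c \<le> norm c / 2 * (norm (s - s') + norm (t - t')) + norm (s - s') * norm ?A"
      using 1 by (simp add: norm_mult)
    then have "norm c * norm (t - t') \<le> (2 * norm ?A + norm c) * norm (s - s')"
      by (simp add: algebra_simps)
    also have "2 * norm ?A + norm c = norm c * C"
      using c by (simp add: C_def field_simps)
    finally have "norm c * norm (t - t') \<le> norm c * (C * norm (s - s'))"
      by (simp add: mult.assoc)
    then show ?thesis using c by simp
  qed
  have slice0: "q (pt 0 t) = q (z0 + t *s e2)" for t by (simp add: pt_def)
  have dpt: "dist z0 (pt s t) \<le> norm s + norm t" for s t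
    using npt[of s t] by (metis add_diff_cancel_left' dist_commute dist_norm pt_def)
  have memr: "pt s t \<in> ball z0 \<rho>" if "norm s < \<rho> / 2" "norm t < \<rho> / 2" for s t
    using that dpt[of s t] by simp
  obtain d where d: "0 < d" "d < \<rho> / 2" "\<And>t. norm t \<le> d \<Longrightarrow> t \<noteq> 0 \<Longrightarrow> q (pt 0 t) \<noteq> 0"
  proof (rule nonzero_slice_isolated[of "\<lambda>t. q (pt 0 t)" "\<rho> / 2" K])
    have mem: "z0 + t *s e2 \<in> S" if "t \<in> ball 0 (\<rho> / 2)" for t
      using memr[of 0 t] that \<rho> by (auto simp: pt_def subset_iff)
    show "(\<lambda>t. q (pt 0 t)) holomorphic_on ball 0 (\<rho> / 2)"
      unfolding slice0 by (rule hol_fun_slice[OF q mem])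
    show "(deriv ^^ K) (\<lambda>t. q (pt 0 t)) 0 \<noteq> 0"
      unfolding slice0
      using higher_deriv_slice[OF q \<open>open S\<close> open_ball[of 0 "\<rho>/2"], where z=z0 and l=l2 and n=K and t=0]
        mem \<rho>(1) z0(3) by (simp add: e2_def)
  qed (use \<rho> z0 in \<open>auto simp: pt_def\<close>)
  obtain \<eta> where \<eta>: "\<eta> > 0" "\<And>t. norm t = d \<Longrightarrow> norm (q (pt 0 t)) \<ge> \<eta>"
  proof -
    have "continuous_on (sphere 0 d) (\<lambda>t. norm (q (pt 0 t)))"
      by (intro continuous_intros continuous_on_compose2[OF hol_fun_imp_continuous[OF q]])
         (use memr[of 0] d \<rho> in \<open>auto simp: pt_def subset_iff intro!: continuous_intros\<close>)
    then obtain t0 where "t0 \<in> sphere 0 d" "\<And>t. t \<in> sphere 0 d \<Longrightarrow> norm (q (pt 0 t0)) \<le> norm (q (pt 0 t))"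
      using continuous_attains_inf[of "sphere 0 d" "\<lambda>t. norm (q (pt 0 t))"] d(1) by auto
    then show ?thesis using that[of "norm (q (pt 0 t0))"] d(1,3) by (auto simp: dist_norm)
  qed
  \<comment> \<open>\<open>q (pt 0 t)\<close> is bounded away from 0 on the circle |t| = d, and
    uniform continuity keeps the slices for small \<open>s\<close> close to it, so their zero inside
    the circle survives.\<close>
  obtain s0 where s0: "s0 > 0" "s0 < \<rho> / 2" "\<And>s. norm s < s0 \<Longrightarrow> \<exists>t. norm t \<le> d \<and> q (pt s t) = 0"
  proof -
    define \<rho>' where "\<rho>' = (\<rho> / 2 + d)"
    have \<rho>': "cball z0 \<rho>' \<subseteq> S" using \<rho>(2) d by (auto simp: \<rho>'_def subset_iff)
    have "uniformly_continuous_on (cball z0 \<rho>') q"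
      by (intro compact_uniformly_continuous continuous_on_subset[OF hol_fun_imp_continuous[OF q] \<rho>']) auto
    then obtain s1 where s1: "s1 > 0"
      "\<And>x y. x \<in> cball z0 \<rho>' \<Longrightarrow> y \<in> cball z0 \<rho>' \<Longrightarrow> dist y x < s1 \<Longrightarrow> dist (q y) (q x) < \<eta> / 2"
      using \<eta>(1) unfolding uniformly_continuous_on_def by (metis half_gt_zero)
    have mem: "pt s t \<in> cball z0 \<rho>'" if "norm s < \<rho> / 2" "norm t \<le> d" for s t
      using that dpt[of s t] by (simp add: \<rho>'_def)
    show ?thesis
    proof (rule that[of "min s1 (\<rho> / 4)"])
      fix s :: complex assume s: "norm s < min s1 (\<rho> / 4)"
      show "\<exists>t. norm t \<le> d \<and> q (pt s t) = 0"
      proof (rule zeros_persist[where g="\<lambda>t. q (pt s t)" and h="\<lambda>t. q (pt 0 t)" and \<eta>=\<eta>])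
        have "z0 + s *s e1 + t *s e2 \<in> S" if "t \<in> cball 0 d" for t
          using mem[of s t] that s \<rho> \<rho>' by (auto simp: pt_def subset_iff add.assoc)
        from hol_fun_slice[OF q this, of "cball 0 d"]
        show "(\<lambda>t. q (pt s t)) holomorphic_on cball 0 d"
          by (simp add: pt_def add.assoc)
        fix t :: complex assume t: "norm t \<le> d"
        have "dist (pt s t) (pt 0 t) < s1"
          using s by (simp add: dist_norm pt_diff norm_cscale ne)
        then show "norm (q (pt s t) - q (pt 0 t)) < \<eta> / 2"
          using s1(2)[OF mem[of 0 t] mem[of s t]] s t \<rho>(1) by (simp add: dist_norm)
      qed (use d \<eta> z0 in \<open>auto simp: pt_def\<close>)
    qed (use s1 \<rho> in auto)
  qed
  \<comment> \<open>An arbitrary choice of zeros suffices: its Lipschitz continuity comes from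
    \<open>lip\<close>, not from the choice.\<close>
  then obtain \<tau> where \<tau>: "\<And>s. norm s < s0 \<Longrightarrow> norm (\<tau> s) \<le> d \<and> q (pt s (\<tau> s)) = 0" by metis
  have mem: "pt s (\<tau> s) \<in> ball z0 \<rho>" if "norm s < s0" for s
    using memr[of s "\<tau> s"] \<tau>[OF that] that s0 d by simp
  have C: "C > 0" unfolding C_def by (simp add: add_nonneg_pos)
  \<comment> \<open>\<open>\<tau>\<close> need not be differentiable. Since the derivative of
    \<open>F $ k\<close> vanishes on the plane at every zero, its increment is o(|y - x|), and the
    Lipschitz bound turns this into o of the increment of \<open>s\<close>.\<close>
  have const: "F (pt s (\<tau> s)) $ k = F (pt s' (\<tau> s')) $ k" if "s \<in> ball 0 s0" "s' \<in> ball 0 s0" for s s' k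
  proof -
    let ?f = "\<lambda>z. F z $ k"
    have "((\<lambda>s. ?f (pt s (\<tau> s))) has_derivative (\<lambda>h. 0)) (at s within ball 0 s0)"
      if s: "s \<in> ball 0 s0" for s
      unfolding has_derivative_within_alt
    proof (intro conjI allI impI)
      fix e :: real assume "e > 0"
      let ?x = "pt s (\<tau> s)"
      have x: "?x \<in> S" "q ?x = 0" using s mem[of s] \<rho>(2) \<tau>[of s] by auto
      have "\<forall>e>0. \<exists>d>0. \<forall>y. norm (y - ?x) < d \<longrightarrow>
          norm (?f y - ?f ?x - blinfun_apply (cderiv ?f ?x) (y - ?x)) \<le> e * norm (y - ?x)"
        using hol_fun_has_cderiv[OF F x(1)] unfolding has_derivative_at_alt by blast
      moreover have "e / (1 + C) > 0" using \<open>e > 0\<close> C by simp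
      ultimately obtain \<delta> where \<delta>: "\<delta> > 0" "\<And>y. norm (y - ?x) < \<delta> \<Longrightarrow>
          norm (?f y - ?f ?x - blinfun_apply (cderiv ?f ?x) (y - ?x)) \<le> e / (1 + C) * norm (y - ?x)"
        by blast
      show "\<exists>d>0. \<forall>y\<in>ball 0 s0. norm (y - s) < d \<longrightarrow>
          norm (?f (pt y (\<tau> y)) - ?f ?x - 0) \<le> e * norm (y - s)"
      proof (intro exI conjI ballI impI)
        show "0 < \<delta> / (1 + C)" using \<delta> C by simp
        fix y assume y: "y \<in> ball 0 s0" "norm (y - s) < \<delta> / (1 + C)"
        let ?y = "pt y (\<tau> y)"
        have "norm (\<tau> y - \<tau> s) \<le> C * norm (y - s)"
          using lip[OF mem mem] \<tau> y(1) s by auto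
        then have le: "norm (?y - ?x) \<le> (1 + C) * norm (y - s)"
          using npt[of "y - s" "\<tau> y - \<tau> s"] unfolding pt_diff by (simp add: algebra_simps)
        also have "\<dots> < \<delta>" using y(2) C by (simp add: field_simps)
        finally have "norm (?f ?y - ?f ?x - blinfun_apply (cderiv ?f ?x) (?y - ?x)) \<le> e / (1 + C) * norm (?y - ?x)"
          by (rule \<delta>(2))
        moreover have "blinfun_apply (cderiv ?f ?x) (?y - ?x) = 0"
          unfolding pt_diff e1_def e2_def cderiv_axes[OF l12] using crit[OF x] by simp
        moreover have "e / (1 + C) * norm (?y - ?x) \<le> e / (1 + C) * ((1 + C) * norm (y - s))"
          using le \<open>e > 0\<close> C by (intro mult_left_mono) auto
        ultimately show "norm (?f ?y - ?f ?x - 0) \<le> e * norm (y - s)" using C by simp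
      qed
    qed simp
    then have "\<exists>c. \<forall>s\<in>ball 0 s0. ?f (pt s (\<tau> s)) = c"
      by (intro has_derivative_zero_constant) auto
    with that show ?thesis by auto
  qed
  have sm: "of_real (s0 / 2) \<in> ball (0::complex) s0" "(0::complex) \<in> ball 0 s0"
    using s0(1) by auto
  let ?s = "of_real (s0 / 2) :: complex"
  have "F (pt ?s (\<tau> ?s)) = F (pt 0 (\<tau> 0))"
    unfolding vec_eq_iff using const[OF sm] by blast
  moreover have "pt ?s (\<tau> ?s) \<in> S" "pt 0 (\<tau> 0) \<in> S" using mem sm \<rho>(2) by auto
  ultimately have "pt ?s (\<tau> ?s) = pt 0 (\<tau> 0)" using inj by (auto dest: inj_onD)
  \<comment> \<open>The two points of the graph lie over different parameters \<open>s\<close>,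
    which are read off in coordinate \<open>l1\<close>.\<close>
  then have "pt ?s (\<tau> ?s) $ l1 = pt 0 (\<tau> 0) $ l1" by simp
  then show False using l12 s0(1) by (simp add: pt_def e1_def e2_def axis_def)
qed

section \<open>Jacobian matrices and local inverses\<close>

definition jac :: "(complex ^ 'n \<Rightarrow> complex ^ 'm) \<Rightarrow> complex ^ 'n \<Rightarrow> complex ^ 'n ^ 'm" where
  "jac F z = (\<chi> i l. cpd l (\<lambda>z. F z $ i) z)"

lemma jac_nth [simp]: "jac F z $ i $ l = cpd l (\<lambda>z. F z $ i) z"
  by (simp add: jac_def)

lemma jac_mult_nth: "(jac F z *v v) $ i = blinfun_apply (cderiv (\<lambda>z. F z $ i) z) v"
  by (simp add: matrix_vector_mult_def mult.commute)

lemma jac_has_derivative: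
  assumes "holomorphic_on_cn F S" "z \<in> S"
  shows "(F has_derivative (\<lambda>v. jac F z *v v)) (at z)"
  unfolding has_derivative_vec_iff jac_mult_nth
  using assms hol_fun_has_cderiv unfolding holomorphic_on_cn_iff by blast

lemma hol_fun_det_jac:
  fixes F :: "complex ^ 'n \<Rightarrow> complex ^ 'n"
  assumes "holomorphic_on_cn F S" "open S"
  shows "hol_fun (\<lambda>z. det (jac F z)) S"
  by (rule hol_fun_det) (use assms in \<open>auto simp: holomorphic_on_cn_iff intro: hol_fun_cpd\<close>)

lemma det_eq_0_iff_kernel:
  fixes A :: "complex ^ 'n ^ 'n"
  shows "det A = 0 \<longleftrightarrow> (\<exists>v. v \<noteq> 0 \<and> A *v v = 0)"
  using invertible_det_nz[of A] invertible_left_inverse[of A] matrix_left_invertible_ker[of A] by blast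

lemma bounded_linear_matrix_mult:
  fixes A :: "complex ^ 'n ^ 'm"
  shows "bounded_linear (\<lambda>v. A *v v)"
  using matrix_vector_mul_linear linear_conv_bounded_linear by blast

text \<open>Invariance of domain makes the image open and the inverse continuous; its derivative is
  then the inverse matrix, which is complex linear.\<close>

lemma holomorphic_inverse:
  fixes F :: "complex ^ 'n \<Rightarrow> complex ^ 'n"
  assumes F: "holomorphic_on_cn F S" and "open S" "inj_on F S"
    and nz: "\<And>z. z \<in> S \<Longrightarrow> det (jac F z) \<noteq> 0"
  shows "open (F ` S)" "holomorphic_on_cn (inv_into S F) (F ` S)"
proof -
  have cF: "continuous_on S F" by (rule holomorphic_on_cn_imp_continuous[OF F])
  show op: "open (F ` S)" by (rule invariance_of_domain[OF cF \<open>open S\<close> \<open>inj_on F S\<close>])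
  have cG: "continuous_on (F ` S) (inv_into S F)"
    by (rule continuous_on_inverse_open[OF \<open>open S\<close> cF]) (use \<open>inj_on F S\<close> in auto)
  show "holomorphic_on_cn (inv_into S F) (F ` S)"
    unfolding holomorphic_on_cn_def
  proof
    fix y assume y: "y \<in> F ` S"
    let ?x = "inv_into S F y"
    have x: "?x \<in> S" using y by (rule inv_into_into)
    obtain B where B: "B ** jac F ?x = mat 1"
      using nz[OF x] invertible_det_nz[of "jac F ?x"] invertible_left_inverse[of "jac F ?x"] by blast
    have "(inv_into S F has_derivative (\<lambda>v. B *v v)) (at y)"
    proof (rule has_derivative_inverse_basic)
      show "(F has_derivative (\<lambda>v. jac F ?x *v v)) (at ?x)" by (rule jac_has_derivative[OF F x])
      show "bounded_linear (\<lambda>v. B *v v)" by (rule bounded_linear_matrix_mult)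
      show "(\<lambda>v. B *v v) \<circ> (\<lambda>v. jac F ?x *v v) = id"
        by (simp add: fun_eq_iff matrix_vector_mul_assoc B)
      show "continuous (at y) (inv_into S F)" using cG op y continuous_on_eq_continuous_at by blast
      show "F (inv_into S F z) = z" if "z \<in> F ` S" for z using that by (rule f_inv_into_f)
    qed (use op y in auto)
    moreover have "B *v (c *s v) = c *s (B *v v)" for c v
      by (simp add: vec_eq_iff matrix_vector_mult_def sum_distrib_left algebra_simps)
    ultimately show "\<exists>L. (inv_into S F has_derivative L) (at y) \<and> (\<forall>c x. L (c *s x) = c *s L x)" by blast
  qed
qed

text \<open>The injectivity half of the inverse function theorem. Holomorphic partial derivatives
  make the Jacobian continuous in operator norm, and its determinant stays nonzero nearby.\<close>

lemma holomorphic_locally_injective: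
  fixes F :: "complex ^ 'n \<Rightarrow> complex ^ 'n"
  assumes F: "holomorphic_on_cn F S" and "open S" "a \<in> S" and nz: "det (jac F a) \<noteq> 0"
  obtains U where "open U" "a \<in> U" "U \<subseteq> S" "inj_on F U" "\<And>z. z \<in> U \<Longrightarrow> det (jac F z) \<noteq> 0"
proof -
  define D where "D z = Blinfun (\<lambda>v. jac F z *v v)" for z
  have D: "blinfun_apply (D z) = (\<lambda>v. jac F z *v v)" for z
    unfolding D_def by (rule bounded_linear_Blinfun_apply[OF bounded_linear_matrix_mult])
  have "continuous_on S D"
  proof (rule continuous_on_blinfun_componentwise)
    fix b :: "complex ^ 'n"
    have "continuous_on S (\<lambda>z. (jac F z *v b) $ i)" for i
      unfolding jac_mult_nth
      by (intro continuous_intros cderiv_continuous) (use F \<open>open S\<close> in \<open>auto simp: holomorphic_on_cn_iff\<close>)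
    then have "continuous_on S (\<lambda>z. \<chi> i. (jac F z *v b) $ i)" by (rule continuous_on_vec_lambda)
    then show "continuous_on S (\<lambda>z. blinfun_apply (D z) b)" by (simp add: D)
  qed
  then have cD: "isCont D a" using \<open>open S\<close> \<open>a \<in> S\<close> continuous_on_eq_continuous_at by blast
  define W where "W = {z \<in> S. det (jac F z) \<noteq> 0}"
  have "continuous_on S (\<lambda>z. det (jac F z))"
    by (rule hol_fun_imp_continuous[OF hol_fun_det_jac[OF F \<open>open S\<close>]])
  then have "open W"
    using continuous_open_preimage[OF _ \<open>open S\<close>, of "\<lambda>z. det (jac F z)" "-{0}"]
    by (auto simp: W_def Int_def vimage_def)
  have "a \<in> W" using nz \<open>a \<in> S\<close> by (simp add: W_def)
  obtain B where B: "B ** jac F a = mat 1"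
    using nz invertible_det_nz[of "jac F a"] invertible_left_inverse[of "jac F a"] by blast
  obtain r where r: "r > 0" "ball a r \<subseteq> W" "inj_on F (ball a r)"
  proof (rule has_derivative_locally_injective[OF \<open>a \<in> W\<close> \<open>open W\<close>, where f=F and f'="\<lambda>x v. jac F x *v v" and g'="\<lambda>v. B *v v"])
    show "(\<lambda>v. B *v v) \<circ> (\<lambda>v. jac F a *v v) = id"
      by (simp add: fun_eq_iff matrix_vector_mul_assoc B)
    show "(F has_derivative (\<lambda>v. jac F x *v v)) (at x)" if "x \<in> W" for x
      using that jac_has_derivative[OF F] by (simp add: W_def)
    fix e :: real assume "e > 0"
    then obtain d where d: "d > 0" "\<And>x. dist x a < d \<Longrightarrow> dist (D x) (D a) < e"
      using cD unfolding continuous_at_eps_delta by blast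
    have "onorm (\<lambda>v. jac F x *v v - jac F a *v v) = norm (D x - D a)" for x
      by (simp only: norm_blinfun.rep_eq minus_blinfun.rep_eq D)
    then show "\<exists>d>0. \<forall>x. dist a x < d \<longrightarrow> onorm (\<lambda>v. jac F x *v v - jac F a *v v) < e"
      using d by (auto simp: dist_norm norm_minus_commute)
  qed (auto intro: bounded_linear_matrix_mult)
  show ?thesis by (rule that[of "ball a r"]) (use r in \<open>auto simp: W_def\<close>)
qed

text \<open>Row \<open>i\<close> of the Jacobian is the \<open>j\<close>-th unit row, so every
  vector in its kernel has zero \<open>j\<close>-th entry.\<close>

lemma jac_kernel_component:
  assumes F: "holomorphic_on_cn F S" "open S" "z \<in> S"
    and "\<And>w. w \<in> S \<Longrightarrow> F w $ i = w $ j"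
  shows "(jac F z *v v) $ i = v $ j"
proof -
  have "((\<lambda>w. w $ j) has_derivative (\<lambda>v. (jac F z *v v) $ i)) (at z)"
    by (rule has_derivative_transform_within_open[OF _ F(2,3) assms(4)])
       (use jac_has_derivative[OF F(1,3)] in \<open>simp add: has_derivative_vec_iff\<close>)
  moreover have "((\<lambda>w. w $ j) has_derivative (\<lambda>v. v $ j)) (at z)"
    by (rule bounded_linear_imp_has_derivative[OF bounded_linear_vec_nth])
  ultimately show ?thesis by (metis has_derivative_unique)
qed

lemma jac_mult_axis: "(jac F z *v axis l 1) $ k = cpd l (\<lambda>z. F z $ k) z"
  by (simp add: matrix_vector_mult_def axis_def mult_if_delta if_distrib cong: if_cong)

text \<open>
  If some component \<open>F $ k\<close> has a nonzero derivative in a direction \<open>l \<notin> I\<close> at a singular point, then it can serve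
  as a new coordinate in place of the \<open>l\<close>-th one, and \<open>I\<close> grows. Otherwise all derivatives in directions outside
  \<open>I\<close> vanish on the zero set of the Jacobian determinant.
\<close>

lemma injective_partially_identity_det_nonzero:
  fixes F :: "complex ^ 'n \<Rightarrow> complex ^ 'n"
  assumes "holomorphic_on_cn F S" "open S" "inj_on F S" "a \<in> S"
    and "\<And>i z. i \<in> I \<Longrightarrow> z \<in> S \<Longrightarrow> F z $ i = z $ i"
  shows "det (jac F a) \<noteq> 0"
  using assms
\<comment> \<open>The induction hypothesis is applied to another map on another open set, namely
  \<open>F\<close> in new coordinates.\<close>
proof (induction "card (UNIV - I)" arbitrary: I F S a rule: less_induct)
  case less
  note F = \<open>holomorphic_on_cn F S\<close> and S = \<open>open S\<close> and inj = \<open>inj_on F S\<close>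
  have Fk: "hol_fun (\<lambda>z. F z $ k) S" for k using F by (simp add: holomorphic_on_cn_iff)
  \<comment> \<open>The claim is needed at every singular point of \<open>S\<close>, not only at
    \<open>a\<close>, because \<open>F\<close> has to be followed along the zero set of the
    determinant.\<close>
  have crit: "cpd l (\<lambda>z. F z $ k) z = 0" if z: "z \<in> S" "det (jac F z) = 0" and "l \<notin> I" for z k l
  proof (cases "k \<in> I")
    case True
    then have "k \<noteq> l" using \<open>l \<notin> I\<close> by blast
    have "(jac F z *v axis l 1) $ k = axis l 1 $ k"
      by (rule jac_kernel_component[OF F S z(1)]) (use less.prems(5) True in blast)
    then show ?thesis using \<open>k \<noteq> l\<close> by (simp only: jac_mult_axis) (simp add: axis_def)
  next
    case False
    show ?thesis
    proof (rule ccontr)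
      assume c: "cpd l (\<lambda>z. F z $ k) z \<noteq> 0"
      \<comment> \<open>\<open>\<psi>\<close> installs \<open>F $ k\<close> as the
        \<open>l\<close>-th coordinate. Its Jacobian differs from the identity only in row
        \<open>l\<close>, whose diagonal entry is the derivative assumed to be nonzero.\<close>
      define \<psi> where "\<psi> w = (\<chi> i. if i = l then F w $ k else w $ i)" for w
      have \<psi>: "holomorphic_on_cn \<psi> S"
        unfolding holomorphic_on_cn_iff
      proof
        fix i show "hol_fun (\<lambda>z. \<psi> z $ i) S"
          by (cases "i = l") (simp_all add: \<psi>_def Fk hol_fun_component)
      qed
      have \<psi>_ker: "v = 0" if v: "jac \<psi> z *v v = 0" for v
      proof -
        have v0: "v $ i = 0" if "i \<noteq> l" for i
          using jac_kernel_component[OF \<psi> S z(1), of i i v] that v by (simp add: \<psi>_def)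
        have "(jac \<psi> z *v v) $ l = (\<Sum>j\<in>UNIV. cpd j (\<lambda>z. F z $ k) z * v $ j)"
          by (simp add: matrix_vector_mult_def \<psi>_def)
        also have "\<dots> = (\<Sum>j\<in>UNIV. if j = l then cpd l (\<lambda>z. F z $ k) z * v $ l else 0)"
          by (rule sum.cong) (auto simp: v0)
        also have "\<dots> = cpd l (\<lambda>z. F z $ k) z * v $ l" by simp
        finally have "v $ l = 0" using c v by simp
        then show "v = 0" using v0 by (metis vec_eq_iff zero_index)
      qed
      then have "det (jac \<psi> z) \<noteq> 0" unfolding det_eq_0_iff_kernel by blast
      then obtain U where U: "open U" "z \<in> U" "U \<subseteq> S" "inj_on \<psi> U"
        and nzU: "\<And>w. w \<in> U \<Longrightarrow> det (jac \<psi> w) \<noteq> 0"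
        using holomorphic_locally_injective[OF \<psi> S z(1)] by metis
      define G where "G = inv_into U \<psi>"
      note inv = holomorphic_inverse[OF holomorphic_on_cn_subset[OF \<psi> U(3)] U(1,4) nzU, folded G_def]
      have G\<psi>: "G (\<psi> w) = w" if "w \<in> U" for w unfolding G_def by (rule inv_into_f_f[OF U(4) that])
      have GU: "G y \<in> U" "\<psi> (G y) = y" if "y \<in> \<psi> ` U" for y using that G\<psi> by auto
      \<comment> \<open>Swapping components \<open>k\<close> and \<open>l\<close> puts
        \<open>F $ k\<close> in position \<open>l\<close>, where it equals the new coordinate.
        Neither index is in \<open>I\<close>, so the components already preserved stay in
        place.\<close>
      define \<sigma> where "\<sigma> i = (if i = l then k else if i = k then l else i)" for i
      define H where "H y = (\<chi> i. F (G y) $ \<sigma> i)" for y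
      have \<sigma>\<sigma>: "\<sigma> (\<sigma> i) = i" for i by (simp add: \<sigma>_def)
      have H: "holomorphic_on_cn H (\<psi> ` U)"
        unfolding holomorphic_on_cn_iff
      proof
        fix i show "hol_fun (\<lambda>z. H z $ i) (\<psi> ` U)"
          unfolding H_def vec_lambda_beta
          by (rule hol_fun_compose[OF Fk inv(2)]) (use G\<psi> U(3) in auto)
      qed
      have injH: "inj_on H (\<psi> ` U)"
      proof (rule inj_onI)
        fix y y' assume y: "y \<in> \<psi> ` U" "y' \<in> \<psi> ` U" "H y = H y'"
        have "F (G y) $ i = F (G y') $ i" for i
          using y(3) \<sigma>\<sigma>[of i] by (simp add: H_def vec_eq_iff) metis
        then have "F (G y) = F (G y')" by (simp add: vec_eq_iff)
        then have "G y = G y'" using inj GU(1) y(1,2) U(3) by (meson inj_onD subsetD)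
        then show "y = y'" using GU(2) y by metis
      qed
      have "det (jac H (\<psi> z)) \<noteq> 0"
      proof (rule less.hyps[OF _ H inv(1) injH])
        have "UNIV - insert l I \<subset> UNIV - I" using \<open>l \<notin> I\<close> by blast
        then show "card (UNIV - insert l I) < card (UNIV - I)" by (simp add: psubset_card_mono)
        show "\<psi> z \<in> \<psi> ` U" using U(2) by blast
        fix i y assume i: "i \<in> insert l I" and y: "y \<in> \<psi> ` U"
        show "H y $ i = y $ i"
        proof (cases "i = l")
          case True
          have "y $ l = \<psi> (G y) $ l" by (simp add: GU(2)[OF y])
          then show ?thesis using True by (simp add: H_def \<sigma>_def \<psi>_def)
        next
          case neq: False
          then have iI: "i \<in> I" "i \<noteq> k" using i False by auto
          have "y $ i = \<psi> (G y) $ i" by (simp add: GU(2)[OF y])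
          also have "\<dots> = G y $ i" using neq by (simp add: \<psi>_def)
          also have "\<dots> = F (G y) $ i" using less.prems(5)[OF iI(1)] GU(1)[OF y] U(3) by auto
          finally show ?thesis using neq iI(2) by (simp add: H_def \<sigma>_def)
        qed
      qed
      moreover obtain v where v: "v \<noteq> 0" "jac F z *v v = 0" using z(2) unfolding det_eq_0_iff_kernel by blast
      \<comment> \<open>\<open>H \<circ> \<psi>\<close> is \<open>F\<close> with its components
        permuted, so a kernel vector of \<open>jac F z\<close> is sent by
        \<open>jac \<psi> z\<close> to a kernel vector of \<open>jac H (\<psi> z)\<close>, and it
        stays nonzero.\<close>
      have "jac H (\<psi> z) *v (jac \<psi> z *v v) = 0"
      proof -
        have "((\<lambda>w. H (\<psi> w)) has_derivative (\<lambda>v. jac H (\<psi> z) *v (jac \<psi> z *v v))) (at z)"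
          by (rule has_derivative_compose[OF jac_has_derivative[OF \<psi> z(1)] jac_has_derivative[OF H]])
             (use U(2) in blast)
        then have HD: "((\<lambda>w. H (\<psi> w) $ i) has_derivative (\<lambda>v. (jac H (\<psi> z) *v (jac \<psi> z *v v)) $ i)) (at z)" for i
          unfolding has_derivative_vec_iff by blast
        have "((\<lambda>w. F w $ \<sigma> i) has_derivative (\<lambda>v. (jac H (\<psi> z) *v (jac \<psi> z *v v)) $ i)) (at z)" for i
          by (rule has_derivative_transform_within_open[OF HD U(1,2)]) (simp add: H_def G\<psi>)
        moreover have "((\<lambda>w. F w $ \<sigma> i) has_derivative (\<lambda>v. (jac F z *v v) $ \<sigma> i)) (at z)" for i
          using jac_has_derivative[OF F z(1)] unfolding has_derivative_vec_iff by blast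
        ultimately have "(jac H (\<psi> z) *v (jac \<psi> z *v v)) $ i = (jac F z *v v) $ \<sigma> i" for i
          by (metis has_derivative_unique)
        then show ?thesis using v(2) by (simp add: vec_eq_iff)
      qed
      ultimately show False using \<psi>_ker v(1) unfolding det_eq_0_iff_kernel by blast
    qed
  qed
  show ?case
  proof
    assume a0: "det (jac F a) = 0"
    note a = \<open>a \<in> S\<close>
    obtain v where v: "v \<noteq> 0" "jac F a *v v = 0" using a0 unfolding det_eq_0_iff_kernel by blast
    \<comment> \<open>A kernel vector vanishes in the preserved coordinates, so at least one
      coordinate direction is left over.\<close>
    have "v $ i = 0" if "i \<in> I" for i
      using jac_kernel_component[OF F S a, of i i v] less.prems(5)[OF that] v(2) by simp
    then obtain l where l: "l \<notin> I" using v(1) by (metis vec_eq_iff zero_index)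
    show False
    proof (cases "\<exists>l2. l2 \<notin> I \<and> l2 \<noteq> l")
      case True
      then obtain l2 where l2: "l2 \<notin> I" "l \<noteq> l2" by blast
      have "\<not> inj_on F S"
        by (rule singular_zero_set_not_injective[OF S Fk hol_fun_det_jac[OF F S] a a0 l2(2)])
           (use crit l l2 in blast)
      then show False using inj by blast
    next
      case False
      \<comment> \<open>With \<open>l\<close> as the only remaining direction, the slice of
        \<open>F $ l\<close> is an injective holomorphic function of one variable, and its
        derivative cannot vanish.\<close>
      define T where "T = {t. a + t *s axis l 1 \<in> S}"
      have "continuous_on UNIV (\<lambda>t. a + t *s axis l 1)" by (intro continuous_intros)
      then have "open T" unfolding T_def using continuous_open_vimage[OF S, of "\<lambda>t. a + t *s axis l 1"]
        by (simp add: vimage_def continuous_on_eq_continuous_at)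
      let ?h = "\<lambda>t. F (a + t *s axis l 1) $ l"
      have "?h holomorphic_on T" by (rule hol_fun_slice[OF Fk]) (simp add: T_def)
      moreover have "inj_on ?h T"
      proof (rule inj_onI)
        fix t t' assume t: "t \<in> T" "t' \<in> T" "?h t = ?h t'"
        have "F (a + t *s axis l 1) $ i = F (a + t' *s axis l 1) $ i" for i
        proof (cases "i = l")
          case neq: False
          then have "i \<in> I" using False by blast
          then show ?thesis using less.prems(5) t(1,2) neq by (simp add: T_def axis_def)
        qed (use t in simp)
        then have "F (a + t *s axis l 1) = F (a + t' *s axis l 1)" by (simp add: vec_eq_iff)
        from inj_onD[OF inj this] have "a + t *s axis l 1 = a + t' *s axis l 1"
          using t(1,2) unfolding T_def by blast
        then have "(a + t *s axis l 1) $ l = (a + t' *s axis l 1) $ l" by (rule arg_cong)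
        then show "t = t'" by simp
      qed
      moreover have "0 \<in> T" using a by (simp add: T_def)
      ultimately have "deriv ?h 0 \<noteq> 0" using \<open>open T\<close> holomorphic_injective_imp_regular by blast
      moreover have "deriv ?h 0 = cpd l (\<lambda>z. F z $ l) a" by (simp add: cpd_def)
      ultimately show False using crit[OF a a0 l] by simp
    qed
  qed
qed

lemma injective_holomorphic_det_nonzero:
  fixes F :: "complex ^ 'n \<Rightarrow> complex ^ 'n"
  assumes "holomorphic_on_cn F S" "open S" "inj_on F S" "a \<in> S"
  shows "det (jac F a) \<noteq> 0"
  using injective_partially_identity_det_nonzero[OF assms, of "{}"] by blast

lemma injective_holomorphic_inverse:
  fixes F :: "complex ^ 'n \<Rightarrow> complex ^ 'n"
  assumes "holomorphic_on_cn F S" "open S" "inj_on F S"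
  shows "holomorphic_on_cn (inv_into S F) (F ` S)" "open (F ` S)"
  using holomorphic_inverse[OF assms] injective_holomorphic_det_nonzero[OF assms] by blast+

section \<open>Harnack inequalities\<close>

lemma harnack_disc:
  assumes F: "F holomorphic_on ball 0 1" and pos: "\<And>t. norm t < 1 \<Longrightarrow> Re (F t) > 0" and t: "norm t < 1"
  shows "(1 - norm t) * Re (F 0) \<le> (1 + norm t) * Re (F t)"
    and "(1 - norm t) * Re (F t) \<le> (1 + norm t) * Re (F 0)"
proof -
  define w where "w = F 0"
  have a: "Re w > 0" using pos[of 0] by (simp add: w_def)
  have nz: "F s + cnj w \<noteq> 0" if "norm s < 1" for s
    using pos[OF that] a by (auto simp: complex_eq_iff)
  \<comment> \<open>Schwarz's lemma is applied to the Cayley transform of \<open>F\<close> centred at \<open>F 0\<close>.\<close>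
  define \<phi> where "\<phi> s = (F s - w) / (F s + cnj w)" for s
  have "norm (\<phi> t) \<le> norm t"
  proof (rule Schwarz_Lemma(1)[OF _ _ _ t])
    show "\<phi> holomorphic_on ball 0 1"
      unfolding \<phi>_def by (intro holomorphic_intros F) (use nz in auto)
    show "\<phi> 0 = 0" by (simp add: \<phi>_def w_def)
    fix s :: complex assume s: "norm s < 1"
    have "(norm (F s - w))\<^sup>2 < (norm (F s + cnj w))\<^sup>2"
      using mult_pos_pos[OF pos[OF s] a] unfolding cmod_power2 by (simp add: power2_eq_square algebra_simps)
    then have "norm (F s - w) < norm (F s + cnj w)" by (rule power_less_imp_less_base) simp
    then show "norm (\<phi> s) < 1" using nz[OF s] by (simp add: \<phi>_def norm_divide)
  qed
  then have "norm (F t - w) \<le> norm t * norm (F t + cnj w)"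
    using nz[OF t] by (simp add: \<phi>_def norm_divide divide_le_eq)
  then have "(norm (F t - w))\<^sup>2 \<le> (norm t * norm (F t + cnj w))\<^sup>2" by (rule power_mono) simp
  then have "(Re (F t) - Re w)\<^sup>2 + (Im (F t) - Im w)\<^sup>2
      \<le> (norm t)\<^sup>2 * (Re (F t) + Re w)\<^sup>2 + (norm t)\<^sup>2 * (Im (F t) - Im w)\<^sup>2"
    by (simp add: power_mult_distrib cmod_power2 distrib_left)
  \<comment> \<open>The imaginary parts occur on both sides and cancel, since |t| \<le> 1; only the
    real parts remain.\<close>
  moreover have "(norm t)\<^sup>2 * (Im (F t) - Im w)\<^sup>2 \<le> 1 * (Im (F t) - Im w)\<^sup>2"
    by (rule mult_right_mono) (use t in \<open>auto simp: power_le_one\<close>)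
  ultimately have "(Re (F t) - Re w)\<^sup>2 \<le> (norm t * (Re (F t) + Re w))\<^sup>2"
    by (simp add: power_mult_distrib)
  then have "\<bar>Re (F t) - Re w\<bar> \<le> norm t * (Re (F t) + Re w)"
    using pos[OF t] a by (simp add: abs_le_square_iff[symmetric] abs_mult)
  then show "(1 - norm t) * Re (F 0) \<le> (1 + norm t) * Re (F t)"
    "(1 - norm t) * Re (F t) \<le> (1 + norm t) * Re (F 0)"
    by (simp_all add: w_def algebra_simps abs_le_iff)
qed

text \<open>Apply the disc version on the complex line through \<open>q\<close> and
  \<open>z\<close>. The direction \<open>v\<close> has length \<open>R\<close>, so the unit disc
  maps into the ball and \<open>z\<close> has parameter of modulus
  \<open>dist q z / R\<close>.\<close>

lemma harnack_ball:
  fixes F :: "complex ^ 'n \<Rightarrow> complex"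
  assumes F: "hol_fun F S" and pos: "\<And>z. z \<in> S \<Longrightarrow> Re (F z) > 0" and S: "ball q R \<subseteq> S" and z: "z \<in> ball q R"
  shows "(R - dist q z) * Re (F q) \<le> (R + dist q z) * Re (F z)"
    and "(R - dist q z) * Re (F z) \<le> (R + dist q z) * Re (F q)"
proof -
  have d: "dist q z < R" using z by simp
  have R: "R > 0" using d zero_le_dist[of q z] by linarith
  have "(R - dist q z) * Re (F q) \<le> (R + dist q z) * Re (F z) \<and>
    (R - dist q z) * Re (F z) \<le> (R + dist q z) * Re (F q)"
  proof (cases "q = z")
    case False
    define e where "e = dist q z"
    have e: "e > 0" "e < R" using False d by (simp_all add: e_def)
    define v where "v = complex_of_real (R / e) *s (z - q)"
    have "norm (z - q) = e" by (simp add: e_def dist_norm norm_minus_commute)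
    then have nv: "norm v = R" unfolding v_def norm_cscale using e R by (simp add: norm_divide)
    define h where "h t = F (q + t *s v)" for t
    have mem: "q + t *s v \<in> S" if "norm t < 1" for t
    proof -
      have "norm t * R < R" using that R by simp
      then show ?thesis using S by (auto simp: subset_iff dist_norm norm_cscale nv)
    qed
    define t where "t = complex_of_real (e / R)"
    have nt: "norm t = e / R" using e R by (simp add: t_def norm_divide)
    then have t1: "norm t < 1" using e R by simp
    have "complex_of_real (e / R) * complex_of_real (R / e) = 1" using e R by simp
    then have "t *s v = z - q" by (simp only: t_def v_def vector_smult_assoc vector_smult_lid)
    then have ht: "h t = F z" "h 0 = F q" by (simp_all add: h_def)
    have "h holomorphic_on ball 0 1"
      unfolding h_def by (rule hol_fun_slice[OF F]) (use mem in auto)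
    from harnack_disc[OF this _ t1] pos mem
    have "(1 - norm t) * Re (h 0) \<le> (1 + norm t) * Re (h t)"
      "(1 - norm t) * Re (h t) \<le> (1 + norm t) * Re (h 0)"
      unfolding h_def by blast+
    then have "R * ((1 - e / R) * Re (F q)) \<le> R * ((1 + e / R) * Re (F z))"
      "R * ((1 - e / R) * Re (F z)) \<le> R * ((1 + e / R) * Re (F q))"
      using R unfolding nt ht by (simp_all add: mult_left_mono)
    moreover have "R * ((1 - e / R) * x) = (R - e) * x" "R * ((1 + e / R) * x) = (R + e) * x" for x
      using R by (simp_all add: field_simps)
    ultimately show ?thesis unfolding e_def by simp
  qed simp
  then show "(R - dist q z) * Re (F q) \<le> (R + dist q z) * Re (F z)"
    "(R - dist q z) * Re (F z) \<le> (R + dist q z) * Re (F q)" by blast+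
qed

text \<open>The constant 3 is (R + R/2) / (R - R/2).\<close>

lemma harnack_half_ball:
  fixes F :: "complex ^ 'n \<Rightarrow> complex"
  assumes "hol_fun F S" and "\<And>z. z \<in> S \<Longrightarrow> Re (F z) > 0" and "ball q R \<subseteq> S" and "z \<in> ball q (R / 2)"
  shows "Re (F q) \<le> 3 * Re (F z)" and "Re (F z) \<le> 3 * Re (F q)"
proof -
  have d: "dist q z < R / 2" using assms(4) by simp
  then have R: "R > 0" using zero_le_dist[of q z] by linarith
  have zb: "z \<in> ball q R" "q \<in> ball q R" using d R by auto
  note h = harnack_ball[OF assms(1,2,3) zb(1)]
  have p: "Re (F z) > 0" "Re (F q) > 0" using assms(2,3) zb by blast+
  have "(R / 2) * Re (F q) \<le> (R - dist q z) * Re (F q)" "(R + dist q z) * Re (F z) \<le> (3 * R / 2) * Re (F z)"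
    "(R / 2) * Re (F z) \<le> (R - dist q z) * Re (F z)" "(R + dist q z) * Re (F q) \<le> (3 * R / 2) * Re (F q)"
    using d p by (auto intro!: mult_right_mono)
  with h have "(R / 2) * Re (F q) \<le> (R / 2) * (3 * Re (F z))" "(R / 2) * Re (F z) \<le> (R / 2) * (3 * Re (F q))"
    by (simp_all add: algebra_simps)
  then show "Re (F q) \<le> 3 * Re (F z)" "Re (F z) \<le> 3 * Re (F q)" using R by simp_all
qed

text \<open>\<open>K\<close> supplies the finite cover and \<open>T\<close> the points at which
  \<open>Q\<close> is asserted. They are kept apart so that \<open>K\<close> may be the closure of a
  domain \<open>T\<close>, with local information around boundary points as well.\<close>

lemma compact_uniform_constant:
  fixes Q :: "real \<Rightarrow> 'a::metric_space \<Rightarrow> bool"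
  assumes "compact K"
    and mono: "\<And>c c' y. Q c y \<Longrightarrow> 0 < c' \<Longrightarrow> c' \<le> c \<Longrightarrow> Q c' y"
    and loc: "\<And>x. x \<in> K \<Longrightarrow> \<exists>e>0. \<exists>c>0. \<forall>y\<in>ball x e \<inter> T. Q c y"
  shows "\<exists>c>0. \<forall>y\<in>K \<inter> T. Q c y"
proof -
  obtain e c where ec: "\<And>x. x \<in> K \<Longrightarrow> e x > 0 \<and> c x > 0 \<and> (\<forall>y\<in>ball x (e x) \<inter> T. Q (c x) y)"
    using loc by metis
  have "K \<subseteq> (\<Union>x\<in>K. ball x (e x))" using ec by fastforce
  then obtain X where X: "X \<subseteq> K" "finite X" "K \<subseteq> (\<Union>x\<in>X. ball x (e x))"
    using compactE_image[OF \<open>compact K\<close>, of K "\<lambda>x. ball x (e x)"] by auto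
  define c0 where "c0 = Min (insert 1 (c ` X))"
  have c0: "c0 > 0" "\<And>x. x \<in> X \<Longrightarrow> c0 \<le> c x"
    unfolding c0_def using X ec by (auto simp: subset_iff)
  have "Q c0 y" if y: "y \<in> K \<inter> T" for y
  proof -
    obtain x where x: "x \<in> X" "y \<in> ball x (e x)" using X(3) y by blast
    then have "Q (c x) y" using ec X(1) y by blast
    then show ?thesis using mono c0 x(1) by blast
  qed
  with c0(1) show ?thesis by blast
qed

text \<open>Harnack chains: admissible constants propagate along overlapping half balls by
  connectedness, and compactness makes them uniform. \<open>Q\<close> quantifies over
  \<open>F\<close> inside, because the constant must not depend on \<open>F\<close>.\<close>

lemma harnack_compact:
  fixes \<Omega> :: "(complex ^ 'n) set"
  assumes "open \<Omega>" "connected \<Omega>" "p \<in> \<Omega>" "compact K" "K \<subseteq> \<Omega>"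
  shows "\<exists>c>0. \<forall>x\<in>K. \<forall>F. hol_fun F \<Omega> \<longrightarrow> (\<forall>z\<in>\<Omega>. Re (F z) > 0) \<longrightarrow> c * Re (F x) \<le> Re (F p)"
proof -
  define Q where "Q c x \<longleftrightarrow> (\<forall>F. hol_fun F \<Omega> \<longrightarrow> (\<forall>z\<in>\<Omega>. Re (F z) > 0) \<longrightarrow> c * Re (F x) \<le> Re (F p))" for c x
  \<comment> \<open>The 9 is 3 * 3: one comparison from \<open>y'\<close> to the centre
    \<open>x\<close>, another from \<open>x\<close> to \<open>y\<close>.\<close>
  have nb: "\<exists>s>0. ball x s \<subseteq> \<Omega> \<and> (\<forall>y\<in>ball x (s/2). \<forall>y'\<in>ball x (s/2). \<forall>c>0. Q c y \<longrightarrow> Q (c / 9) y')"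
    if "x \<in> \<Omega>" for x
  proof -
    obtain s where s: "s > 0" "ball x s \<subseteq> \<Omega>" by (rule openE[OF \<open>open \<Omega>\<close> \<open>x \<in> \<Omega>\<close>])
    have "Q (c / 9) y'" if y: "y \<in> ball x (s/2)" "y' \<in> ball x (s/2)" "c > 0" "Q c y" for y y' c
      unfolding Q_def
    proof (intro allI impI)
      fix F assume F: "hol_fun F \<Omega>" "\<forall>z\<in>\<Omega>. Re (F z) > 0"
      have "Re (F y') \<le> 3 * Re (F x)" "Re (F x) \<le> 3 * Re (F y)"
        using harnack_half_ball[OF F(1) _ s(2)] F(2) y by blast+
      then have "c * Re (F y') \<le> c * (9 * Re (F y))" using y(3) by (intro mult_left_mono) auto
      then show "c / 9 * Re (F y') \<le> Re (F p)" using y(4) F unfolding Q_def by fastforce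
    qed
    with s show ?thesis by blast
  qed
  have pt: "\<exists>c>0. Q c x" if "x \<in> \<Omega>" for x
  proof (rule connected_induction_simple[OF \<open>connected \<Omega>\<close>, of p x "\<lambda>x. \<exists>c>0. Q c x"])
    show "\<exists>c>0. Q c p" unfolding Q_def by (intro exI[of _ 1]) auto
    fix a assume "a \<in> \<Omega>"
    then obtain s where s: "s > 0" "ball a s \<subseteq> \<Omega>"
      and q: "\<And>y y' c. y \<in> ball a (s/2) \<Longrightarrow> y' \<in> ball a (s/2) \<Longrightarrow> c > 0 \<Longrightarrow> Q c y \<Longrightarrow> Q (c / 9) y'"
      using nb by metis
    have "ball a (s/2) \<subseteq> ball a s" using s(1) by (intro subset_ball) simp
    then have op: "openin (top_of_set \<Omega>) (ball a (s/2))" using s(2) \<open>open \<Omega>\<close> by (simp add: openin_open_eq)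
    have tr: "\<exists>c>0. Q c y'" if "y \<in> ball a (s/2)" "y' \<in> ball a (s/2)" "\<exists>c>0. Q c y" for y y'
      using that q by (metis zero_less_divide_iff zero_less_numeral)
    show "\<exists>T. openin (top_of_set \<Omega>) T \<and> a \<in> T \<and>
        (\<forall>x\<in>T. \<forall>y\<in>T. (\<exists>c>0. Q c x) \<longrightarrow> (\<exists>c>0. Q c y))"
    proof (intro exI[of _ "ball a (s/2)"] conjI ballI impI)
      show "a \<in> ball a (s/2)" using s(1) by simp
    qed (rule op, rule tr)
  qed (use assms that in auto)
  have "\<exists>c>0. \<forall>x\<in>K \<inter> UNIV. Q c x"
  proof (rule compact_uniform_constant[OF \<open>compact K\<close>])
    fix c c' y assume c: "Q c y" "0 < c'" "c' \<le> c"
    show "Q c' y"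
      unfolding Q_def
    proof (intro allI impI)
      fix F assume F: "hol_fun F \<Omega>" "\<forall>z\<in>\<Omega>. Re (F z) > 0"
      show "c' * Re (F y) \<le> Re (F p)"
      \<comment> \<open>Monotonicity in the constant is asked at arbitrary points \<open>y\<close>,
        where the real part may be negative; then the positive right-hand side decides.\<close>
      proof (cases "Re (F y) \<ge> 0")
        case True
        then have "c' * Re (F y) \<le> c * Re (F y)" using c(3) by (rule mult_right_mono[rotated])
        then show ?thesis using c(1) F unfolding Q_def by fastforce
      next
        case False
        then have "c' * Re (F y) \<le> 0" using c(2) by (simp add: mult_nonneg_nonpos)
        moreover have "0 < Re (F p)" using F(2) \<open>p \<in> \<Omega>\<close> by blast
        ultimately show ?thesis by linarith
      qed
    qed
  next
    fix x assume "x \<in> K"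
    then have x: "x \<in> \<Omega>" using assms by blast
    from nb[OF this] obtain s where s: "s > 0"
      and q: "\<And>y y' c. y \<in> ball x (s/2) \<Longrightarrow> y' \<in> ball x (s/2) \<Longrightarrow> c > 0 \<Longrightarrow> Q c y \<Longrightarrow> Q (c / 9) y'"
      by metis
    obtain c where "c > 0" "Q c x" using pt[OF x] by blast
    then show "\<exists>e>0. \<exists>c>0. \<forall>y\<in>ball x e \<inter> UNIV. Q c y"
      using q[of x _ c] s by (intro exI[of _ "s/2"] exI[of _ "c/9"] conjI) auto
  qed
  then show ?thesis unfolding Q_def by simp
qed

section \<open>Balls inside a domain with twice differentiable boundary\<close>

definition gradient :: "('a::euclidean_space \<Rightarrow>\<^sub>L real) \<Rightarrow> 'a" where
  "gradient D = (\<Sum>b\<in>Basis. blinfun_apply D b *\<^sub>R b)"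

lemma gradient_inner: "gradient D \<bullet> v = blinfun_apply D v"
proof -
  have "blinfun_apply D v = blinfun_apply D (\<Sum>b\<in>Basis. (v \<bullet> b) *\<^sub>R b)"
    by (simp add: euclidean_representation)
  also have "\<dots> = (\<Sum>b\<in>Basis. (v \<bullet> b) * blinfun_apply D b)"
    by (simp add: blinfun.sum_right blinfun.scaleR_right)
  finally show ?thesis
    by (simp add: gradient_def inner_sum_left inner_commute[of v] mult.commute)
qed

lemma norm_le_norm_gradient: "norm D \<le> norm (gradient D)"
  by (rule norm_blinfun_bound)
     (use Cauchy_Schwarz_ineq2[of "gradient D"] in \<open>simp_all add: gradient_inner\<close>)

text \<open>The second derivative is bounded near \<open>p\<close>, so \<open>D\<close> is Lipschitz
  there. The base point \<open>z\<close> of the expansion is free, as it will be a point inside the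
  domain rather than a boundary point.\<close>

lemma second_order_bound:
  fixes \<rho> :: "'a::euclidean_space \<Rightarrow> real" and D :: "'a \<Rightarrow> 'a \<Rightarrow>\<^sub>L real"
    and D2 :: "'a \<Rightarrow> 'a \<Rightarrow>\<^sub>L 'a \<Rightarrow>\<^sub>L real"
  assumes "open U" "p \<in> U"
    and D: "\<And>x. x \<in> U \<Longrightarrow> (\<rho> has_derivative blinfun_apply (D x)) (at x)"
    and D2: "\<And>x. x \<in> U \<Longrightarrow> (D has_derivative blinfun_apply (D2 x)) (at x)"
    and "continuous_on U D2"
  obtains e M where "e > 0" "M > 0" "ball p e \<subseteq> U"
    "\<And>y z. y \<in> ball p e \<Longrightarrow> z \<in> ball p e \<Longrightarrow>
      \<bar>\<rho> y - \<rho> z - blinfun_apply (D z) (y - z)\<bar> \<le> M * (norm (y - z))\<^sup>2"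
proof -
  have "isCont D2 p" using assms continuous_on_eq_continuous_at by blast
  then obtain e1 where e1: "e1 > 0" "\<And>x. dist x p < e1 \<Longrightarrow> dist (D2 x) (D2 p) < 1"
    unfolding continuous_at_eps_delta by (metis zero_less_one)
  obtain e2 where e2: "e2 > 0" "ball p e2 \<subseteq> U" using assms openE by blast
  define e where "e = min e1 e2"
  define M where "M = norm (D2 p) + 1"
  have U: "ball p e \<subseteq> U" using e2 by (auto simp: e_def)
  have M: "M > 0" unfolding M_def by (simp add: add_nonneg_pos)
  have D2M: "norm (D2 x) \<le> M" if "x \<in> ball p e" for x
    using e1(2)[of x] that norm_triangle_ineq2[of "D2 x" "D2 p"]
    by (simp add: M_def e_def dist_norm dist_commute norm_minus_commute)
  show ?thesis
  proof (rule that[of e M])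
    fix y z assume yz: "y \<in> ball p e" "z \<in> ball p e"
    have seg: "closed_segment z y \<subseteq> ball p e"
      using yz by (intro closed_segment_subset) auto
    have lip: "norm (D x - D z) \<le> M * norm (y - z)" if x: "x \<in> closed_segment z y" for x
    proof -
      have "norm (D x - D z) \<le> M * norm (x - z)"
      proof (rule differentiable_bound[where S="ball p e" and f'="\<lambda>x. blinfun_apply (D2 x)"])
        show "(D has_derivative blinfun_apply (D2 x)) (at x within ball p e)" if "x \<in> ball p e" for x
          using D2 U that has_derivative_at_withinI by blast
        show "onorm (blinfun_apply (D2 x)) \<le> M" if "x \<in> ball p e" for x
          using D2M[OF that] by (simp add: norm_blinfun.rep_eq)
      qed (use x seg yz in auto)
      also have "\<dots> \<le> M * norm (y - z)"
        using segment_bound(1)[OF x] M by (simp add: mult_left_mono)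
      finally show ?thesis .
    qed
    have "norm (\<rho> y - \<rho> z - blinfun_apply (D z) (y - z)) \<le> norm (y - z) * (M * norm (y - z))"
    proof (rule differentiable_bound_linearization[where S="closed_segment z y" and f'="\<lambda>x. blinfun_apply (D x)"])
      fix t :: real assume "t \<in> {0..1}"
      then show "z + t *\<^sub>R (y - z) \<in> closed_segment z y"
        by (auto simp: closed_segment_def algebra_simps intro!: exI[of _ t])
    next
      fix x assume x: "x \<in> closed_segment z y"
      then show "(\<rho> has_derivative blinfun_apply (D x)) (at x within closed_segment z y)"
        using D U seg has_derivative_at_withinI by blast
      have "onorm (blinfun_apply (D x) - blinfun_apply (D z)) = norm (D x - D z)"
        by (simp only: norm_blinfun.rep_eq minus_blinfun.rep_eq fun_diff_def)
      then show "onorm (blinfun_apply (D x) - blinfun_apply (D z)) \<le> M * norm (y - z)"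
        using lip[OF x] by simp
    qed auto
    then show "\<bar>\<rho> y - \<rho> z - blinfun_apply (D z) (y - z)\<bar> \<le> M * (norm (y - z))\<^sup>2"
      by (simp add: power2_eq_square algebra_simps)
  qed (use U e1 e2 M in \<open>auto simp: e_def\<close>)
qed

text \<open>The segment from \<open>z\<close> to \<open>y\<close> meets the frontier.\<close>

lemma infdist_frontier_le:
  fixes z :: "'a::real_normed_vector"
  assumes "z \<in> S" "y \<notin> S"
  shows "infdist z (frontier S) \<le> dist z y"
proof -
  have "closed_segment z y \<inter> frontier S \<noteq> {}"
    by (rule connected_Int_frontier) (use assms in auto)
  then obtain x where x: "x \<in> closed_segment z y" "x \<in> frontier S" by blast
  have "infdist z (frontier S) \<le> dist z x" by (rule infdist_le[OF x(2)])
  also have "\<dots> \<le> dist z y" using segment_bound(1)[OF x(1)] by (simp add: dist_norm norm_minus_commute)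
  finally show ?thesis .
qed

definition harnack_bound :: "(complex ^ 'n) set \<Rightarrow> complex ^ 'n \<Rightarrow> real \<Rightarrow> complex ^ 'n \<Rightarrow> bool" where
  "harnack_bound \<Omega> p c z \<longleftrightarrow> (\<forall>F. hol_fun F \<Omega> \<longrightarrow> (\<forall>z\<in>\<Omega>. Re (F z) > 0) \<longrightarrow>
     c * infdist z (frontier \<Omega>) * Re (F z) \<le> Re (F p))"

text \<open>The centre lies at distance \<open>r\<close> from \<open>z\<close> along the inward
  normal of the level set through \<open>z\<close>, which avoids projecting to the boundary. The
  radius R satisfies R^2 - r^2 = r \<delta>, so that R - r is comparable to \<delta>, an upper bound
  for the distance to the frontier.\<close>

lemma C2_boundary_interior_ball:
  fixes \<Omega> :: "(complex ^ 'n) set"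
  assumes "open \<Omega>" "C2_boundary \<Omega>" "p0 \<in> frontier \<Omega>"
  obtains e r where "e > 0" "r > 0"
    "\<And>z. z \<in> ball p0 e \<inter> \<Omega> \<Longrightarrow> \<exists>q \<delta>. norm (z - q) = r \<and> 0 < \<delta> \<and> \<delta> \<le> r \<and>
       infdist z (frontier \<Omega>) \<le> \<delta> \<and> ball q (sqrt (r\<^sup>2 + r * \<delta>)) \<subseteq> \<Omega>"
proof -
  from assms(2)[unfolded C2_boundary_def, rule_format, OF assms(3)]
  obtain U and \<rho> :: "complex ^ 'n \<Rightarrow> real" and D :: "complex ^ 'n \<Rightarrow> (complex ^ 'n) \<Rightarrow>\<^sub>L real"
    and D2 :: "complex ^ 'n \<Rightarrow> (complex ^ 'n) \<Rightarrow>\<^sub>L ((complex ^ 'n) \<Rightarrow>\<^sub>L real)"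
    where U: "open U \<and> p0 \<in> U \<and>
        (\<forall>x\<in>U. (\<rho> has_derivative blinfun_apply (D x)) (at x)) \<and>
        (\<forall>x\<in>U. (D has_derivative blinfun_apply (D2 x)) (at x)) \<and>
        continuous_on U D2 \<and> (\<forall>z\<in>U. z \<in> \<Omega> \<longleftrightarrow> \<rho> z < 0) \<and> (\<forall>z\<in>U \<inter> frontier \<Omega>. D z \<noteq> 0)"
    by (elim exE) (rule that)
  have "open U" "p0 \<in> U" "continuous_on U D2" using U by blast+
  have D: "(\<rho> has_derivative blinfun_apply (D x)) (at x)" if "x \<in> U" for x using U that by blast
  have D2: "(D has_derivative blinfun_apply (D2 x)) (at x)" if "x \<in> U" for x using U that by blast
  have \<rho>: "z \<in> \<Omega> \<longleftrightarrow> \<rho> z < 0" if "z \<in> U" for z using U that by blast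
  have "D p0 \<noteq> 0" using U assms(3) by blast
  obtain e1 M where e1: "e1 > 0" "ball p0 e1 \<subseteq> U" and "M > 0"
    and taylor: "\<And>y z. y \<in> ball p0 e1 \<Longrightarrow> z \<in> ball p0 e1 \<Longrightarrow>
      \<bar>\<rho> y - \<rho> z - blinfun_apply (D z) (y - z)\<bar> \<le> M * (norm (y - z))\<^sup>2"
  proof (rule second_order_bound[of U p0 \<rho> D D2])
    fix e M assume "0 < e" "0 < M" "ball p0 e \<subseteq> U" "\<And>y z. y \<in> ball p0 e \<Longrightarrow> z \<in> ball p0 e \<Longrightarrow>
      \<bar>\<rho> y - \<rho> z - blinfun_apply (D z) (y - z)\<bar> \<le> M * (norm (y - z))\<^sup>2"
    then show ?thesis by (intro that)
  qed (rule \<open>open U\<close> \<open>p0 \<in> U\<close> \<open>continuous_on U D2\<close> | erule D D2)+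
  define m where "m = norm (D p0) / 2"
  have "m > 0" using \<open>D p0 \<noteq> 0\<close> by (simp add: m_def)
  have "isCont D p0" using D2[OF \<open>p0 \<in> U\<close>] has_derivative_continuous by blast
  then obtain e2 where e2: "e2 > 0" "\<And>x. dist x p0 < e2 \<Longrightarrow> dist (D x) (D p0) < m"
    using \<open>m > 0\<close> unfolding continuous_at_eps_delta by metis
  have Dm: "norm (D x) \<ge> m" if "dist x p0 < e2" for x
    using e2(2)[OF that] norm_triangle_ineq2[of "D p0" "D x"]
    by (simp add: m_def dist_norm norm_minus_commute)
  \<comment> \<open>The first bound keeps all points in the region of the Taylor estimate. The
    second gives \<open>2 * M * r \<le> m \<le> G\<close>, so the quadratic error is dominated by
    the curvature of the ball.\<close>
  define r where "r = min (e1 / 4) (m / (2 * M))"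
  have r: "r > 0" "r \<le> e1 / 4" "2 * M * r \<le> m"
    using e1 \<open>m > 0\<close> \<open>M > 0\<close> by (auto simp: r_def min_def field_simps)
  have "p0 \<notin> \<Omega>" using assms(1,3) by (simp add: frontier_def interior_open)
  then have "\<rho> p0 \<ge> 0" using \<rho> \<open>p0 \<in> U\<close> by force
  have "isCont \<rho> p0" using D[OF \<open>p0 \<in> U\<close>] has_derivative_continuous by blast
  \<comment> \<open>This tolerance for \<open>\<rho>\<close> is what later forces
    \<open>\<delta> < r\<close>.\<close>
  moreover have "m * r / 2 > 0" using \<open>m > 0\<close> r by simp
  ultimately obtain e3 where e3: "e3 > 0" "\<And>x. dist x p0 < e3 \<Longrightarrow> dist (\<rho> x) (\<rho> p0) < m * r / 2"
    unfolding continuous_at_eps_delta by metis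
  define e where "e = Min {e1 / 4, e2, e3}"
  have e: "e > 0" "e \<le> e1 / 4" "e \<le> e2" "e \<le> e3" using e1 e2 e3 by (auto simp: e_def)
  show ?thesis
  proof (rule that[OF e(1) r(1)])
    fix z assume z: "z \<in> ball p0 e \<inter> \<Omega>"
    then have zd: "dist z p0 < e" by (simp add: dist_commute)
    have z1: "z \<in> ball p0 e1" using zd e e1 by (simp add: dist_commute)
    then have "\<rho> z < 0" using z \<rho> e1 by blast
    have "\<bar>\<rho> z\<bar> < m * r / 2" using e3(2)[of z] zd e \<open>\<rho> p0 \<ge> 0\<close> \<open>\<rho> z < 0\<close> by (simp add: dist_real_def)
    define G where "G = norm (gradient (D z))"
    have G: "G \<ge> m" "G > 0" using Dm[of z] norm_le_norm_gradient[of "D z"] zd e \<open>m > 0\<close> by (auto simp: G_def)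
    define \<nu> where "\<nu> = gradient (D z) /\<^sub>R G"
    have \<nu>: "norm \<nu> = 1" using G(2) by (simp add: \<nu>_def G_def)
    have Dz: "blinfun_apply (D z) v = G * (\<nu> \<bullet> v)" for v
      using G(2) by (simp add: \<nu>_def gradient_inner)
    \<comment> \<open>By Taylor's formula, \<open>\<rho>\<close> changes sign on the normal through \<open>z\<close> within distance \<open>\<delta>\<close>.\<close>
    define \<delta> where "\<delta> = - 2 * \<rho> z / G"
    have "\<delta> > 0" using \<open>\<rho> z < 0\<close> G(2) by (simp add: \<delta>_def divide_neg_pos)
    have "\<delta> < r"
    proof -
      have "- 2 * \<rho> z < m * r" using \<open>\<bar>\<rho> z\<bar> < m * r / 2\<close> by linarith
      also have "\<dots> \<le> G * r" using G r by (simp add: mult_right_mono)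
      finally show ?thesis unfolding \<delta>_def pos_divide_less_eq[OF G(2)] by (simp add: mult.commute)
    qed
    have G\<rho>: "\<rho> z = - (G * \<delta> / 2)" using G(2) by (simp add: \<delta>_def)
    have MG: "2 * M * r \<le> G" using r G by linarith
    show "\<exists>q \<delta>. norm (z - q) = r \<and> 0 < \<delta> \<and> \<delta> \<le> r \<and>
       infdist z (frontier \<Omega>) \<le> \<delta> \<and> ball q (sqrt (r\<^sup>2 + r * \<delta>)) \<subseteq> \<Omega>"
    proof (intro exI conjI)
      show "norm (z - (z - r *\<^sub>R \<nu>)) = r" using r \<nu> by simp
      show "0 < \<delta>" by fact
      show "\<delta> \<le> r" using \<open>\<delta> < r\<close> by simp
      show "infdist z (frontier \<Omega>) \<le> \<delta>"
      proof -
        let ?y = "z + \<delta> *\<^sub>R \<nu>"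
        have n: "norm (?y - z) = \<delta>" using \<open>\<delta> > 0\<close> \<nu> by simp
        have "dist p0 ?y < e1" using dist_triangle[of p0 ?y z] n zd e \<open>\<delta> < r\<close> r e1
          by (simp add: dist_norm norm_minus_commute)
        then have y: "?y \<in> ball p0 e1" by simp
        have "\<nu> \<bullet> \<nu> = 1" using \<nu> by (simp add: norm_eq_1)
        then have "\<bar>\<rho> ?y - \<rho> z - G * \<delta>\<bar> \<le> M * \<delta>\<^sup>2"
          using taylor[OF y z1] n by (simp add: Dz)
        moreover have "M * \<delta>\<^sup>2 \<le> (M * r) * \<delta>"
          using \<open>\<delta> < r\<close> \<open>\<delta> > 0\<close> \<open>M > 0\<close> by (simp add: power2_eq_square)
        moreover have "(M * r) * \<delta> \<le> G / 2 * \<delta>" using MG \<open>\<delta> > 0\<close> by (intro mult_right_mono) auto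
        ultimately have "\<rho> ?y \<ge> 0" using G\<rho> by (simp add: abs_le_iff)
        then have "?y \<notin> \<Omega>" using \<rho> y e1 by force
        then have "infdist z (frontier \<Omega>) \<le> dist z ?y" using z by (intro infdist_frontier_le) auto
        then show ?thesis using n by (simp add: dist_norm norm_minus_commute)
      qed
      \<comment> \<open>Membership means |y - z|^2 + 2 r <\<nu>, y - z> < r \<delta>. As
        \<open>\<rho> z = - (G * \<delta> / 2)\<close> and 2 M r \<le> G, Taylor's formula bounds 2
        r \<open>\<rho> y\<close> by G times the difference of the two sides, which is
        negative.\<close>
      show "ball (z - r *\<^sub>R \<nu>) (sqrt (r\<^sup>2 + r * \<delta>)) \<subseteq> \<Omega>"
      proof
        fix y assume "y \<in> ball (z - r *\<^sub>R \<nu>) (sqrt (r\<^sup>2 + r * \<delta>))"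
        then have "norm ((y - z) + r *\<^sub>R \<nu>) < sqrt (r\<^sup>2 + r * \<delta>)"
          by (simp add: dist_norm norm_minus_commute algebra_simps)
        then have n: "(norm ((y - z) + r *\<^sub>R \<nu>))\<^sup>2 < r\<^sup>2 + r * \<delta>"
          using power_strict_mono[OF _ norm_ge_zero, of "(y - z) + r *\<^sub>R \<nu>" "sqrt (r\<^sup>2 + r * \<delta>)" 2] r \<open>\<delta> > 0\<close>
          by (simp add: add_nonneg_nonneg)
        have "(norm ((y - z) + r *\<^sub>R \<nu>))\<^sup>2 = (norm (y - z))\<^sup>2 + 2 * r * (\<nu> \<bullet> (y - z)) + r\<^sup>2"
        proof -
          have "\<nu> \<bullet> \<nu> = 1" using \<nu> by (simp add: norm_eq_1)
          then show ?thesis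
            unfolding power2_norm_eq_inner inner_add_left inner_add_right inner_scaleR_left inner_scaleR_right
            by (simp add: inner_commute[of "y - z" \<nu>] power2_eq_square[of r] distrib_left)
        qed
        with n have n2: "(norm (y - z))\<^sup>2 + 2 * r * (\<nu> \<bullet> (y - z)) < r * \<delta>" by simp
        have "(norm ((y - z) + r *\<^sub>R \<nu>))\<^sup>2 < (2 * r)\<^sup>2"
        proof -
          have "r * \<delta> < r * r" using \<open>\<delta> < r\<close> r by simp
          then show ?thesis using n mult_pos_pos[OF r(1) r(1)] by (simp add: power2_eq_square)
        qed
        then have "norm ((y - z) + r *\<^sub>R \<nu>) < 2 * r"
          by (rule power_less_imp_less_base) (use r(1) in simp)
        moreover have "norm (y - z) \<le> norm ((y - z) + r *\<^sub>R \<nu>) + r"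
          using norm_triangle_ineq4[of "(y - z) + r *\<^sub>R \<nu>" "r *\<^sub>R \<nu>"] r \<nu> by simp
        ultimately have "dist p0 y < e1" using dist_triangle[of p0 y z] zd e r
          by (simp add: dist_norm norm_minus_commute)
        then have y: "y \<in> ball p0 e1" by simp
        have "\<rho> y \<le> \<rho> z + G * (\<nu> \<bullet> (y - z)) + M * (norm (y - z))\<^sup>2"
          using taylor[OF y z1] by (simp add: Dz abs_le_iff)
        then have "2 * r * \<rho> y \<le> 2 * r * (\<rho> z + G * (\<nu> \<bullet> (y - z)) + M * (norm (y - z))\<^sup>2)"
          using r by (intro mult_left_mono) auto
        also have "\<dots> = G * (2 * r * (\<nu> \<bullet> (y - z)) - r * \<delta>) + (2 * M * r) * (norm (y - z))\<^sup>2"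
          by (simp add: G\<rho> algebra_simps)
        also have "\<dots> \<le> G * (2 * r * (\<nu> \<bullet> (y - z)) - r * \<delta>) + G * (norm (y - z))\<^sup>2"
          using MG by (intro add_left_mono mult_right_mono) auto
        also have "\<dots> = G * ((norm (y - z))\<^sup>2 + 2 * r * (\<nu> \<bullet> (y - z)) - r * \<delta>)"
          by (simp add: algebra_simps)
        also have "\<dots> < 0" using n2 G(2) by (simp add: mult_pos_neg)
        finally have "\<rho> y < 0" using r by (simp add: mult_less_0_iff)
        then show "y \<in> \<Omega>" using \<rho> y e1 by blast
      qed
    qed
  qed
qed

text \<open>Two comparisons are combined: from \<open>z\<close> to the centre \<open>q\<close> of
  its inner ball, losing a factor proportional to \<open>\<delta>\<close>, and from \<open>q\<close>
  to \<open>p\<close>, losing a fixed factor since the centres stay in a compact set.\<close>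

lemma harnack_bound_boundary:
  fixes \<Omega> :: "(complex ^ 'n) set"
  assumes "open \<Omega>" "connected \<Omega>" "bounded \<Omega>" "C2_boundary \<Omega>" "p \<in> \<Omega>" "p0 \<in> frontier \<Omega>"
  shows "\<exists>e>0. \<exists>c>0. \<forall>z\<in>ball p0 e \<inter> \<Omega>. harnack_bound \<Omega> p c z"
proof -
  obtain e r where er: "e > 0" "r > 0"
    and ball: "\<And>z. z \<in> ball p0 e \<inter> \<Omega> \<Longrightarrow> \<exists>q \<delta>. norm (z - q) = r \<and> 0 < \<delta> \<and> \<delta> \<le> r \<and>
       infdist z (frontier \<Omega>) \<le> \<delta> \<and> ball q (sqrt (r\<^sup>2 + r * \<delta>)) \<subseteq> \<Omega>"
    using C2_boundary_interior_ball[OF assms(1,4,6)] by blast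
  \<comment> \<open>A ball of radius greater than \<open>r\<close> around each centre
    \<open>q\<close> lies in the domain, so this set contains all centres.\<close>
  define K where "K = {x \<in> closure \<Omega>. infdist x (- \<Omega>) \<ge> r}"
  have ne: "- \<Omega> \<noteq> {}" using assms(1,6) by (auto simp: frontier_def interior_open)
  have "compact K"
  proof -
    have "compact (closure \<Omega> \<inter> (\<lambda>x. infdist x (- \<Omega>)) -` {r..})"
      by (intro compact_Int_closed closed_vimage)
         (use assms in \<open>auto simp: compact_closure intro!: continuous_intros\<close>)
    moreover have "closure \<Omega> \<inter> (\<lambda>x. infdist x (- \<Omega>)) -` {r..} = K" by (auto simp: K_def)
    ultimately show ?thesis by simp
  qed
  have "K \<subseteq> \<Omega>"
  proof
    fix x assume "x \<in> K"
    show "x \<in> \<Omega>"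
    proof (rule ccontr)
      assume "x \<notin> \<Omega>"
      then have "infdist x (- \<Omega>) = 0" by simp
      then show False using \<open>x \<in> K\<close> er by (simp add: K_def)
    qed
  qed
  obtain c where c: "c > 0" "\<And>x F. x \<in> K \<Longrightarrow> hol_fun F \<Omega> \<Longrightarrow> (\<forall>z\<in>\<Omega>. Re (F z) > 0) \<Longrightarrow> c * Re (F x) \<le> Re (F p)"
    using harnack_compact[OF assms(1,2,5) \<open>compact K\<close> \<open>K \<subseteq> \<Omega>\<close>] by blast
  \<comment> \<open>From (R + r)(R - r) = r \<delta> and R + r \<le> 3 r, the first comparison costs
    the factor \<open>\<delta> / (9 * r)\<close>.\<close>
  have "harnack_bound \<Omega> p (c / (9 * r)) z" if z: "z \<in> ball p0 e \<inter> \<Omega>" for z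
    unfolding harnack_bound_def
  proof (intro allI impI)
    fix F assume F: "hol_fun F \<Omega>" "\<forall>z\<in>\<Omega>. Re (F z) > 0"
    obtain q \<delta> where q: "norm (z - q) = r" "0 < \<delta>" "\<delta> \<le> r" "infdist z (frontier \<Omega>) \<le> \<delta>"
      "ball q (sqrt (r\<^sup>2 + r * \<delta>)) \<subseteq> \<Omega>" using ball[OF z] by blast
    define R where "R = sqrt (r\<^sup>2 + r * \<delta>)"
    have R2: "R\<^sup>2 = r\<^sup>2 + r * \<delta>" using q er by (simp add: R_def)
    have "R \<ge> 0" using q er by (simp add: R_def)
    have "r\<^sup>2 < R\<^sup>2" using q er by (simp add: R2)
    then have "r < R" using \<open>R \<ge> 0\<close> by (rule power_less_imp_less_base)
    have "r * \<delta> \<le> r * r" using q er by simp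
    then have "R\<^sup>2 \<le> (2 * r)\<^sup>2" unfolding R2 using er by (simp add: power2_eq_square)
    then have "R \<le> 2 * r" using er by (auto intro: power2_le_imp_le)
    have dz: "dist q z = r" using q(1) by (simp add: dist_norm norm_minus_commute)
    then have zb: "z \<in> ball q R" using \<open>r < R\<close> by simp
    have h: "(R - r) * Re (F z) \<le> (R + r) * Re (F q)"
      using harnack_ball(2)[OF F(1) _ q(5)[folded R_def] zb] F(2) dz by simp
    have qR: "q \<in> ball q R" using \<open>r < R\<close> er by simp
    then have "q \<in> \<Omega>" using q(5)[folded R_def] by blast
    have "infdist q (- \<Omega>) \<ge> r"
      unfolding infdist_notempty[OF ne]
    proof (rule cINF_greatest[OF ne])
      fix y assume "y \<in> - \<Omega>"
      then have "y \<notin> ball q R" using q(5)[folded R_def] by blast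
      then show "r \<le> dist q y" using \<open>r < R\<close> by simp
    qed
    then have "q \<in> K" using \<open>q \<in> \<Omega>\<close> closure_subset by (auto simp: K_def)
    have pos: "Re (F q) > 0" "Re (F z) > 0" using F(2) \<open>q \<in> \<Omega>\<close> z by auto
    have "(R + r) * ((R - r) * Re (F z)) \<le> (R + r) * ((R + r) * Re (F q))"
      using h \<open>R \<ge> 0\<close> er by (intro mult_left_mono) auto
    also have "(R + r) * ((R - r) * Re (F z)) = r * \<delta> * Re (F z)"
      proof -
      have "(R + r) * ((R - r) * x) = (R\<^sup>2 - r\<^sup>2) * x" for x by (simp add: power2_eq_square algebra_simps)
      then show ?thesis by (simp add: R2)
    qed
    also have "(R + r) * ((R + r) * Re (F q)) \<le> (3 * r) * ((3 * r) * Re (F q))"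
      using \<open>R \<le> 2 * r\<close> \<open>R \<ge> 0\<close> pos er by (intro mult_mono) auto
    finally have "r * (\<delta> * Re (F z)) \<le> r * (9 * r * Re (F q))" by (simp add: algebra_simps)
    then have "\<delta> * Re (F z) \<le> 9 * r * Re (F q)" using er by simp
    then have "c / (9 * r) * (\<delta> * Re (F z)) \<le> c / (9 * r) * (9 * r * Re (F q))"
      using c er by (intro mult_left_mono) auto
    also have "\<dots> = c * Re (F q)" using er by simp
    also have "\<dots> \<le> Re (F p)" by (rule c(2)[OF \<open>q \<in> K\<close> F])
    finally have "c / (9 * r) * (\<delta> * Re (F z)) \<le> Re (F p)" .
    moreover have "c / (9 * r) * (infdist z (frontier \<Omega>) * Re (F z)) \<le> c / (9 * r) * (\<delta> * Re (F z))"
      using q pos c er by (intro mult_left_mono mult_right_mono) auto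
    ultimately show "c / (9 * r) * infdist z (frontier \<Omega>) * Re (F z) \<le> Re (F p)"
      by (simp add: mult.assoc)
  qed
  moreover have "c / (9 * r) > 0" using c er by simp
  ultimately show ?thesis using er(1) by blast
qed

text \<open>The compact closure is covered by neighbourhoods of its points. Around an interior point
  the distance to the frontier is bounded, and the compact version of Harnack's inequality
  suffices.\<close>

lemma harnack_bound_uniform:
  fixes \<Omega> :: "(complex ^ 'n) set"
  assumes "open \<Omega>" "connected \<Omega>" "bounded \<Omega>" "C2_boundary \<Omega>" "p \<in> \<Omega>"
  shows "\<exists>c>0. \<forall>z\<in>\<Omega>. harnack_bound \<Omega> p c z"
proof -
  have "\<exists>c>0. \<forall>z\<in>closure \<Omega> \<inter> \<Omega>. harnack_bound \<Omega> p c z"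
  proof (rule compact_uniform_constant)
    show "compact (closure \<Omega>)" using assms by (simp add: compact_closure)
    fix c c' z assume c: "harnack_bound \<Omega> p c z" "0 < c'" "c' \<le> c"
    show "harnack_bound \<Omega> p c' z"
      unfolding harnack_bound_def
    proof (intro allI impI)
      fix F assume F: "hol_fun F \<Omega>" "\<forall>z\<in>\<Omega>. Re (F z) > 0"
      let ?t = "infdist z (frontier \<Omega>) * Re (F z)"
      have Fp: "0 < Re (F p)" using F(2) assms(5) by blast
      have 1: "c * ?t \<le> Re (F p)" using c(1) F unfolding harnack_bound_def by (simp add: mult.assoc)
      have "c' * ?t \<le> Re (F p)"
      proof (cases "?t \<ge> 0")
        case True
        then have "c' * ?t \<le> c * ?t" by (rule mult_right_mono[OF c(3)])
        then show ?thesis using 1 by linarith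
      next
        case False
        then have "c' * ?t \<le> 0" using c(2) by (simp add: mult_nonneg_nonpos)
        then show ?thesis using Fp by linarith
      qed
      then show "c' * infdist z (frontier \<Omega>) * Re (F z) \<le> Re (F p)" by (simp add: mult.assoc)
    qed
  next
    fix x assume "x \<in> closure \<Omega>"
    show "\<exists>e>0. \<exists>c>0. \<forall>z\<in>ball x e \<inter> \<Omega>. harnack_bound \<Omega> p c z"
    proof (cases "x \<in> \<Omega>")
      case False
      then have "x \<in> frontier \<Omega>" using \<open>x \<in> closure \<Omega>\<close> assms(1) by (simp add: frontier_def interior_open)
      then show ?thesis by (rule harnack_bound_boundary[OF assms])
    next
      case True
      then obtain e where e: "e > 0" "cball x e \<subseteq> \<Omega>" using assms(1) open_contains_cball by blast
      obtain c where c: "c > 0" "\<And>x' F. x' \<in> cball x e \<Longrightarrow> hol_fun F \<Omega> \<Longrightarrow> (\<forall>z\<in>\<Omega>. Re (F z) > 0) \<Longrightarrow> c * Re (F x') \<le> Re (F p)"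
        using harnack_compact[OF assms(1,2,5) compact_cball e(2)] by blast
      define d where "d = infdist x (frontier \<Omega>) + e"
      have d: "d > 0" using e infdist_nonneg[of x] by (simp add: d_def add_nonneg_pos)
      have "harnack_bound \<Omega> p (c / d) z" if z: "z \<in> ball x e \<inter> \<Omega>" for z
        unfolding harnack_bound_def
      proof (intro allI impI)
        fix F assume F: "hol_fun F \<Omega>" "\<forall>z\<in>\<Omega>. Re (F z) > 0"
        have "infdist z (frontier \<Omega>) \<le> d"
          using infdist_triangle[of z "frontier \<Omega>" x] z by (simp add: d_def dist_commute)
        then have "(c / d * Re (F z)) * infdist z (frontier \<Omega>) \<le> (c / d * Re (F z)) * d"
          using F(2) z c d by (intro mult_left_mono) (auto simp: less_imp_le)
        also have "\<dots> = c * Re (F z)" using d by simp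
        also have "\<dots> \<le> Re (F p)" using z c(2)[OF _ F, of z] by simp
        finally show "c / d * infdist z (frontier \<Omega>) * Re (F z) \<le> Re (F p)" by (simp add: algebra_simps)
      qed
      moreover have "c / d > 0" using c d by simp
      ultimately show ?thesis using e(1) by blast
    qed
  qed
  then show ?thesis using closure_subset by fastforce
qed

section \<open>Automorphisms of the unit ball\<close>

text \<open>The Hermitian inner product, complex linear in the first argument; the Euclidean
  \<open>inner\<close> is only its real part and would not preserve holomorphy.\<close>

definition cdot :: "complex ^ 'n \<Rightarrow> complex ^ 'n \<Rightarrow> complex" where
  "cdot w a = (\<Sum>i\<in>UNIV. w $ i * cnj (a $ i))"

lemma cdot_self: "cdot w w = complex_of_real ((norm w)\<^sup>2)"
proof -
  have "(norm w)\<^sup>2 = (\<Sum>i\<in>UNIV. (norm (w $ i))\<^sup>2)"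
    by (simp add: norm_vec_def L2_set_def sum_nonneg)
  then show ?thesis
    unfolding cdot_def by (simp only: complex_norm_square of_real_sum)
qed

lemma cdot_cnj: "cdot a w = cnj (cdot w a)"
  by (simp add: cdot_def mult.commute)

lemma cdot_diff_left: "cdot (x - y) a = cdot x a - cdot y a"
  by (simp add: cdot_def sum_subtractf left_diff_distrib)

lemma cdot_cscale_left: "cdot (c *s x) a = c * cdot x a"
  by (simp add: cdot_def sum_distrib_left mult.assoc)

lemma cdot_diff_right: "cdot a (x - y) = cdot a x - cdot a y"
  by (simp add: cdot_def sum_subtractf right_diff_distrib)

lemma cdot_cscale_right: "cdot a (c *s x) = cnj c * cdot a x"
  by (simp add: cdot_def sum_distrib_left algebra_simps)

lemma norm_cdot_le: "norm (cdot w a) \<le> norm w * norm a"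
proof -
  have "norm (cdot w a) \<le> (\<Sum>i\<in>UNIV. \<bar>norm (w $ i)\<bar> * \<bar>norm (a $ i)\<bar>)"
    unfolding cdot_def by (rule sum_norm_le) (simp add: norm_mult)
  also have "\<dots> \<le> norm w * norm a"
    unfolding norm_vec_def by (rule L2_set_mult_ineq)
  finally show ?thesis .
qed

lemma hol_fun_cdot: "holomorphic_on_cn f S \<Longrightarrow> hol_fun (\<lambda>z. cdot (f z) a) S"
  unfolding cdot_def holomorphic_on_cn_iff
  by (intro hol_fun_sum hol_fun_mult hol_fun_const) blast

text \<open>
  The usual formula has the projections onto the line of \<open>a\<close> and its complement in it; they are eliminated here, so
  that it also makes sense for \<open>a = 0\<close>.
\<close>

definition ball_aut :: "complex ^ 'n \<Rightarrow> complex ^ 'n \<Rightarrow> complex ^ 'n" where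
  "ball_aut a w = (let s = complex_of_real (sqrt (1 - (norm a)\<^sup>2)); \<mu> = cdot w a in
     (1 / (1 - \<mu>)) *s ((1 - \<mu> / (1 + s)) *s a - s *s w))"

lemma ball_aut_nth:
  "ball_aut a w $ j = (1 / (1 - cdot w a)) * ((1 - cdot w a / (1 + complex_of_real (sqrt (1 - (norm a)\<^sup>2)))) * a $ j -
     complex_of_real (sqrt (1 - (norm a)\<^sup>2)) * w $ j)"
  unfolding ball_aut_def Let_def by (simp only: vector_smult_component vector_minus_component)

context
  fixes a :: "complex ^ 'n"
  assumes a: "norm a < 1"
begin

lemma one_minus_cdot: "norm w \<le> 1 \<Longrightarrow> 1 - cdot w a \<noteq> 0"
proof
  assume "norm w \<le> 1" "1 - cdot w a = 0"
  then have "1 \<le> norm w * norm a" using norm_cdot_le[of w a] by (metis eq_iff_diff_eq_0 norm_one)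
  also have "\<dots> \<le> 1 * norm a" using \<open>norm w \<le> 1\<close> by (intro mult_right_mono) auto
  finally show False using a by simp
qed

text \<open>The classical identity for 1 - |\<phi>(w)|^2, multiplied by its denominator. It yields
  both that the ball is preserved and how far interior points are moved towards the sphere.\<close>

lemma ball_aut_norm:
  assumes "norm w \<le> 1"
  shows "(norm (1 - cdot w a))\<^sup>2 * (1 - (norm (ball_aut a w))\<^sup>2) = (1 - (norm a)\<^sup>2) * (1 - (norm w)\<^sup>2)"
proof -
  define r where "r = sqrt (1 - (norm a)\<^sup>2)"
  define s where "s = complex_of_real r"
  define \<mu> where "\<mu> = cdot w a"
  define k where "k = 1 - \<mu> / (1 + s)"
  \<comment> \<open>\<open>N\<close> is the numerator of the automorphism. Expanding its Hermitian
    square with |a|^2 = 1 - s^2 makes the factor 1 + s cancel.\<close>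
  define N where "N = k *s a - s *s w"
  have "(norm a)\<^sup>2 < 1" using a by (simp add: power_less_one_iff)
  then have r: "r > 0" "r\<^sup>2 = 1 - (norm a)\<^sup>2" by (simp_all add: r_def)
  have s1: "1 + s \<noteq> 0" using r(1) unfolding s_def by (metis add_pos_pos less_numeral_extra(1,3) of_real_1 of_real_add of_real_eq_0_iff)
  have cs: "cnj s = s" by (simp add: s_def)
  have s2: "cdot a a = 1 - s\<^sup>2"
    unfolding cdot_self s_def using r(2) by (simp flip: of_real_power)
  have "cdot N N = k * cnj k * cdot a a - k * s * cdot a w - s * cnj k * cdot w a + s * s * cdot w w"
    by (simp add: N_def cdot_diff_left cdot_diff_right cdot_cscale_left cdot_cscale_right cs algebra_simps)
  also have "\<dots> = k * cnj k * (1 - s\<^sup>2) - k * s * cnj \<mu> - s * cnj k * \<mu> + s\<^sup>2 * cdot w w"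
    by (simp add: s2 \<mu>_def cdot_cnj[of a w] power2_eq_square)
  also have "\<dots> = (1 - \<mu>) * (1 - cnj \<mu>) - s\<^sup>2 * (1 - cdot w w)"
  proof -
    have k: "k = (1 + s - \<mu>) / (1 + s)" "cnj k = (1 + s - cnj \<mu>) / (1 + s)"
      using s1 by (simp_all add: k_def cs field_simps)
    show ?thesis unfolding k using s1
      by (simp add: divide_simps cs) (simp add: algebra_simps power2_eq_square)
  qed
  finally have NN: "cdot N N = (1 - \<mu>) * (1 - cnj \<mu>) - s\<^sup>2 * (1 - cdot w w)" .
  have "complex_of_real ((norm N)\<^sup>2) = complex_of_real ((norm (1 - \<mu>))\<^sup>2 - r\<^sup>2 * (1 - (norm w)\<^sup>2))"
    using NN unfolding cdot_self by (simp add: s_def complex_norm_square complex_cnj_diff del: of_real_power)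
      (simp add: power2_eq_square)
  then have n: "(norm N)\<^sup>2 = (norm (1 - \<mu>))\<^sup>2 - r\<^sup>2 * (1 - (norm w)\<^sup>2)" by (simp only: of_real_eq_iff)
  have "ball_aut a w = (1 / (1 - \<mu>)) *s N"
    by (simp add: ball_aut_def Let_def N_def k_def \<mu>_def s_def r_def)
  then have "norm (ball_aut a w) = norm N / norm (1 - \<mu>)" by (simp add: norm_cscale norm_divide)
  moreover have "norm (1 - \<mu>) \<noteq> 0" using one_minus_cdot[OF assms] by (simp add: \<mu>_def)
  ultimately have "(norm (1 - \<mu>))\<^sup>2 * (1 - (norm (ball_aut a w))\<^sup>2) = (norm (1 - \<mu>))\<^sup>2 - (norm N)\<^sup>2"
    by (simp add: power_divide right_diff_distrib)
  then show ?thesis using n r(2) by (simp add: \<mu>_def)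
qed

lemma ball_aut_in_ball: "norm w < 1 \<Longrightarrow> norm (ball_aut a w) < 1"
proof -
  assume w: "norm w < 1"
  have "(norm a)\<^sup>2 < 1" "(norm w)\<^sup>2 < 1" using a w by (simp_all add: power_less_one_iff)
  then have "0 < (norm (1 - cdot w a))\<^sup>2 * (1 - (norm (ball_aut a w))\<^sup>2)"
    unfolding ball_aut_norm[OF less_imp_le[OF w]] by simp
  then have "(norm (ball_aut a w))\<^sup>2 < 1" by (simp add: zero_less_mult_iff)
  then show ?thesis by (simp add: power_less_one_iff)
qed

lemma ball_aut_involution:
  assumes w: "norm w < 1"
  shows "ball_aut a (ball_aut a w) = w"
proof -
  define s where "s = complex_of_real (sqrt (1 - (norm a)\<^sup>2))"
  define \<mu> where "\<mu> = cdot w a"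
  have aut: "ball_aut a w = (1 / (1 - cdot w a)) *s ((1 - cdot w a / (1 + s)) *s a - s *s w)" for w
    by (simp add: ball_aut_def Let_def s_def)
  have a1: "(norm a)\<^sup>2 < 1" using a by (simp add: power_less_one_iff)
  then have s2: "cdot a a = 1 - s\<^sup>2" and s0: "s \<noteq> 0"
    unfolding cdot_self s_def by (simp_all flip: of_real_power)
  have s1: "1 + s \<noteq> 0"
  proof -
    have "1 + sqrt (1 - (norm a)\<^sup>2) \<noteq> 0" using a1 by (smt (verit) real_sqrt_gt_zero)
    then show ?thesis unfolding s_def by (metis of_real_1 of_real_add of_real_eq_0_iff)
  qed
  have m: "1 - \<mu> \<noteq> 0" using one_minus_cdot w by (simp add: \<mu>_def)
  \<comment> \<open>The second application depends on the first only through its components and this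
    pairing with \<open>a\<close>.\<close>
  have c: "cdot (ball_aut a w) a = (1 - s\<^sup>2 - \<mu>) / (1 - \<mu>)"
    unfolding aut cdot_cscale_left cdot_diff_left \<mu>_def[symmetric] s2
    using s1 m by (simp add: divide_simps) (simp add: algebra_simps power2_eq_square)
  have "1 - (1 - s\<^sup>2 - \<mu>) / (1 - \<mu>) = s\<^sup>2 / (1 - \<mu>)"
    using m by (simp add: field_simps)
  then have i: "1 / (1 - (1 - s\<^sup>2 - \<mu>) / (1 - \<mu>)) = (1 - \<mu>) / s\<^sup>2" by simp
  have "ball_aut a (ball_aut a w) $ j = w $ j" for j
  proof -
    have "ball_aut a (ball_aut a w) $ j = (1 - \<mu>) / s\<^sup>2 *
        ((1 - (1 - s\<^sup>2 - \<mu>) / (1 - \<mu>) / (1 + s)) * a $ j - s * (ball_aut a w $ j))"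
      unfolding ball_aut_nth[of a "ball_aut a w"] c i s_def[symmetric] ..
    also have "ball_aut a w $ j = (1 / (1 - \<mu>)) * ((1 - \<mu> / (1 + s)) * a $ j - s * w $ j)"
      unfolding ball_aut_nth s_def \<mu>_def ..
    also have "(1 - \<mu>) / s\<^sup>2 * ((1 - (1 - s\<^sup>2 - \<mu>) / (1 - \<mu>) / (1 + s)) * a $ j -
        s * ((1 / (1 - \<mu>)) * ((1 - \<mu> / (1 + s)) * a $ j - s * w $ j))) = w $ j"
    proof -
      \<comment> \<open>This identity makes the coefficient of \<open>a $ j\<close> vanish, leaving
        \<open>w $ j\<close>.\<close>
      have 1: "(1 - \<mu>) * (1 - (1 - s\<^sup>2 - \<mu>) / (1 - \<mu>) / (1 + s)) = s * (1 - \<mu> / (1 + s))"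
        using s1 m by (simp add: divide_simps) (simp add: algebra_simps power2_eq_square)
      have "(1 - \<mu>) / s\<^sup>2 * (X * A - s * ((1 / (1 - \<mu>)) * (Y * A - s * W)))
          = ((1 - \<mu>) * X * A - s * Y * A) / s\<^sup>2 + W" for X Y A W
        using s0 m by (simp add: divide_simps) (simp add: algebra_simps power2_eq_square)
      from this[of "1 - (1 - s\<^sup>2 - \<mu>) / (1 - \<mu>) / (1 + s)" "a $ j" "1 - \<mu> / (1 + s)" "w $ j"]
      show ?thesis unfolding 1 by simp
    qed
    finally show ?thesis .
  qed
  then show ?thesis by (simp add: vec_eq_iff)
qed

lemma ball_aut_holomorphic: "holomorphic_on_cn (ball_aut a) (ball 0 1)"
  unfolding holomorphic_on_cn_iff
proof
  fix i
  have id: "holomorphic_on_cn (\<lambda>z. z) (ball 0 1)" unfolding holomorphic_on_cn_iff by (simp add: hol_fun_component)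
  note c = hol_fun_cdot[OF id, of a]
  have "hol_fun (\<lambda>w. (1 / (1 - cdot w a)) *
      ((1 - cdot w a * (1 / (1 + complex_of_real (sqrt (1 - (norm a)\<^sup>2))))) * a $ i -
        complex_of_real (sqrt (1 - (norm a)\<^sup>2)) * w $ i)) (ball 0 1)"
    by (intro hol_fun_mult hol_fun_divide hol_fun_diff hol_fun_const hol_fun_component c one_minus_cdot)
       simp
  then show "hol_fun (\<lambda>z. ball_aut a z $ i) (ball 0 1)"
    unfolding ball_aut_nth by simp
qed

lemma ball_aut_center: "ball_aut a a = 0"
proof -
  define r where "r = sqrt (1 - (norm a)\<^sup>2)"
  have "(norm a)\<^sup>2 < 1" using a by (simp add: power_less_one_iff)
  then have r: "r > 0" "(norm a)\<^sup>2 = 1 - r\<^sup>2" by (simp_all add: r_def)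
  have "1 + complex_of_real r \<noteq> 0"
    using r(1) by (metis add_pos_pos less_numeral_extra(1,3) of_real_1 of_real_add of_real_eq_0_iff)
  then have "1 - complex_of_real (1 - r\<^sup>2) / (1 + complex_of_real r) = complex_of_real r"
    by (simp add: field_simps power2_eq_square)
  then have "(1 - complex_of_real (1 - r\<^sup>2) / (1 + complex_of_real r)) *s a - complex_of_real r *s a = 0"
    by simp
  then show ?thesis
    unfolding ball_aut_def Let_def cdot_self r_def[symmetric] r(2)[symmetric] by simp
qed

text \<open>For |u| < 1 - \<epsilon> and w = \<open>ball_aut a u\<close>, the norm identity gives 4
  (1 - |w|^2) > \<epsilon> (1 - |a|). Together with 1 - |w|^2 \<le> 2 (1 - |w|) this produces the 8
  and |w| < r; the involution sends w back to u.\<close>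

lemma ball_aut_ball_subset:
  assumes \<epsilon>: "0 < \<epsilon>" "\<epsilon> < 1" and le: "8 * (1 - r) \<le> \<epsilon> * (1 - norm a)"
  shows "ball 0 (1 - \<epsilon>) \<subseteq> ball_aut a ` ball 0 r"
proof
  fix u :: "complex ^ 'n" assume "u \<in> ball 0 (1 - \<epsilon>)"
  then have u: "norm u < 1 - \<epsilon>" by simp
  let ?w = "ball_aut a u"
  have "norm (1 - cdot u a) \<le> 1 + norm u * norm a"
    using norm_triangle_ineq4[of 1 "cdot u a"] norm_cdot_le[of u a] by simp
  also have "norm u * norm a \<le> 1 * 1" using u \<epsilon> a by (intro mult_mono) auto
  finally have "(norm (1 - cdot u a))\<^sup>2 \<le> 2\<^sup>2" by (intro power_mono) auto
  moreover have w1: "norm ?w < 1" using u \<epsilon> by (intro ball_aut_in_ball) simp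
  then have "(norm ?w)\<^sup>2 \<le> 1" by (simp add: power_le_one)
  ultimately have "(norm (1 - cdot u a))\<^sup>2 * (1 - (norm ?w)\<^sup>2) \<le> 2\<^sup>2 * (1 - (norm ?w)\<^sup>2)"
    by (intro mult_right_mono) auto
  then have 1: "(1 - (norm a)\<^sup>2) * (1 - (norm u)\<^sup>2) \<le> 4 * (1 - (norm ?w)\<^sup>2)"
    using u \<epsilon> by (subst (asm) ball_aut_norm) auto
  have sq: "1 - x \<le> 1 - x\<^sup>2" if "0 \<le> x" "x \<le> 1" for x :: real
    using mult_left_mono[of x 1 x] that by (simp add: power2_eq_square)
  have "(1 - norm a) * \<epsilon> < (1 - (norm a)\<^sup>2) * (1 - (norm u)\<^sup>2)"
    using sq[of "norm a"] sq[of "norm u"] a u \<epsilon> by (intro mult_le_less_imp_less) auto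
  with 1 le have "8 * (1 - r) < 4 * (1 - (norm ?w)\<^sup>2)" by (simp add: mult.commute)
  moreover have "1 - (norm ?w)\<^sup>2 \<le> 2 * (1 - norm ?w)"
    using zero_le_power2[of "1 - norm ?w"] by (simp add: power2_eq_square algebra_simps)
  then have "4 * (1 - (norm ?w)\<^sup>2) \<le> 8 * (1 - norm ?w)" by simp
  ultimately have "8 * (1 - r) < 8 * (1 - norm ?w)" by (rule less_le_trans)
  then have "norm ?w < r" by simp
  moreover have "u = ball_aut a ?w" using ball_aut_involution[of u] u \<epsilon> by simp
  ultimately show "u \<in> ball_aut a ` ball 0 r" by (intro image_eqI[of u _ ?w]) simp_all
qed

end

section \<open>Limits of holomorphic maps\<close>

text \<open>Cauchy's estimate for the slice from \<open>x\<close> to \<open>y\<close>: a disc of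
  radius \<open>r / N\<close> in the parameter corresponds to displacements of length
  \<open>r\<close>, which remain in \<open>S\<close> along the whole segment.\<close>

lemma hol_fun_lipschitz:
  fixes f :: "complex ^ 'n \<Rightarrow> complex"
  assumes f: "hol_fun f S" and M: "\<And>w. w \<in> S \<Longrightarrow> norm (f w) \<le> M" and "ball z (2 * r) \<subseteq> S"
    and xy: "x \<in> ball z r" "y \<in> ball z r"
  shows "norm (f x - f y) \<le> M / r * norm (x - y)"
proof (cases "x = y")
  case False
  have "dist z x < r" using xy by simp
  then have r: "r > 0" using zero_le_dist[of z x] by linarith
  define v where "v = y - x"
  define N where "N = norm v"
  have N: "N > 0" using False by (simp add: N_def v_def)
  define h where "h t = f (x + t *s v)" for t
  define h' where "h' t = (\<Sum>l\<in>UNIV. v $ l * cpd l f (x + t *s v))" for t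
  have seg: "x + t *s v \<in> ball z r" if t: "t \<in> closed_segment 0 1" for t
  proof -
    obtain u where u: "t = complex_of_real u" "0 \<le> u" "u \<le> 1"
      using t by (auto simp: closed_segment_def scaleR_conv_of_real)
    have "x + t *s v = (1 - u) *\<^sub>R x + u *\<^sub>R y"
      by (simp add: u(1) v_def scaleR_cscale vec_eq_iff algebra_simps)
    then show ?thesis using convexD_alt[OF convex_ball xy u(2,3)] by simp
  qed
  have mem: "x + s *s v \<in> S" if t: "t \<in> closed_segment 0 1" and s: "norm (s - t) \<le> r / N" for s t
  proof -
    have "norm (x + s *s v - (x + t *s v)) = norm (s - t) * N"
      by (simp add: N_def norm_cscale flip: vector_sub_rdistrib)
    also have "\<dots> \<le> r" using s N by (simp add: le_divide_eq)
    finally have "dist z (x + s *s v) < 2 * r"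
      using seg[OF t] dist_triangle[of z "x + s *s v" "x + t *s v"] by (simp add: dist_norm norm_minus_commute)
    then show ?thesis using assms(3) by auto
  qed
  have der: "(h has_field_derivative h' t) (at t)" if t: "t \<in> closed_segment 0 1" for t
    unfolding h_def h'_def by (rule cpd_slice_derivative[OF f]) (use mem[OF t, of t] r N in simp)
  have "norm (h 0 - h 1) \<le> M / (r / N) * norm (0 - 1 :: complex)"
  proof (rule field_differentiable_bound[OF convex_closed_segment])
    fix t :: complex assume t: "t \<in> closed_segment 0 1"
    show "(h has_field_derivative h' t) (at t within closed_segment 0 1)"
      using der[OF t] has_field_derivative_at_within by blast
    have hol: "h holomorphic_on cball t (r / N)"
      unfolding h_def by (rule hol_fun_slice[OF f]) (use mem[OF t] in \<open>auto simp: dist_norm norm_minus_commute\<close>)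
    have "norm ((deriv ^^ 1) h t) \<le> fact 1 * M / (r / N) ^ 1"
    proof (rule Cauchy_inequality)
      show "h holomorphic_on ball t (r / N)" using hol holomorphic_on_subset ball_subset_cball by blast
      show "continuous_on (cball t (r / N)) h" by (rule holomorphic_on_imp_continuous_on[OF hol])
      show "norm (h s) \<le> M" if "norm (t - s) = r / N" for s
        unfolding h_def by (intro M mem[OF t]) (use that in \<open>simp add: norm_minus_commute\<close>)
    qed (use r N in simp)
    then show "norm (h' t) \<le> M / (r / N)" using DERIV_imp_deriv[OF der[OF t]] by simp
  qed auto
  moreover have "h 0 = f x" "h 1 = f y" by (simp_all add: h_def v_def)
  ultimately show ?thesis using norm_minus_commute[of x y] by (simp add: N_def v_def)
qed simp

lemma cpd_bound:
  fixes f :: "complex ^ 'n \<Rightarrow> complex"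
  assumes f: "hol_fun f S" and M: "\<And>w. w \<in> S \<Longrightarrow> norm (f w) \<le> M" and r: "r > 0" and S: "cball z r \<subseteq> S"
  shows "norm (cpd l f z) \<le> M / r"
proof -
  have mem: "z + t *s axis l 1 \<in> S" if "norm t \<le> r" for t
    using that S by (auto simp: subset_iff dist_norm norm_cscale)
  let ?h = "\<lambda>t. f (z + t *s axis l 1)"
  have hol: "?h holomorphic_on cball 0 r"
    by (rule hol_fun_slice[OF f]) (use mem in auto)
  have "norm ((deriv ^^ 1) ?h 0) \<le> fact 1 * M / r ^ 1"
  proof (rule Cauchy_inequality)
    show "?h holomorphic_on ball 0 r" using hol holomorphic_on_subset ball_subset_cball by blast
    show "continuous_on (cball 0 r) ?h" by (rule holomorphic_on_imp_continuous_on[OF hol])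
    show "norm (?h s) \<le> M" if "norm (0 - s) = r" for s by (intro M mem) (use that in simp)
  qed (rule r)
  then show ?thesis by (simp add: cpd_def)
qed

text \<open>The pointwise limit inherits the modulus of continuity, since \<open>eq\<close> is
  stated with a non-strict inequality; a finite net then makes the convergence uniform.\<close>

lemma equicontinuous_imp_uniform_limit:
  fixes f :: "nat \<Rightarrow> 'a::metric_space \<Rightarrow> 'b::metric_space"
  assumes "compact K"
    and eq: "\<And>x e. x \<in> K \<Longrightarrow> e > 0 \<Longrightarrow> \<exists>d>0. \<forall>n. \<forall>y\<in>K. dist y x < d \<longrightarrow> dist (f n y) (f n x) \<le> e"
    and lim: "\<And>x. x \<in> K \<Longrightarrow> (\<lambda>n. f n x) \<longlonglongrightarrow> g x"
  shows "uniform_limit K f g sequentially"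
proof (rule uniform_limitI)
  fix e :: real assume "e > 0"
  have "\<exists>d>0. \<forall>n. \<forall>y\<in>K. dist y x < d \<longrightarrow> dist (f n y) (f n x) \<le> e / 4" if "x \<in> K" for x
    using eq[OF that, of "e / 4"] \<open>e > 0\<close> by simp
  then obtain d where d: "\<And>x. x \<in> K \<Longrightarrow> d x > 0"
    "\<And>x n y. x \<in> K \<Longrightarrow> y \<in> K \<Longrightarrow> dist y x < d x \<Longrightarrow> dist (f n y) (f n x) \<le> e / 4" by metis
  have "K \<subseteq> (\<Union>x\<in>K. ball x (d x))" using d(1) by fastforce
  then obtain X where X: "X \<subseteq> K" "finite X" "K \<subseteq> (\<Union>x\<in>X. ball x (d x))"
    using compactE_image[OF \<open>compact K\<close>, of K "\<lambda>x. ball x (d x)"] by auto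
  have "\<forall>\<^sub>F n in sequentially. \<forall>x\<in>X. dist (f n x) (g x) < e / 4"
    unfolding eventually_ball_finite_distrib[OF X(2)]
  proof (intro ballI tendstoD)
    show "(\<lambda>n. f n x) \<longlonglongrightarrow> g x" if "x \<in> X" for x using lim X(1) that by blast
  qed (use \<open>e > 0\<close> in simp)
  then show "\<forall>\<^sub>F n in sequentially. \<forall>y\<in>K. dist (f n y) (g y) < e"
  proof (rule eventually_mono, intro ballI)
    fix n y assume n: "\<forall>x\<in>X. dist (f n x) (g x) < e / 4" and y: "y \<in> K"
    obtain x where x: "x \<in> X" "y \<in> ball x (d x)" using X(3) y by blast
    then have xK: "x \<in> K" using X(1) by blast
    have le: "dist (f m y) (f m x) \<le> e / 4" for m
      using d(2)[OF xK y] x(2) by (simp add: dist_commute)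
    have "dist (g y) (g x) \<le> e / 4"
      by (rule Lim_bounded[OF tendsto_dist[OF lim[OF y] lim[OF xK]]]) (use le in auto)
    moreover have "dist (f n y) (g y) \<le> dist (f n y) (f n x) + dist (f n x) (g x) + dist (g x) (g y)"
      using dist_triangle[of "f n y" "g y" "f n x"] dist_triangle[of "f n x" "g y" "g x"] by linarith
    ultimately show "dist (f n y) (g y) < e" using le[of n] n x(1) \<open>e > 0\<close> by (auto simp: dist_commute)
  qed
qed

lemma bounded_hol_fun_equicontinuous:
  fixes f :: "nat \<Rightarrow> complex ^ 'n \<Rightarrow> complex"
  assumes "open S" and f: "\<And>n. hol_fun (f n) S" and M: "\<And>n z. z \<in> S \<Longrightarrow> norm (f n z) \<le> M"
    and x: "x \<in> S" and "e > 0"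
  shows "\<exists>d>0. \<forall>n. \<forall>y\<in>S. dist y x < d \<longrightarrow> dist (f n y) (f n x) \<le> e"
proof -
  obtain s where s: "s > 0" "ball x s \<subseteq> S" by (rule openE[OF \<open>open S\<close> x])
  define r where "r = s / 2"
  have r: "r > 0" "ball x (2 * r) \<subseteq> S" using s by (auto simp: r_def)
  have M0: "M \<ge> 0" using M[OF x, of 0] norm_ge_zero order_trans by blast
  \<comment> \<open>\<open>M + 1\<close> instead of \<open>M\<close> also covers the bound
    0.\<close>
  define d where "d = min r (e * r / (M + 1))"
  have d: "d > 0" using r \<open>e > 0\<close> M0 by (simp add: d_def)
  have "dist (f n y) (f n x) \<le> e" if y: "dist y x < d" for n y
  proof -
    have "norm (f n y - f n x) \<le> M / r * norm (y - x)"
      by (rule hol_fun_lipschitz[OF f M r(2)]) (use y r in \<open>auto simp: d_def dist_commute\<close>)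
    also have "\<dots> \<le> M / r * (e * r / (M + 1))"
      using y M0 r by (intro mult_left_mono) (auto simp: d_def dist_norm)
    also have "\<dots> = e * (M / (M + 1))" using r by simp
    also have "\<dots> \<le> e * 1" using M0 \<open>e > 0\<close> by (intro mult_left_mono) auto
    finally show ?thesis by (simp add: dist_norm)
  qed
  with d show ?thesis by blast
qed

lemma hol_fun_uniform_limit:
  fixes f :: "nat \<Rightarrow> complex ^ 'n \<Rightarrow> complex"
  assumes "open S" and f: "\<And>n. hol_fun (f n) S" and M: "\<And>n z. z \<in> S \<Longrightarrow> norm (f n z) \<le> M"
    and lim: "\<And>z. z \<in> S \<Longrightarrow> (\<lambda>n. f n z) \<longlonglongrightarrow> g z"
    and K: "compact K" "K \<subseteq> S"
  shows "uniform_limit K f g sequentially"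
proof (rule equicontinuous_imp_uniform_limit[OF K(1)])
  fix x e assume "x \<in> K" "(e::real) > 0"
  with K have "x \<in> S" by blast
  then have "\<exists>d>0. \<forall>n. \<forall>y\<in>S. dist y x < d \<longrightarrow> dist (f n y) (f n x) \<le> e"
    by (intro bounded_hol_fun_equicontinuous[of S f M] assms \<open>e > 0\<close>)
  with K(2) show "\<exists>d>0. \<forall>n. \<forall>y\<in>K. dist y x < d \<longrightarrow> dist (f n y) (f n x) \<le> e" by blast
qed (use lim K in blast)

text \<open>Equicontinuity upgrades pointwise to locally uniform convergence, after which
  Weierstrass's theorem applies on a slice.\<close>

lemma cpd_tendsto:
  fixes f :: "nat \<Rightarrow> complex ^ 'n \<Rightarrow> complex"
  assumes "open S" and f: "\<And>n. hol_fun (f n) S" and M: "\<And>n z. z \<in> S \<Longrightarrow> norm (f n z) \<le> M"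
    and lim: "\<And>z. z \<in> S \<Longrightarrow> (\<lambda>n. f n z) \<longlonglongrightarrow> g z" and "z \<in> S"
  shows "(\<lambda>n. cpd l (f n) z) \<longlonglongrightarrow> cpd l g z"
proof -
  obtain r where r: "r > 0" "cball z r \<subseteq> S" using \<open>open S\<close> \<open>z \<in> S\<close> open_contains_cball by blast
  have ul: "uniform_limit (cball z r) f g sequentially"
    by (intro hol_fun_uniform_limit[of S f M g] assms compact_cball r(2))
  have mem: "z + t *s axis l 1 \<in> cball z r" if "t \<in> ball 0 r" for t
    using that by (simp add: dist_norm norm_cscale)
  have "(\<lambda>n. (deriv ^^ 1) (\<lambda>t. f n (z + t *s axis l 1)) 0) \<longlonglongrightarrow> (deriv ^^ 1) (\<lambda>t. g (z + t *s axis l 1)) 0"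
  proof (rule higher_deriv_complex_uniform_limit)
    show "uniform_limit (ball 0 r) (\<lambda>n t. f n (z + t *s axis l 1)) (\<lambda>t. g (z + t *s axis l 1)) sequentially"
    proof (rule uniform_limitI)
      fix e :: real assume "e > 0"
      from uniform_limitD[OF ul this]
      show "\<forall>\<^sub>F n in sequentially. \<forall>t\<in>ball 0 r. dist (f n (z + t *s axis l 1)) (g (z + t *s axis l 1)) < e"
        proof (rule eventually_mono, intro ballI)
        fix n t assume n: "\<forall>x\<in>cball z r. dist (f n x) (g x) < e" and t: "t \<in> ball (0::complex) r"
        show "dist (f n (z + t *s axis l 1)) (g (z + t *s axis l 1)) < e" by (rule bspec[OF n mem[OF t]])
      qed
    qed
    show "\<forall>\<^sub>F n in sequentially. (\<lambda>t. f n (z + t *s axis l 1)) holomorphic_on ball 0 r"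
      by (intro always_eventually allI hol_fun_slice[OF f]) (use mem r in blast)
  qed (use r in auto)
  then show ?thesis by (simp add: cpd_def)
qed

text \<open>By Cauchy's estimate the partial derivatives are themselves a bounded holomorphic family
  on small balls, hence equicontinuous.\<close>

lemma cpd_uniform_limit:
  fixes f :: "nat \<Rightarrow> complex ^ 'n \<Rightarrow> complex"
  assumes "open S" and f: "\<And>n. hol_fun (f n) S" and M: "\<And>n z. z \<in> S \<Longrightarrow> norm (f n z) \<le> M"
    and lim: "\<And>z. z \<in> S \<Longrightarrow> (\<lambda>n. f n z) \<longlonglongrightarrow> g z" and K: "compact K" "K \<subseteq> S"
  shows "uniform_limit K (\<lambda>n. cpd l (f n)) (cpd l g) sequentially"
proof (rule equicontinuous_imp_uniform_limit[OF K(1)])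
  fix x and e :: real assume "x \<in> K" "e > 0"
  then obtain s where s: "s > 0" "ball x s \<subseteq> S" using openE[OF \<open>open S\<close>] K(2) by blast
  define r where "r = s / 3"
  have r: "r > 0" using s by (simp add: r_def)
  have sub: "ball x r \<subseteq> S" "x \<in> ball x r" using s by (auto simp: r_def)
  have hol: "hol_fun (cpd l (f n)) (ball x r)" for n
    using hol_fun_subset[OF hol_fun_cpd[OF f \<open>open S\<close>] sub(1)] .
  have bd: "norm (cpd l (f n) w) \<le> M / r" if w: "w \<in> ball x r" for n w
  proof (rule cpd_bound[OF f M r])
    show "cball w r \<subseteq> S"
    proof
      fix v assume "v \<in> cball w r"
      then have "dist x v < s" using w s(1) dist_triangle[of x v w] by (simp add: r_def)
      then show "v \<in> S" using s(2) by auto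
    qed
  qed
  have "\<exists>d>0. \<forall>n. \<forall>y\<in>ball x r. dist y x < d \<longrightarrow> dist (cpd l (f n) y) (cpd l (f n) x) \<le> e"
    by (intro bounded_hol_fun_equicontinuous[of "ball x r" "\<lambda>n. cpd l (f n)" "M / r"] open_ball hol bd sub(2) \<open>e > 0\<close>)
  then obtain d where d: "d > 0" "\<forall>n. \<forall>y\<in>ball x r. dist y x < d \<longrightarrow> dist (cpd l (f n) y) (cpd l (f n) x) \<le> e" by blast
  show "\<exists>d>0. \<forall>n. \<forall>y\<in>K. dist y x < d \<longrightarrow> dist (cpd l (f n) y) (cpd l (f n) x) \<le> e"
    using d r by (intro exI[of _ "min d r"]) (auto simp: dist_commute)
qed (use cpd_tendsto[OF assms(1-4)] K in blast)

text \<open>Uniform convergence of the derivatives makes the limit differentiable. The candidate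
  derivative can be written down beforehand, as \<open>cpd l g\<close> exists as a term and is
  already known to be the limit of the partial derivatives.\<close>

lemma hol_fun_limit:
  fixes f :: "nat \<Rightarrow> complex ^ 'n \<Rightarrow> complex"
  assumes "open S" and f: "\<And>n. hol_fun (f n) S" and M: "\<And>n z. z \<in> S \<Longrightarrow> norm (f n z) \<le> M"
    and lim: "\<And>z. z \<in> S \<Longrightarrow> (\<lambda>n. f n z) \<longlonglongrightarrow> g z"
  shows "hol_fun g S"
  unfolding hol_fun_def
proof
  fix z assume "z \<in> S"
  then obtain r where r: "r > 0" "cball z r \<subseteq> S" using \<open>open S\<close> open_contains_cball by blast
  have sub: "ball z r \<subseteq> S" "z \<in> ball z r" using r by auto
  define L where "L x h = (\<Sum>l\<in>UNIV. h $ l * cpd l g x)" for x :: "complex ^ 'n" and h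
  have "\<exists>G. \<forall>x\<in>ball z r. (\<lambda>n. f n x) \<longlonglongrightarrow> G x \<and> (G has_derivative L x) (at x within ball z r)"
  proof (rule has_derivative_sequence[OF convex_ball _ _ sub(2)])
    show "(f n has_derivative (\<lambda>h. \<Sum>l\<in>UNIV. h $ l * cpd l (f n) x)) (at x within ball z r)" if "x \<in> ball z r" for n x
      using hol_fun_has_derivative[OF f] that sub(1) has_derivative_at_withinI by blast
    show "(\<lambda>n. f n z) \<longlonglongrightarrow> g z" by (rule lim[OF \<open>z \<in> S\<close>])
    fix e :: real assume "e > 0"
    define e' where "e' = e / CARD('n)"
    have e': "e' > 0" using \<open>e > 0\<close> by (simp add: e'_def)
    have "\<forall>\<^sub>F n in sequentially. \<forall>l\<in>UNIV. \<forall>x\<in>cball z r. dist (cpd l (f n) x) (cpd l g x) < e'"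
      unfolding eventually_ball_finite_distrib[OF finite_class.finite_UNIV]
      using uniform_limitD[OF cpd_uniform_limit[OF assms compact_cball r(2)] e'] by blast
    then show "\<forall>\<^sub>F n in sequentially. \<forall>x\<in>ball z r. \<forall>h.
        norm ((\<Sum>l\<in>UNIV. h $ l * cpd l (f n) x) - L x h) \<le> e * norm h"
    proof (rule eventually_mono, intro ballI allI)
      fix n x h assume n: "\<forall>l\<in>UNIV. \<forall>x\<in>cball z r. dist (cpd l (f n) x) (cpd l g x) < e'" and x: "x \<in> ball z r"
      have "norm ((\<Sum>l\<in>UNIV. h $ l * cpd l (f n) x) - L x h) =
          norm (\<Sum>l\<in>UNIV. h $ l * (cpd l (f n) x - cpd l g x))"
        by (simp add: L_def sum_subtractf right_diff_distrib)
      also have "\<dots> \<le> (\<Sum>l\<in>(UNIV::'n set). norm h * e')"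
      proof (rule sum_norm_le)
        fix l
        have "norm (cpd l (f n) x - cpd l g x) \<le> e'" using n x by (simp add: dist_norm less_imp_le)
        then show "norm (h $ l * (cpd l (f n) x - cpd l g x)) \<le> norm h * e'"
          unfolding norm_mult by (intro mult_mono) (auto simp: Finite_Cartesian_Product.norm_nth_le)
      qed
      also have "\<dots> = e * norm h" by (simp add: e'_def)
      finally show "norm ((\<Sum>l\<in>UNIV. h $ l * cpd l (f n) x) - L x h) \<le> e * norm h" .
    qed
  qed
  then obtain G where G: "\<And>x. x \<in> ball z r \<Longrightarrow> (\<lambda>n. f n x) \<longlonglongrightarrow> G x"
    "(G has_derivative L z) (at z within ball z r)" using sub(2) by blast
  have "G x = g x" if "x \<in> ball z r" for x
    using LIMSEQ_unique[OF G(1)[OF that] lim] that sub(1) by blast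
  then have "(g has_derivative L z) (at z within ball z r)"
    using has_derivative_transform[OF sub(2) _ G(2)] by metis
  moreover have "at z within ball z r = at z" by (rule at_within_open) (use sub in simp_all)
  ultimately show "\<exists>L. (g has_derivative L) (at z) \<and> (\<forall>c x. L (c *s x) = c * L x)"
    by (intro exI[of _ "L z"]) (simp add: L_def sum_distrib_left algebra_simps)
qed

text \<open>A diagonal subsequence converges on a countable dense set, and equicontinuity carries
  the Cauchy property to every point.\<close>

lemma montel_holomorphic_on_cn:
  fixes f :: "nat \<Rightarrow> complex ^ 'n \<Rightarrow> complex ^ 'm"
  assumes "open S" and f: "\<And>n. holomorphic_on_cn (f n) S" and M: "\<And>n z. z \<in> S \<Longrightarrow> norm (f n z) \<le> M"
  obtains k g where "strict_mono (k :: nat \<Rightarrow> nat)" "\<And>z. z \<in> S \<Longrightarrow> (\<lambda>n. f (k n) z) \<longlonglongrightarrow> g z"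
proof -
  obtain T where T: "countable T" "T \<subseteq> S" "S \<subseteq> closure T" using separable by blast
  obtain k where k: "strict_mono k" "\<And>x. x \<in> T \<Longrightarrow> \<exists>l. (\<lambda>n. f (k n) x) \<longlonglongrightarrow> l"
    using function_convergent_subsequence[of T f M] T M by blast
  have fi: "hol_fun (\<lambda>z. f n z $ i) S" for n i using f unfolding holomorphic_on_cn_iff by blast
  have Mi: "norm (f n z $ i) \<le> M" if "z \<in> S" for n z i
    using M[OF that] Finite_Cartesian_Product.norm_nth_le order_trans by blast
  have conv: "convergent (\<lambda>n. f (k n) z $ i)" if z: "z \<in> S" for z i
  proof (rule Cauchy_convergent, rule metric_CauchyI)
    fix e :: real assume "e > 0"
    then have "e / 3 > 0" by simp
    then have "\<exists>d>0. \<forall>n. \<forall>y\<in>S. dist y z < d \<longrightarrow> dist (f n y $ i) (f n z $ i) \<le> e / 3"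
      by (intro bounded_hol_fun_equicontinuous[of S "\<lambda>n z. f n z $ i" M] \<open>open S\<close> fi Mi z)
    then obtain d where d: "d > 0" "\<And>n y. y \<in> S \<Longrightarrow> dist y z < d \<Longrightarrow> dist (f n y $ i) (f n z $ i) \<le> e / 3" by blast
    obtain y where y: "y \<in> T" "dist y z < d" using T(3) z d(1) closure_approachable by blast
    then have yS: "y \<in> S" using T(2) by blast
    obtain l where "(\<lambda>n. f (k n) y) \<longlonglongrightarrow> l" using k(2)[OF y(1)] by blast
    then have "(\<lambda>n. f (k n) y $ i) \<longlonglongrightarrow> l $ i" by (rule tendsto_vec_nth)
    then have "Cauchy (\<lambda>n. f (k n) y $ i)" by (rule LIMSEQ_imp_Cauchy)
    then obtain N where N: "\<And>m n. m \<ge> N \<Longrightarrow> n \<ge> N \<Longrightarrow> dist (f (k m) y $ i) (f (k n) y $ i) < e / 3"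
      using metric_CauchyD[OF _ \<open>e / 3 > 0\<close>] by blast
    show "\<exists>N. \<forall>m\<ge>N. \<forall>n\<ge>N. dist (f (k m) z $ i) (f (k n) z $ i) < e"
    proof (intro exI allI impI)
      fix m n assume "N \<le> m" "N \<le> n"
      note N[OF this] d(2)[OF yS y(2), of "k m"] d(2)[OF yS y(2), of "k n"]
      moreover have "dist (f (k m) z $ i) (f (k n) z $ i) \<le> dist (f (k m) z $ i) (f (k m) y $ i)
          + dist (f (k m) y $ i) (f (k n) y $ i) + dist (f (k n) y $ i) (f (k n) z $ i)"
        by (meson dist_triangle add_right_mono order_trans)
      ultimately show "dist (f (k m) z $ i) (f (k n) z $ i) < e" by (simp add: dist_commute)
    qed
  qed
  define g where "g z = (\<chi> i. lim (\<lambda>n. f (k n) z $ i))" for z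
  have "(\<lambda>n. f (k n) z) \<longlonglongrightarrow> g z" if "z \<in> S" for z
  proof (rule vec_tendstoI)
    show "(\<lambda>n. f (k n) z $ i) \<longlonglongrightarrow> g z $ i" for i
      using conv[OF that, of i] by (simp add: g_def convergent_LIMSEQ_iff)
  qed
  with k(1) show ?thesis by (rule that)
qed

section \<open>Squeezing and the limit map\<close>

lemma squeezing_witness:
  fixes \<Omega> :: "(complex ^ 'n) set"
  assumes "open \<Omega>" "bounded \<Omega>" "z \<in> \<Omega>" "t < squeezing \<Omega> z"
  obtains f :: "complex ^ 'n \<Rightarrow> complex ^ 'n" and r where "t < r" "holomorphic_on_cn f \<Omega>" "inj_on f \<Omega>" "f ` \<Omega> \<subseteq> ball 0 1" "f z = 0" "ball 0 r \<subseteq> f ` \<Omega>"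
proof -
  let ?P = "\<lambda>r. r > 0 \<and> (\<exists>f :: complex ^ 'n \<Rightarrow> complex ^ 'n. holomorphic_on_cn f \<Omega> \<and> inj_on f \<Omega> \<and>
      f ` \<Omega> \<subseteq> ball 0 1 \<and> f z = 0 \<and> ball 0 r \<subseteq> f ` \<Omega>)"
  obtain B where B: "B > 0" "\<Omega> \<subseteq> ball z B" using bounded_subset_ballD[OF \<open>bounded \<Omega>\<close>] by blast
  obtain e where e: "e > 0" "ball z e \<subseteq> \<Omega>" by (rule openE[OF \<open>open \<Omega>\<close> \<open>z \<in> \<Omega>\<close>])
  \<comment> \<open>Translation and scaling embed the bounded domain into the unit ball, which
    provides one admissible radius.\<close>
  define f where "f w = complex_of_real (1 / B) *s (w - z)" for w
  have hol: "holomorphic_on_cn f \<Omega>"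
    unfolding holomorphic_on_cn_iff f_def vector_smult_component vector_minus_component
    by (intro allI hol_fun_mult hol_fun_const hol_fun_diff hol_fun_component)
  have B0: "complex_of_real (1 / B) \<noteq> 0" using B(1) by simp
  have inj: "inj_on f \<Omega>"
    using B0 by (auto simp: inj_on_def f_def vec_eq_iff)
  have n: "norm (f w) = dist z w / B" for w
    unfolding f_def norm_cscale using B(1) by (simp add: norm_divide dist_norm norm_minus_commute)
  have im: "f ` \<Omega> \<subseteq> ball 0 1" using B n by (auto simp: subset_iff divide_less_eq)
  have sub: "ball 0 (e / B) \<subseteq> f ` \<Omega>"
  proof
    fix y :: "complex ^ 'n" assume y: "y \<in> ball 0 (e / B)"
    define w where "w = z + complex_of_real B *s y"
    have "f w = y" using B(1) by (simp add: f_def w_def vec_eq_iff)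
    moreover have "dist z w < e"
      using y B(1) by (simp add: w_def dist_norm norm_cscale less_divide_eq mult.commute)
    ultimately show "y \<in> f ` \<Omega>" using e(2) by auto
  qed
  have "f z = 0" by (simp add: f_def)
  then have "?P (e / B)" using hol inj im sub e(1) B(1) by (intro conjI exI[of _ f]) auto
  \<comment> \<open>Without this, \<open>squeezing \<Omega> z\<close> would be the unspecified value \<open>Sup {}\<close>.\<close>
  then have "{r. ?P r} \<noteq> {}" by blast
  from less_cSupD[OF this] \<open>t < squeezing \<Omega> z\<close>[unfolded squeezing_def]
  obtain r where r: "?P r" "t < r" by blast
  then obtain f :: "complex ^ 'n \<Rightarrow> complex ^ 'n" where "holomorphic_on_cn f \<Omega> \<and> inj_on f \<Omega> \<and>
      f ` \<Omega> \<subseteq> ball 0 1 \<and> f z = 0 \<and> ball 0 r \<subseteq> f ` \<Omega>" by blast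
  then show ?thesis by (intro that[OF r(2), of f]) simp_all
qed

text \<open>\<open>sgn a\<close> is the unit vector along \<open>a\<close>, and 0 for
  \<open>a = 0\<close>, so the test function needs no case distinction.\<close>

lemma cdot_sgn: "cdot a (sgn a) = complex_of_real (norm a)"
proof (cases "a = 0")
  case False
  have "sgn a = complex_of_real (1 / norm a) *s a"
    by (simp add: sgn_div_norm scaleR_cscale divide_inverse)
  then have "cdot a (sgn a) = complex_of_real (1 / norm a * (norm a)\<^sup>2)"
    by (simp only: cdot_cscale_right cdot_self complex_cnj_complex_of_real of_real_mult)
  then show ?thesis using False by (simp add: power2_eq_square)
qed (simp add: cdot_def)

lemma Re_cdot_sgn_le: "Re (cdot x (sgn a)) \<le> norm x"
proof -
  have "norm (cdot x (sgn a)) \<le> norm x * norm (sgn a)" by (rule norm_cdot_le)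
  also have "\<dots> \<le> norm x * 1" by (intro mult_left_mono) (simp_all add: norm_sgn)
  finally show ?thesis using complex_Re_le_cmod[of "cdot x (sgn a)"] by simp
qed

lemma almost_onto_ball:
  fixes \<Omega> :: "(complex ^ 'n) set"
  assumes "open \<Omega>" "connected \<Omega>" "bounded \<Omega>" "C2_boundary \<Omega>" "p \<in> \<Omega>"
    and nb: "\<not> (\<exists>c>0. \<forall>z\<in>\<Omega>. squeezing \<Omega> z \<le> 1 - c * infdist z (frontier \<Omega>))"
    and \<epsilon>: "0 < \<epsilon>" "\<epsilon> < 1"
  obtains f :: "complex ^ 'n \<Rightarrow> complex ^ 'n" where "holomorphic_on_cn f \<Omega>" "inj_on f \<Omega>" "f ` \<Omega> \<subseteq> ball 0 1" "f p = 0" "ball 0 (1 - \<epsilon>) \<subseteq> f ` \<Omega>"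
proof -
  obtain c where c: "c > 0" "\<And>z. z \<in> \<Omega> \<Longrightarrow> harnack_bound \<Omega> p c z"
    using harnack_bound_uniform[OF assms(1-5)] by blast
  \<comment> \<open>The 8 anticipates the loss under the ball automorphism, and \<open>c\<close> the
    loss in Harnack's inequality.\<close>
  have "\<epsilon> * c / 8 > 0" using \<epsilon> c by simp
  with nb obtain z where z: "z \<in> \<Omega>" "1 - \<epsilon> * c / 8 * infdist z (frontier \<Omega>) < squeezing \<Omega> z"
    by (meson not_le)
  obtain f :: "complex ^ 'n \<Rightarrow> complex ^ 'n" and r where r: "1 - \<epsilon> * c / 8 * infdist z (frontier \<Omega>) < r" and f: "holomorphic_on_cn f \<Omega>" "inj_on f \<Omega>"
    "f ` \<Omega> \<subseteq> ball 0 1" "f z = 0" "ball 0 r \<subseteq> f ` \<Omega>"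
    by (rule squeezing_witness[OF assms(1,3) z]) (rule that)
  define a where "a = f p"
  have fb: "norm (f w) < 1" if "w \<in> \<Omega>" for w using f(3) that by auto
  have a: "norm a < 1" unfolding a_def by (rule fb[OF \<open>p \<in> \<Omega>\<close>])
  define F where "F w = 1 - cdot (f w) (sgn a)" for w
  have "hol_fun F \<Omega>" unfolding F_def by (intro hol_fun_diff hol_fun_const hol_fun_cdot f)
  moreover have "Re (F w) > 0" if "w \<in> \<Omega>" for w
  using Re_cdot_sgn_le[of "f w" a] fb[OF that] by (simp add: F_def)
  ultimately have "c * infdist z (frontier \<Omega>) * Re (F z) \<le> Re (F p)"
    using c(2)[OF z(1)] unfolding harnack_bound_def by blast
  moreover have "Re (F z) = 1" by (simp add: F_def f(4) cdot_def)
  moreover have "Re (F p) = 1 - norm a"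
    by (simp add: F_def cdot_sgn flip: a_def)
  ultimately have "\<epsilon> * (c * infdist z (frontier \<Omega>)) \<le> \<epsilon> * (1 - norm a)" using \<epsilon> by simp
  then have le: "8 * (1 - r) \<le> \<epsilon> * (1 - norm a)" using r by (simp add: algebra_simps)
  let ?h = "\<lambda>w. ball_aut a (f w)"
  show ?thesis
  proof (rule that[of ?h])
    show "holomorphic_on_cn ?h \<Omega>" by (rule holomorphic_on_cn_compose[OF ball_aut_holomorphic[OF a] f(1,3)])
    show "inj_on ?h \<Omega>"
      using f(2) ball_aut_involution[OF a fb] by (intro inj_onI) (metis inj_onD)
    show "?h ` \<Omega> \<subseteq> ball 0 1" using ball_aut_in_ball[OF a fb] by auto
    show "?h p = 0" using ball_aut_center[OF a] by (simp add: a_def)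
    have "ball 0 (1 - \<epsilon>) \<subseteq> ball_aut a ` ball 0 r" by (rule ball_aut_ball_subset[OF a \<epsilon> le])
    also have "\<dots> \<subseteq> ?h ` \<Omega>" using f(5) by auto
    finally show "ball 0 (1 - \<epsilon>) \<subseteq> ?h ` \<Omega>" .
  qed
qed

text \<open>Moving from a boundary point along the gradient makes \<open>\<rho>\<close> positive,
  hence leads outside the closure at arbitrarily small distance.\<close>

lemma C2_boundary_interior_closure:
  fixes \<Omega> :: "(complex ^ 'n) set"
  assumes "open \<Omega>" "C2_boundary \<Omega>"
  shows "interior (closure \<Omega>) \<subseteq> \<Omega>"
proof (rule subsetI, rule ccontr)
  fix p0 assume p0: "p0 \<in> interior (closure \<Omega>)" "p0 \<notin> \<Omega>"
  then have fr: "p0 \<in> frontier \<Omega>"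
    using interior_subset \<open>open \<Omega>\<close> by (auto simp: frontier_def interior_open)
  from assms(2)[unfolded C2_boundary_def, rule_format, OF fr]
  obtain U and \<rho> :: "complex ^ 'n \<Rightarrow> real" and D :: "complex ^ 'n \<Rightarrow> (complex ^ 'n) \<Rightarrow>\<^sub>L real"
    and D2 :: "complex ^ 'n \<Rightarrow> (complex ^ 'n) \<Rightarrow>\<^sub>L ((complex ^ 'n) \<Rightarrow>\<^sub>L real)"
    where U: "open U \<and> p0 \<in> U \<and>
        (\<forall>x\<in>U. (\<rho> has_derivative blinfun_apply (D x)) (at x)) \<and>
        (\<forall>x\<in>U. (D has_derivative blinfun_apply (D2 x)) (at x)) \<and>
        continuous_on U D2 \<and> (\<forall>z\<in>U. z \<in> \<Omega> \<longleftrightarrow> \<rho> z < 0) \<and> (\<forall>z\<in>U \<inter> frontier \<Omega>. D z \<noteq> 0)"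
    by (elim exE) (rule that)
  have "open U" "p0 \<in> U" using U by blast+
  have D: "(\<rho> has_derivative blinfun_apply (D x)) (at x)" if "x \<in> U" for x using U that by blast
  have \<rho>: "z \<in> \<Omega> \<longleftrightarrow> \<rho> z < 0" if "z \<in> U" for z using U that by blast
  have "D p0 \<noteq> 0" using U fr by blast
  define v where "v = gradient (D p0)"
  have "v \<noteq> 0" using norm_le_norm_gradient[of "D p0"] \<open>D p0 \<noteq> 0\<close> by (auto simp: v_def)
  have Dv: "blinfun_apply (D p0) v > 0" using \<open>v \<noteq> 0\<close> unfolding v_def gradient_inner[symmetric] by simp
  have "((\<lambda>t. p0 + t *\<^sub>R v) has_derivative (\<lambda>t. t *\<^sub>R v)) (at 0)"
    by (auto intro!: derivative_eq_intros)
  from has_derivative_compose[OF this, of \<rho> "blinfun_apply (D p0)"] D[OF \<open>p0 \<in> U\<close>]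
  have "((\<lambda>t. \<rho> (p0 + t *\<^sub>R v)) has_derivative (\<lambda>t. blinfun_apply (D p0) (t *\<^sub>R v))) (at 0)" by simp
  then have "((\<lambda>t. \<rho> (p0 + t *\<^sub>R v)) has_real_derivative blinfun_apply (D p0) v) (at 0)"
    by (simp add: has_field_derivative_def blinfun.scaleR_right mult_commute_abs)
  from DERIV_pos_inc_right[OF this Dv]
  obtain d where d: "d > 0" "\<And>h. 0 < h \<Longrightarrow> h < d \<Longrightarrow> \<rho> p0 < \<rho> (p0 + h *\<^sub>R v)" by auto
  obtain e where e: "e > 0" "ball p0 e \<subseteq> U \<inter> interior (closure \<Omega>)"
    using openE[of "U \<inter> interior (closure \<Omega>)" p0] \<open>open U\<close> \<open>p0 \<in> U\<close> p0(1) by blast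
  \<comment> \<open>The step is short enough both for the increase of \<open>\<rho>\<close> and for
    staying inside the interior of the closure.\<close>
  define h where "h = min (d / 2) (e / (2 * norm v))"
  have h: "0 < h" "h < d" using d(1) e(1) \<open>v \<noteq> 0\<close> by (auto simp: h_def)
  define y where "y = p0 + h *\<^sub>R v"
  have "h * norm v \<le> e / (2 * norm v) * norm v" by (intro mult_right_mono) (auto simp: h_def)
  also have "\<dots> < e" using \<open>v \<noteq> 0\<close> e(1) by simp
  finally have "y \<in> ball p0 e" using h(1) by (simp add: y_def dist_norm)
  then have y: "y \<in> U" "y \<in> closure \<Omega>" using e(2) interior_subset by blast+
  have "\<rho> y > 0" using d(2)[OF h] \<rho>[OF \<open>p0 \<in> U\<close>] p0(2) by (simp add: y_def)
  have "continuous_on U \<rho>"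
    using D by (meson continuous_at_imp_continuous_on has_derivative_continuous)
  then have "open (U \<inter> \<rho> -` {0<..})" by (rule continuous_open_preimage[OF _ \<open>open U\<close> open_greaterThan])
  moreover have "y \<in> U \<inter> \<rho> -` {0<..}" using y \<open>\<rho> y > 0\<close> by simp
  moreover have "U \<inter> \<rho> -` {0<..} \<inter> \<Omega> = {}" using \<rho> by force
  ultimately show False using y(2) by (metis IntI closure_iff_nhds_not_empty empty_iff open_Int_closure_eq_empty)
qed

text \<open>A maximum principle for vector-valued maps by Harnack's inequality, used with
  \<open>z\<close> as base point and \<open>{p}\<close> as compact set.\<close>

lemma norm_less_one_on_connected:
  fixes f :: "complex ^ 'n \<Rightarrow> complex ^ 'm"
  assumes "open \<Omega>" "connected \<Omega>" "p \<in> \<Omega>" "z \<in> \<Omega>" and f: "holomorphic_on_cn f \<Omega>"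
    and le: "\<And>w. w \<in> \<Omega> \<Longrightarrow> norm (f w) \<le> 1" and "f p = 0"
  shows "norm (f z) < 1"
proof -
  obtain c where c: "c > 0" "\<And>F. hol_fun F \<Omega> \<Longrightarrow> \<forall>z\<in>\<Omega>. Re (F z) > 0 \<Longrightarrow> c * Re (F p) \<le> Re (F z)"
    using harnack_compact[OF assms(1,2,4), of "{p}"] \<open>p \<in> \<Omega>\<close> by auto
  define a where "a = f z"
  \<comment> \<open>The shift by \<open>\<delta>\<close> makes the real part of \<open>F\<close> positive although \<open>norm (f w) = 1\<close> is not yet excluded.\<close>
  define \<delta> where "\<delta> = c / 2"
  have \<delta>: "\<delta> > 0" using c by (simp add: \<delta>_def)
  define F where "F w = complex_of_real (1 + \<delta>) - cdot (f w) (sgn a)" for w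
  have "hol_fun F \<Omega>" unfolding F_def by (intro hol_fun_diff hol_fun_const hol_fun_cdot f)
  moreover have "Re (F w) > 0" if "w \<in> \<Omega>" for w
  using Re_cdot_sgn_le[of "f w" a] le[OF that] \<delta> by (simp add: F_def)
  ultimately have "c * Re (F p) \<le> Re (F z)" using c(2) by blast
  moreover have "Re (F p) = 1 + \<delta>" by (simp add: F_def \<open>f p = 0\<close> cdot_def)
  moreover have "Re (F z) = 1 + \<delta> - norm a"
    by (simp add: F_def cdot_sgn flip: a_def)
  \<comment> \<open>With \<open>\<delta> = c / 2\<close> the right-hand side is 1 - c/2 -
    c^2/2.\<close>
  ultimately have "norm a \<le> 1 + \<delta> - c * (1 + \<delta>)" by simp
  also have "\<dots> < 1" using c(1) by (simp add: \<delta>_def algebra_simps add_pos_pos)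
  finally show ?thesis by (simp add: a_def)
qed

section \<open>Nondegeneracy of limit maps\<close>

lemma det_jac_right_inverse:
  fixes F G :: "complex ^ 'n \<Rightarrow> complex ^ 'n"
  assumes F: "holomorphic_on_cn F S" and G: "holomorphic_on_cn G T" "G ` T \<subseteq> S" "open T" "w \<in> T"
    and FG: "\<And>w. w \<in> T \<Longrightarrow> F (G w) = w"
  shows "det (jac F (G w)) * det (jac G w) = 1"
proof -
  have "((\<lambda>w. F (G w)) has_derivative (\<lambda>v. jac F (G w) *v (jac G w *v v))) (at w)"
    by (rule has_derivative_compose[OF jac_has_derivative[OF G(1,4)] jac_has_derivative[OF F]]) (use G in auto)
  then have "((\<lambda>w. w) has_derivative (\<lambda>v. jac F (G w) *v (jac G w *v v))) (at w)"
    by (rule has_derivative_transform_within_open[OF _ G(3,4) FG])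
  then have "(\<lambda>v. jac F (G w) *v (jac G w *v v)) = (\<lambda>v. v)"
    using has_derivative_unique has_derivative_ident by blast
  then have "jac F (G w) ** jac G w = mat 1"
    unfolding matrix_eq by (metis matrix_vector_mul_assoc matrix_vector_mul_lid)
  then show ?thesis by (metis det_mul det_I)
qed

lemma norm_det_le:
  fixes A :: "complex ^ 'n ^ 'n" and B :: real
  assumes "\<And>i j. norm (A $ i $ j) \<le> B"
  shows "norm (det A) \<le> card {p. p permutes (UNIV :: 'n set)} * B ^ CARD('n)"
proof -
  have "norm (of_int (sign p) * (\<Prod>i\<in>UNIV. A $ i $ p i)) \<le> B ^ CARD('n)" for p
  proof -
    have "norm (\<Prod>i\<in>UNIV. A $ i $ p i) \<le> (\<Prod>i\<in>(UNIV :: 'n set). B)"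
      unfolding prod_norm[symmetric] by (rule prod_mono) (use assms in auto)
    moreover have "norm (of_int (sign p) :: complex) = 1" by (simp add: sign_def)
    ultimately show ?thesis by (simp add: norm_mult)
  qed
  then have "norm (det A) \<le> (\<Sum>p\<in>{p. p permutes (UNIV :: 'n set)}. B ^ CARD('n))"
    unfolding det_def by (rule sum_norm_le)
  then show ?thesis by simp
qed

lemma tendsto_det:
  fixes A :: "nat \<Rightarrow> complex ^ 'n ^ 'n"
  assumes "\<And>i j. (\<lambda>k. A k $ i $ j) \<longlonglongrightarrow> B $ i $ j"
  shows "(\<lambda>k. det (A k)) \<longlonglongrightarrow> det B"
  unfolding det_def by (intro tendsto_intros assms)

text \<open>Restrict to the complex line through 0 and \<open>w\<close> and use Hurwitz's theorem in
  one variable. A constant slice is settled by its value at 0.\<close>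

lemma hurwitz_hol_fun:
  fixes h :: "nat \<Rightarrow> complex ^ 'n \<Rightarrow> complex"
  assumes h: "\<And>n. hol_fun (h n) (ball 0 s)" and M: "\<And>n z. z \<in> ball 0 s \<Longrightarrow> norm (h n z) \<le> M"
    and lim: "\<And>z. z \<in> ball 0 s \<Longrightarrow> (\<lambda>n. h n z) \<longlonglongrightarrow> g z"
    and nz: "\<And>n z. z \<in> ball 0 s \<Longrightarrow> h n z \<noteq> 0" and g0: "g 0 \<noteq> 0" and w: "w \<in> ball 0 s"
  shows "g w \<noteq> 0"
proof (cases "w = 0")
  case False
  define T where "T = ball (0 :: complex) (s / norm w)"
  have mem: "t *s w \<in> ball 0 s" if "t \<in> T" for t
    using that False by (simp add: T_def norm_cscale less_divide_eq)
  have g: "hol_fun g (ball 0 s)" by (intro hol_fun_limit[of "ball 0 s" h M g] open_ball h M lim)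
  have "s > 0" using w le_less_trans[OF norm_ge_zero[of w], of s] by simp
  have sl: "(\<lambda>t. q (t *s w)) holomorphic_on T" if "hol_fun q (ball 0 s)" for q
    using hol_fun_slice[OF that, of T 0 w] mem by simp
  have "g (1 *s w) \<noteq> 0"
  proof (cases "(\<lambda>t. g (t *s w)) constant_on T")
    case True
    moreover have "1 \<in> T" "0 \<in> T" using False w \<open>s > 0\<close> by (simp_all add: T_def less_divide_eq)
    ultimately have "g (1 *s w) = g (0 *s w)" unfolding constant_on_def by metis
    then show ?thesis using g0 by simp
  next
    case nc: False
    show ?thesis
    proof (rule Hurwitz_no_zeros[of T "\<lambda>n t. h n (t *s w)" "\<lambda>t. g (t *s w)"])
      fix K assume K: "compact K" "K \<subseteq> T"
      let ?K = "(\<lambda>t. t *s w) ` K"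
      have "compact ?K" by (intro compact_continuous_image continuous_intros K)
      then have "uniform_limit ?K h g sequentially"
        by (intro hol_fun_uniform_limit[of "ball 0 s" h M g] open_ball h M lim) (use K mem in blast)+
      then show "uniform_limit K (\<lambda>n t. h n (t *s w)) (\<lambda>t. g (t *s w)) sequentially"
        unfolding uniform_limit_iff by simp
    qed (use sl h g mem nz nc w False in \<open>auto simp: T_def less_divide_eq\<close>)
  qed
  then show ?thesis by simp
qed (use g0 in simp)

text \<open>Boundedness gives equicontinuity, so the argument may move with \<open>n\<close>. This
  carries the inverse relations between the approximating maps over to their limits.\<close>

lemma tendsto_diagonal:
  fixes f :: "nat \<Rightarrow> complex ^ 'n \<Rightarrow> complex ^ 'm"
  assumes "open S" and f: "\<And>n. holomorphic_on_cn (f n) S" and M: "\<And>n z. z \<in> S \<Longrightarrow> norm (f n z) \<le> M"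
    and lim: "(\<lambda>n. f n x) \<longlonglongrightarrow> y" and x: "x \<in> S" "X \<longlonglongrightarrow> x"
  shows "(\<lambda>n. f n (X n)) \<longlonglongrightarrow> y"
proof (rule vec_tendstoI, rule tendstoI)
  fix i and e :: real assume "e > 0"
  then have "e / 2 > 0" by simp
  have fi: "hol_fun (\<lambda>z. f n z $ i) S" for n using f unfolding holomorphic_on_cn_iff by blast
  have Mi: "norm (f n z $ i) \<le> M" if "z \<in> S" for n z
    using M[OF that] Finite_Cartesian_Product.norm_nth_le order_trans by blast
  have "\<exists>d>0. \<forall>n. \<forall>y\<in>S. dist y x < d \<longrightarrow> dist (f n y $ i) (f n x $ i) \<le> e / 2"
    by (intro bounded_hol_fun_equicontinuous[of S "\<lambda>n z. f n z $ i" M] \<open>open S\<close> fi Mi x(1) \<open>e / 2 > 0\<close>)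
  then obtain d where d: "d > 0" "\<And>n y. y \<in> S \<Longrightarrow> dist y x < d \<Longrightarrow> dist (f n y $ i) (f n x $ i) \<le> e / 2" by blast
  have "\<forall>\<^sub>F n in sequentially. X n \<in> S" by (rule topological_tendstoD[OF x(2) \<open>open S\<close> x(1)])
  moreover have "\<forall>\<^sub>F n in sequentially. dist (X n) x < d" by (rule tendstoD[OF x(2) d(1)])
  moreover have "\<forall>\<^sub>F n in sequentially. dist (f n x $ i) (y $ i) < e / 2"
    by (rule tendstoD[OF tendsto_vec_nth[OF lim] \<open>e / 2 > 0\<close>])
  ultimately show "\<forall>\<^sub>F n in sequentially. dist (f n (X n) $ i) (y $ i) < e"
  proof eventually_elim
    case (elim n)
    then show ?case using d(2)[of "X n" n] dist_triangle[of "f n (X n) $ i" "y $ i" "f n x $ i"] by simp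
  qed
qed

lemma holomorphic_on_cn_limit:
  fixes f :: "nat \<Rightarrow> complex ^ 'n \<Rightarrow> complex ^ 'm"
  assumes "open S" and f: "\<And>n. holomorphic_on_cn (f n) S" and M: "\<And>n z. z \<in> S \<Longrightarrow> norm (f n z) \<le> M"
    and lim: "\<And>z. z \<in> S \<Longrightarrow> (\<lambda>n. f n z) \<longlonglongrightarrow> g z"
  shows "holomorphic_on_cn g S"
    and "z \<in> S \<Longrightarrow> (\<lambda>n. jac (f n) z $ i $ l) \<longlonglongrightarrow> jac g z $ i $ l"
proof -
  have fi: "hol_fun (\<lambda>z. f n z $ i) S" for n i using f unfolding holomorphic_on_cn_iff by blast
  have Mi: "norm (f n z $ i) \<le> M" if "z \<in> S" for n z i
    using M[OF that] Finite_Cartesian_Product.norm_nth_le order_trans by blast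
  have li: "(\<lambda>n. f n z $ i) \<longlonglongrightarrow> g z $ i" if "z \<in> S" for z i
    by (rule tendsto_vec_nth[OF lim[OF that]])
  show "holomorphic_on_cn g S"
    unfolding holomorphic_on_cn_iff
  proof
    show "hol_fun (\<lambda>z. g z $ i) S" for i
      by (rule hol_fun_limit[of S "\<lambda>n z. f n z $ i" M]) (fact \<open>open S\<close> fi | erule Mi li)+
  qed
  show "(\<lambda>n. jac (f n) z $ i $ l) \<longlonglongrightarrow> jac g z $ i $ l" if "z \<in> S"
    unfolding jac_nth
    by (intro cpd_tendsto[of S "\<lambda>n z. f n z $ i" M] \<open>open S\<close> fi Mi li that)
qed

text \<open>On a smaller concentric ball containing \<open>w\<close>, Cauchy's estimate bounds the
  Jacobian entries uniformly, so the determinants form a bounded family to which Hurwitz's theorem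
  applies.\<close>

lemma limit_det_jac_nonzero:
  fixes G :: "nat \<Rightarrow> complex ^ 'n \<Rightarrow> complex ^ 'n"
  assumes G: "\<And>n. holomorphic_on_cn (G n) (ball 0 1)" and M: "\<And>n z. z \<in> ball 0 1 \<Longrightarrow> norm (G n z) \<le> M"
    and lim: "\<And>z. z \<in> ball 0 1 \<Longrightarrow> (\<lambda>n. G n z) \<longlonglongrightarrow> g z"
    and nz: "\<And>n z. z \<in> ball 0 1 \<Longrightarrow> det (jac (G n) z) \<noteq> 0" and g0: "det (jac g 0) \<noteq> 0" and w: "w \<in> ball 0 1"
  shows "det (jac g w) \<noteq> 0"
proof -
  define s where "s = (1 + norm w) / 2"
  have s: "norm w < s" "s < 1" using w by (simp_all add: s_def)
  have sub: "z \<in> ball 0 1" if "z \<in> ball 0 s" for z :: "complex ^ 'n" using that s by simp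
  have Gi: "hol_fun (\<lambda>z. G n z $ i) (ball 0 1)" for n i using G unfolding holomorphic_on_cn_iff by blast
  have Mi: "norm (G n z $ i) \<le> M" if "z \<in> ball 0 1" for n z i
    using M[OF that] Finite_Cartesian_Product.norm_nth_le order_trans by blast
  have bd: "norm (jac (G n) z $ i $ j) \<le> M / (1 - s)" if z: "z \<in> ball 0 s" for n z i j
    unfolding jac_nth
  proof (rule cpd_bound[OF Gi Mi])
    show "cball z (1 - s) \<subseteq> ball 0 1"
    proof
      fix y assume "y \<in> cball z (1 - s)"
      then have "dist 0 y < 1" using z dist_triangle[of 0 y z] by simp
      then show "y \<in> ball 0 1" by simp
    qed
  qed (use s in simp_all)
  show ?thesis
  proof (rule hurwitz_hol_fun[of "\<lambda>n z. det (jac (G n) z)" s _ "\<lambda>z. det (jac g z)"])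
    show "hol_fun (\<lambda>z. det (jac (G n) z)) (ball 0 s)" for n
      by (rule hol_fun_subset[OF hol_fun_det_jac[OF G open_ball]]) (use sub in blast)
    show "norm (det (jac (G n) z)) \<le> card {p. p permutes (UNIV :: 'n set)} * (M / (1 - s)) ^ CARD('n)"
      if "z \<in> ball 0 s" for n z by (rule norm_det_le[OF bd[OF that]])
    show "(\<lambda>n. det (jac (G n) z)) \<longlonglongrightarrow> det (jac g z)" if "z \<in> ball 0 s" for z
      by (intro tendsto_det holomorphic_on_cn_limit(2)[of "ball 0 1" G M] open_ball G M lim sub[OF that])
  qed (use nz sub g0 s in auto)
qed

text \<open>The maps \<open>F n\<close> cover the whole unit ball and may exceed it slightly. Hence
  their bounds \<open>\<rho> n\<close> only tend to 1, and \<open>GF\<close> is restricted to points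
  whose image is in the ball.\<close>

lemma biholomorphic_limit:
  fixes \<Omega> :: "(complex ^ 'n) set" and F G :: "nat \<Rightarrow> complex ^ 'n \<Rightarrow> complex ^ 'n"
  assumes "open \<Omega>" "connected \<Omega>" "bounded \<Omega>" "interior (closure \<Omega>) \<subseteq> \<Omega>" "p \<in> \<Omega>"
    and F: "\<And>n. holomorphic_on_cn (F n) \<Omega>" and F\<rho>: "\<And>n z. z \<in> \<Omega> \<Longrightarrow> norm (F n z) \<le> \<rho> n" and \<rho>: "\<rho> \<longlonglongrightarrow> 1"
    and Fp: "\<And>n. F n p = 0"
    and G: "\<And>n. holomorphic_on_cn (G n) (ball 0 1)" and G\<Omega>: "\<And>n w. w \<in> ball 0 1 \<Longrightarrow> G n w \<in> \<Omega>"
    and FG: "\<And>n w. w \<in> ball 0 1 \<Longrightarrow> F n (G n w) = w"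
    and GF: "\<And>n z. z \<in> \<Omega> \<Longrightarrow> F n z \<in> ball 0 1 \<Longrightarrow> G n (F n z) = z"
  shows "biholomorphic_cn \<Omega> (ball 0 1)"
proof -
  have "Bseq \<rho>" using \<rho> convergentI convergent_imp_Bseq by blast
  then obtain R where R: "\<And>n. norm (\<rho> n) \<le> R" unfolding Bseq_def by blast
  have FR: "norm (F n z) \<le> R" if "z \<in> \<Omega>" for n z using F\<rho>[OF that, of n] R[of n] by simp
  obtain M where M: "\<And>z. z \<in> \<Omega> \<Longrightarrow> norm z \<le> M" using \<open>bounded \<Omega>\<close> unfolding bounded_iff by blast
  obtain k1 f where k1: "strict_mono (k1 :: nat \<Rightarrow> nat)" "\<And>z. z \<in> \<Omega> \<Longrightarrow> (\<lambda>n. F (k1 n) z) \<longlonglongrightarrow> f z"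
  proof (rule montel_holomorphic_on_cn[of \<Omega> F R])
    fix k f assume "strict_mono (k :: nat \<Rightarrow> nat)" "\<And>z. z \<in> \<Omega> \<Longrightarrow> (\<lambda>n. F (k n) z) \<longlonglongrightarrow> f z"
    then show ?thesis by (rule that)
  qed (simp_all add: \<open>open \<Omega>\<close> F FR)
  obtain k2 g where k2: "strict_mono (k2 :: nat \<Rightarrow> nat)" "\<And>z. z \<in> ball 0 1 \<Longrightarrow> (\<lambda>n. G (k1 (k2 n)) z) \<longlonglongrightarrow> g z"
  proof (rule montel_holomorphic_on_cn[of "ball 0 1" "\<lambda>n. G (k1 n)" M])
    fix k g assume "strict_mono (k :: nat \<Rightarrow> nat)" "\<And>z. z \<in> ball 0 1 \<Longrightarrow> (\<lambda>n. G (k1 (k n)) z) \<longlonglongrightarrow> g z"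
    then show ?thesis by (rule that)
  next
    show "norm (G (k1 n) w) \<le> M" if "w \<in> ball 0 1" for n w by (rule M[OF G\<Omega>[OF that]])
  qed (simp_all add: G)
  define k where "k = (\<lambda>n. k1 (k2 n))"
  have "strict_mono k" using strict_mono_o[OF k1(1) k2(1)] by (simp add: k_def o_def)
  have flim: "(\<lambda>n. F (k n) z) \<longlonglongrightarrow> f z" if "z \<in> \<Omega>" for z
    using LIMSEQ_subseq_LIMSEQ[OF k1(2)[OF that] k2(1)] by (simp add: k_def o_def)
  have glim: "(\<lambda>n. G (k n) z) \<longlonglongrightarrow> g z" if "z \<in> ball 0 1" for z
    using k2(2)[OF that] by (simp add: k_def)
  have GM: "norm (G n w) \<le> M" if "w \<in> ball 0 1" for n w using M[OF G\<Omega>[OF that]] .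
  have f: "holomorphic_on_cn f \<Omega>" and
    jf: "\<And>z i l. z \<in> \<Omega> \<Longrightarrow> (\<lambda>n. jac (F (k n)) z $ i $ l) \<longlonglongrightarrow> jac f z $ i $ l"
    using holomorphic_on_cn_limit[of \<Omega> "\<lambda>n. F (k n)" R f] \<open>open \<Omega>\<close> F FR flim by blast+
  have g: "holomorphic_on_cn g (ball 0 1)" and
    jg: "\<And>z i l. z \<in> ball 0 1 \<Longrightarrow> (\<lambda>n. jac (G (k n)) z $ i $ l) \<longlonglongrightarrow> jac g z $ i $ l"
    using holomorphic_on_cn_limit[of "ball 0 1" "\<lambda>n. G (k n)" M g] open_ball G GM glim by blast+
  have "f p = 0" using LIMSEQ_unique[OF flim[OF \<open>p \<in> \<Omega>\<close>]] by (simp add: Fp)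
  have "norm (f z) \<le> 1" if "z \<in> \<Omega>" for z
  proof (rule LIMSEQ_le)
    show "(\<lambda>n. norm (F (k n) z)) \<longlonglongrightarrow> norm (f z)" by (rule tendsto_norm[OF flim[OF that]])
    show "(\<lambda>n. \<rho> (k n)) \<longlonglongrightarrow> 1" using LIMSEQ_subseq_LIMSEQ[OF \<rho> \<open>strict_mono k\<close>] by (simp add: o_def)
  qed (use F\<rho>[OF that] in auto)
  then have f1: "f z \<in> ball 0 1" if "z \<in> \<Omega>" for z
    using norm_less_one_on_connected[OF assms(1,2,5) that f] \<open>f p = 0\<close> by simp
  have G0: "G n 0 = p" for n using GF[OF \<open>p \<in> \<Omega>\<close>, of n] Fp[of n] by simp
  have dFG: "det (jac (F n) (G n w)) * det (jac (G n) w) = 1" if "w \<in> ball 0 1" for n w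
    by (rule det_jac_right_inverse[OF F G _ open_ball that FG]) (use G\<Omega> in auto)
  \<comment> \<open>The determinants at \<open>p\<close> and at 0 have product 1 for every
    \<open>n\<close>, and so do their limits; this prevents the limit of the inverses from
    degenerating at 0.\<close>
  have "(\<lambda>n. det (jac (F (k n)) p) * det (jac (G (k n)) 0)) \<longlonglongrightarrow> det (jac f p) * det (jac g 0)"
    by (intro tendsto_mult tendsto_det jf jg \<open>p \<in> \<Omega>\<close>) simp
  moreover have "det (jac (F (k n)) p) * det (jac (G (k n)) 0) = 1" for n using dFG[of 0 "k n"] by (simp add: G0)
  ultimately have "(\<lambda>n. 1) \<longlonglongrightarrow> det (jac f p) * det (jac g 0)" by simp
  from LIMSEQ_unique[OF this tendsto_const] have "det (jac f p) * det (jac g 0) = 1" .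
  then have g0: "det (jac g 0) \<noteq> 0" by auto
  have dg: "det (jac g w) \<noteq> 0" if "w \<in> ball 0 1" for w
  proof (rule limit_det_jac_nonzero[of "\<lambda>n. G (k n)" M g])
    show "det (jac (G (k n)) z) \<noteq> 0" if "z \<in> ball 0 1" for n z using dFG[OF that, of "k n"] by auto
  qed (use G GM glim g0 that in blast)+
  have gcl: "g w \<in> closure \<Omega>" if "w \<in> ball 0 1" for w
    unfolding closure_sequential
    by (intro exI[of _ "\<lambda>n. G (k n) w"] conjI allI G\<Omega> glim that)
  have g\<Omega>: "g w \<in> \<Omega>" if w: "w \<in> ball 0 1" for w
  proof -
    obtain U where U: "open U" "w \<in> U" "U \<subseteq> ball 0 1" "inj_on g U"
      using holomorphic_locally_injective[OF g open_ball w dg[OF w]] by metis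
    have "continuous_on U g"
      using holomorphic_on_cn_imp_continuous[OF g] U(3) continuous_on_subset by blast
    then have "open (g ` U)" by (rule invariance_of_domain[OF _ U(1,4)])
    moreover have "g ` U \<subseteq> closure \<Omega>" using gcl U(3) by blast
    ultimately have "g ` U \<subseteq> interior (closure \<Omega>)" by (rule interior_maximal[rotated])
    then show ?thesis using U(2) assms(4) by blast
  qed
  have fg: "f (g w) = w" if w: "w \<in> ball 0 1" for w
  proof -
    have "(\<lambda>n. F (k n) (G (k n) w)) \<longlonglongrightarrow> f (g w)"
      by (rule tendsto_diagonal[of \<Omega> "\<lambda>n. F (k n)" R "g w"]) (use \<open>open \<Omega>\<close> F FR flim g\<Omega>[OF w] glim[OF w] in blast)+
    then show ?thesis using LIMSEQ_unique[of "\<lambda>n. w"] by (simp add: FG[OF w])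
  qed
  have gf: "g (f z) = z" if z: "z \<in> \<Omega>" for z
  proof -
    have "(\<lambda>n. G (k n) (F (k n) z)) \<longlonglongrightarrow> g (f z)"
      by (rule tendsto_diagonal[of "ball 0 1" "\<lambda>n. G (k n)" M "f z"]) (use open_ball G GM glim f1[OF z] flim[OF z] in blast)+
    \<comment> \<open>\<open>f z\<close> is in the open ball, so \<open>F (k n) z\<close> finally
      lies there too and \<open>GF\<close> becomes applicable.\<close>
    moreover have "\<forall>\<^sub>F n in sequentially. F (k n) z \<in> ball 0 1"
      by (rule topological_tendstoD[OF flim[OF z] open_ball f1[OF z]])
    then have "\<forall>\<^sub>F n in sequentially. G (k n) (F (k n) z) = z"
      by (rule eventually_mono) (rule GF[OF z])
    then have "(\<lambda>n. G (k n) (F (k n) z)) \<longlonglongrightarrow> z" by (rule tendsto_eventually)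
    ultimately show ?thesis by (rule LIMSEQ_unique)
  qed
  have "f ` \<Omega> = ball 0 1" using f1 g\<Omega> fg by (metis (no_types, lifting) image_eqI image_subsetI subsetI subset_antisym)
  moreover have "g ` ball 0 1 = \<Omega>" using f1 g\<Omega> gf by (metis (no_types, lifting) image_eqI image_subsetI subsetI subset_antisym)
  ultimately show ?thesis unfolding biholomorphic_cn_def using f g fg gf by blast
qed

theorem theorem1p2:
  fixes \<Omega> :: "(complex ^ 'n) set"
  assumes "domain_cn \<Omega>" and "bounded \<Omega>" and "C2_boundary \<Omega>"
    and "\<not> (\<exists>c>0. \<forall>z\<in>\<Omega>. squeezing \<Omega> z \<le> 1 - c * infdist z (frontier \<Omega>))"
  shows "biholomorphic_cn \<Omega> (ball 0 1)"
proof -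
  have \<Omega>: "open \<Omega>" "connected \<Omega>" "\<Omega> \<noteq> {}" using assms(1) unfolding domain_cn_def by auto
  then obtain p where p: "p \<in> \<Omega>" by blast
  \<comment> \<open>The shift by 2 keeps \<open>r n\<close> strictly between 0 and 1 from
    \<open>n = 0\<close> on.\<close>
  define r where "r n = 1 - 1 / real (n + 2)" for n
  have r: "0 < r n" "r n < 1" for n by (simp_all add: r_def)
  have "\<exists>f :: complex ^ 'n \<Rightarrow> complex ^ 'n. holomorphic_on_cn f \<Omega> \<and> inj_on f \<Omega> \<and> f ` \<Omega> \<subseteq> ball 0 1 \<and> f p = 0 \<and> ball 0 (r n) \<subseteq> f ` \<Omega>" for n
  proof -
    have "0 < 1 - r n" "1 - r n < 1" using r[of n] by simp_all
    then show ?thesis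
    proof (rule almost_onto_ball[OF \<Omega>(1,2) assms(2,3) p assms(4)])
      fix f :: "complex ^ 'n \<Rightarrow> complex ^ 'n"
      assume "holomorphic_on_cn f \<Omega>" "inj_on f \<Omega>" "f ` \<Omega> \<subseteq> ball 0 1" "f p = 0" "ball 0 (1 - (1 - r n)) \<subseteq> f ` \<Omega>"
      then show ?thesis by (intro exI[of _ f]) simp
    qed
  qed
  then obtain f :: "nat \<Rightarrow> complex ^ 'n \<Rightarrow> complex ^ 'n" where f: "\<And>n. holomorphic_on_cn (f n) \<Omega>" "\<And>n. inj_on (f n) \<Omega>" "\<And>n. f n ` \<Omega> \<subseteq> ball 0 1"
    "\<And>n. f n p = 0" "\<And>n. ball 0 (r n) \<subseteq> f n ` \<Omega>" by metis
  \<comment> \<open>Scaling by \<open>1 / r n\<close> enlarges the covered ball to the unit ball, so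
    that all inverses share one domain.\<close>
  define F where "F n z = complex_of_real (1 / r n) *s f n z" for n z
  define G where "G n w = inv_into \<Omega> (f n) (complex_of_real (r n) *s w)" for n w
  have sm: "complex_of_real (r n) *s w \<in> f n ` \<Omega>" if "w \<in> ball 0 1" for n w
    by (rule subsetD[OF f(5)]) (use that r[of n] in \<open>simp add: norm_cscale\<close>)
  have sc: "holomorphic_on_cn (\<lambda>w. c *s w) S" for c :: complex and S :: "(complex ^ 'n) set"
    unfolding holomorphic_on_cn_iff vector_smult_component
    by (intro allI hol_fun_mult hol_fun_const hol_fun_component)
  have rr: "complex_of_real (r n) *s (complex_of_real (1 / r n) *s w) = w"
    "complex_of_real (1 / r n) *s (complex_of_real (r n) *s w) = w" for n and w :: "complex ^ 'n"
    using r(1)[of n] by (simp_all add: vec_eq_iff)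
  show ?thesis
  proof (rule biholomorphic_limit[OF \<Omega>(1,2) assms(2) C2_boundary_interior_closure[OF \<Omega>(1) assms(3)] p,
        where F=F and G=G and \<rho>="\<lambda>n. 1 / r n"])
    show "holomorphic_on_cn (F n) \<Omega>" for n
      unfolding F_def by (rule holomorphic_on_cn_compose[OF sc f(1) subset_UNIV])
    show "norm (F n z) \<le> 1 / r n" if "z \<in> \<Omega>" for n z
    proof -
      have "f n z \<in> ball 0 1" using f(3) that by blast
      then show ?thesis using r[of n] by (simp add: F_def norm_cscale norm_divide divide_right_mono)
    qed
    have "r \<longlonglongrightarrow> 1 - 0" unfolding r_def
      by (intro tendsto_diff tendsto_const LIMSEQ_ignore_initial_segment[OF lim_1_over_n])
    then show "(\<lambda>n. 1 / r n) \<longlonglongrightarrow> 1" using tendsto_divide[OF tendsto_const, of r 1 sequentially 1] by simp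
    show "F n p = 0" for n by (simp add: F_def f(4))
    show "holomorphic_on_cn (G n) (ball 0 1)" for n
      unfolding G_def
      by (rule holomorphic_on_cn_compose[OF injective_holomorphic_inverse(1)[OF f(1) \<Omega>(1) f(2)] sc])
         (use sm in blast)
    fix n
    show "G n w \<in> \<Omega>" if "w \<in> ball 0 1" for w unfolding G_def by (rule inv_into_into[OF sm[OF that]])
    show "F n (G n w) = w" if "w \<in> ball 0 1" for w
      unfolding F_def G_def f_inv_into_f[OF sm[OF that]] by (rule rr)
    show "G n (F n z) = z" if "z \<in> \<Omega>" for z
      unfolding F_def G_def rr by (rule inv_into_f_f[OF f(2) that])
  qed
qed

end
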